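(* Let $m\ge1$. There exist constants $C_1,C_2>0$, independent of the mesh size $h$, such that for every $v_h\in U_h^0$, $$\|v_h\|_{\mathrm{DG}}\le C_1\|\mathcal{R}^mv_h\|_{\mathrm{DG}}\qquad\text{and}\qquad \|\mathcal{R}^mv_h\|_{\mathrm{DG}}\le C_2\,\overline{\Lambda}_m\,\|v_h\|_{\mathrm{DG}}.$$
   Context: **Mesh.** $\Omega\subset\mathbb{R}^d$ ($d=2,3$) is a bounded convex polygonal (polyhedral) domain, and $\mathcal{T}_h$ is a triangulation of $\Omega$ into simplices. $\mathcal{E}_h$ is the set of all $(d-1)$-dimensional faces, interior and boundary. Put $h_K=\mathrm{diam}(K)$, $h_e=\mathrm{diam}(e)$, let $\rho_K$ be the radius of the largest ball inscribed in $K$, and set $h=\max_Kh_K$, $\rho=\min_K\rho_K$. The mesh is quasi-uniform: $h\le C_\sigma\rho$ with a fixed constant $C_\sigma>0$. $\boldsymbol{x}_K$ is the barycenter of $K$. $\mathbb{P}_m(D)$ is the space of polynomials of total degree at most $m$ on $D$. **Patches.** Fix an integer threshold $\#S$. For $K\in\mathcal{T}_h$ let $\Delta(K)=\{K'\in\mathcal{T}_h:\overline K\cap\overline{K'}\ne\varnothing\}$, $S_0(K)=\{K\}$, $S_t(K)=\bigcup_{K'\in S_{t-1}(K)}\Delta(K')$ for $t\ge1$, and let $S(K)=S_t(K)$ for the first $t$ such that the number of elements of $S_t(K)$ is at least $\#S$. $S(K)$ also denotes the region covered by its elements, and $\#S(K)$ is its number of elements. Let $I(K)=\{\boldsymbol{x}_{K'}:K'\in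 S(K)\}$. Standing assumption: for every $K\in\mathcal{T}_h$, if $p\in\mathbb{P}_m(S(K))$ vanishes at all points of $I(K)$, then $p=0$. **Reconstruction.** $U_h^0$ is the space of functions constant on each element of $\mathcal{T}_h$. For $v_h\in U_h^0$ and $K\in\mathcal{T}_h$, $\mathcal{R}_K^mv_h\in\mathbb{P}_m(S(K))$ is the unique minimizer of $\sum_{\boldsymbol{x}\in I(K)}(p(\boldsymbol{x})-v_h(\boldsymbol{x}))^2$ over $p\in\mathbb{P}_m(S(K))$ subject to $p(\boldsymbol{x}_K)=v_h(\boldsymbol{x}_K)$. The operator $\mathcal{R}^m$ maps $v_h$ to the piecewise polynomial with $(\mathcal{R}^mv_h)|_K=(\mathcal{R}_K^mv_h)|_K$ for all $K$. Define $$\Lambda(m,K)=\max_{0\ne p\in\mathbb{P}_m(S(K))}\frac{\max_{\boldsymbol{x}\in S(K)}|p(\boldsymbol{x})|}{\max_{\boldsymbol{x}\in I(K)}|p(\boldsymbol{x})|},\quad \Lambda_m=\max_{K\in\mathcal{T}_h}\Lambda(m,K),\quad \overline{\Lambda}_m=\max_{K\in\mathcal{T}_h}\big(1+\Lambda_m\sqrt{\#S(K)}\big).$$ **Norm.** On an interior face shared by $K^\pm$ with unit outward normals $\boldsymbol{n}^\pm$, $[\![v]\!]=v^+\boldsymbol{n}^++v^-\boldsymbol{n}^-$; on a boundary face with unit outward normal $\boldsymbol{n}$, $[\![v]\!]=v\boldsymbol{n}$. For a piecewise polynomial $v$, $$\|v\|_{\mathrm{DG}}^2=\sum_{K\in\mathcal{T}_h}\|\nabla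 v\|_{L^2(K)}^2+\sum_{e\in\mathcal{E}_h}h_e^{-1}\|[\![v]\!]\|_{L^2(e)}^2.$$ **Constants.** The data $\Omega,d,m,\#S,C_\sigma$ are fixed. Constants may depend on them but are the same for all triangulations $\mathcal{T}_h$ of $\Omega$ into simplices that are quasi-uniform with $h\le C_\sigma\rho$ and whose patches $S(K)$, built with threshold $\#S$, satisfy the standing assumption that, for every $K\in\mathcal{T}_h$, any $p\in\mathbb{P}_m(S(K))$ vanishing at all points of $I(K)$ is $0$; in particular they are independent of $h$ and of $v_h$. *)

theory Defs
  imports "HOL-Analysis.Analysis"
begin

section \<open>Meshes\<close>

text \<open>
  A domain is a nonempty open connected set (connectedness follows from convexity). Mesh elements
  are closed simplices of full dimension; conformity is part of the library's \<^const>\<open>triangulation\<close>.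
\<close>

definition convex_polytopal_domain :: "(real^'n) set \<Rightarrow> bool" where
  "convex_polytopal_domain \<Omega> \<longleftrightarrow>
     open \<Omega> \<and> \<Omega> \<noteq> {} \<and> bounded \<Omega> \<and> convex \<Omega> \<and> polytope (closure \<Omega>)"

definition simplicial_mesh :: "(real^'n) set \<Rightarrow> (real^'n) set set \<Rightarrow> bool" where
  "simplicial_mesh \<Omega> \<T> \<longleftrightarrow>
     triangulation \<T> \<and> (\<forall>K\<in>\<T>. int CARD('n) simplex K) \<and> \<Union>\<T> = closure \<Omega>"

definition faces :: "(real^'n) set set \<Rightarrow> (real^'n) set set" where
  "faces \<T> = {e. \<exists>K\<in>\<T>. e facet_of K}"

definition inradius :: "(real^'n) set \<Rightarrow> real" where
  "inradius K = Sup {r. 0 \<le> r \<and> (\<exists>x. cball x r \<subseteq> K)}"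

definition mesh_size :: "(real^'n) set set \<Rightarrow> real" where
  "mesh_size \<T> = Max (diameter ` \<T>)"

definition min_inradius :: "(real^'n) set set \<Rightarrow> real" where
  "min_inradius \<T> = Min (inradius ` \<T>)"

definition quasi_uniform :: "real \<Rightarrow> (real^'n) set set \<Rightarrow> bool" where
  "quasi_uniform C\<sigma> \<T> \<longleftrightarrow> mesh_size \<T> \<le> C\<sigma> * min_inradius \<T>"

definition vertices :: "(real^'n) set \<Rightarrow> (real^'n) set" where
  "vertices K = {x. x extreme_point_of K}"

definition barycenter :: "(real^'n) set \<Rightarrow> real^'n" where
  "barycenter K = (\<Sum>x\<in>vertices K. x) /\<^sub>R real (card (vertices K))"


section \<open>Polynomials\<close>

text \<open>
  Polynomials of total degree at most \<open>m\<close>, as functions on the whole space. A polynomial on a set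
  with nonempty interior (such as a patch) extends uniquely, so the space of polynomials on such a
  set is identified with this one. Multi-indices are functions \<open>\<alpha> :: 'n \<Rightarrow> nat\<close>.
\<close>

definition poly_space :: "nat \<Rightarrow> (real^'n \<Rightarrow> real) set" where
  "poly_space m =
     {p. \<exists>c. p = (\<lambda>x. \<Sum>\<alpha> | sum \<alpha> UNIV \<le> m. c \<alpha> * (\<Prod>i\<in>UNIV. x $ i ^ \<alpha> i))}"


section \<open>Patches\<close>

definition neighbours :: "(real^'n) set set \<Rightarrow> (real^'n) set \<Rightarrow> (real^'n) set set" where
  "neighbours \<T> K = {K'\<in>\<T>. K \<inter> K' \<noteq> {}}"

primrec layer :: "(real^'n) set set \<Rightarrow> nat \<Rightarrow> (real^'n) set \<Rightarrow> (real^'n) set set" where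
  "layer \<T> 0 K = {K}"
| "layer \<T> (Suc t) K = (\<Union>K'\<in>layer \<T> t K. neighbours \<T> K')"

text \<open>
  The patch construction with threshold \<open>N\<close> terminates. This makes the \<open>LEAST\<close> in \<open>patch\<close> below
  meaningful; it fails only for meshes having fewer than \<open>N\<close> elements.
\<close>

definition patches_exist :: "nat \<Rightarrow> (real^'n) set set \<Rightarrow> bool" where
  "patches_exist N \<T> \<longleftrightarrow> (\<forall>K\<in>\<T>. \<exists>t. N \<le> card (layer \<T> t K))"

definition patch :: "nat \<Rightarrow> (real^'n) set set \<Rightarrow> (real^'n) set \<Rightarrow> (real^'n) set set" where
  "patch N \<T> K = layer \<T> (LEAST t. N \<le> card (layer \<T> t K)) K"

definition nodes :: "nat \<Rightarrow> (real^'n) set set \<Rightarrow> (real^'n) set \<Rightarrow> (real^'n) set" where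
  "nodes N \<T> K = barycenter ` patch N \<T> K"

definition unisolvent :: "nat \<Rightarrow> nat \<Rightarrow> (real^'n) set set \<Rightarrow> bool" where
  "unisolvent m N \<T> \<longleftrightarrow>
     (\<forall>K\<in>\<T>. \<forall>p\<in>poly_space m.
        (\<forall>x\<in>nodes N \<T> K. p x = 0) \<longrightarrow> (\<forall>x\<in>\<Union>(patch N \<T> K). p x = 0))"


section \<open>Reconstruction\<close>

text \<open>
  Piecewise functions are functions on the whole space whose values on the mesh skeleton are
  irrelevant: being piecewise constant only refers to the element interiors, which contain the
  barycenters, and one-sided values on faces are taken as limits from the element interiors.
\<close>

definition piecewise_const :: "(real^'n) set set \<Rightarrow> (real^'n \<Rightarrow> real) set" where
  "piecewise_const \<T> = {v. \<forall>K\<in>\<T>. v constant_on interior K}"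

definition reconstruction_on ::
    "nat \<Rightarrow> nat \<Rightarrow> (real^'n) set set \<Rightarrow> (real^'n \<Rightarrow> real) \<Rightarrow> (real^'n) set \<Rightarrow> (real^'n \<Rightarrow> real)" where
  "reconstruction_on m N \<T> v K =
     (THE p. p \<in> poly_space m \<and> p (barycenter K) = v (barycenter K) \<and>
        (\<forall>q\<in>poly_space m. q (barycenter K) = v (barycenter K) \<longrightarrow>
           (\<Sum>x\<in>nodes N \<T> K. (p x - v x)\<^sup>2) \<le> (\<Sum>x\<in>nodes N \<T> K. (q x - v x)\<^sup>2)))"

definition reconstruction ::
    "nat \<Rightarrow> nat \<Rightarrow> (real^'n) set set \<Rightarrow> (real^'n \<Rightarrow> real) \<Rightarrow> (real^'n \<Rightarrow> real)" where
  "reconstruction m N \<T> v x =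
     (if \<exists>K\<in>\<T>. x \<in> interior K
      then reconstruction_on m N \<T> v (THE K. K \<in> \<T> \<and> x \<in> interior K) x
      else 0)"

text \<open>
  The suprema below are maxima: patches are compact, and for a unisolvent mesh the quotient is
  bounded on the finite-dimensional polynomial space and attains its supremum.
\<close>

definition \<Lambda>_elem :: "nat \<Rightarrow> nat \<Rightarrow> (real^'n) set set \<Rightarrow> (real^'n) set \<Rightarrow> real" where
  "\<Lambda>_elem m N \<T> K =
     (SUP p\<in>{p\<in>poly_space m. p \<noteq> (\<lambda>x. 0)}.
        (SUP x\<in>\<Union>(patch N \<T> K). \<bar>p x\<bar>) / Max ((\<lambda>x. \<bar>p x\<bar>) ` nodes N \<T> K))"

definition \<Lambda>_max :: "nat \<Rightarrow> nat \<Rightarrow> (real^'n) set set \<Rightarrow> real" where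
  "\<Lambda>_max m N \<T> = Max (\<Lambda>_elem m N \<T> ` \<T>)"

definition \<Lambda>_bar :: "nat \<Rightarrow> nat \<Rightarrow> (real^'n) set set \<Rightarrow> real" where
  "\<Lambda>_bar m N \<T> = Max ((\<lambda>K. 1 + \<Lambda>_max m N \<T> * sqrt (real (card (patch N \<T> K)))) ` \<T>)"


section \<open>The DG norm\<close>

definition gradient :: "(real^'n \<Rightarrow> real) \<Rightarrow> real^'n \<Rightarrow> real^'n" where
  "gradient v x = (\<chi> i. frechet_derivative v (at x) (axis i 1))"

definition trace_from :: "(real^'n) set \<Rightarrow> (real^'n \<Rightarrow> real) \<Rightarrow> real^'n \<Rightarrow> real" where
  "trace_from K v x = Lim (at x within interior K) v"

definition outward_normal :: "(real^'n) set \<Rightarrow> (real^'n) set \<Rightarrow> real^'n" where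
  "outward_normal K e =
     (THE n. norm n = 1 \<and> (\<forall>x\<in>e. \<forall>y\<in>e. n \<bullet> (x - y) = 0) \<and> (\<forall>x\<in>K. \<forall>y\<in>e. n \<bullet> (x - y) \<le> 0))"

text \<open>
  The sum ranges over the two elements sharing an interior face, or over the single element
  containing a boundary face.
\<close>

definition jump :: "(real^'n) set set \<Rightarrow> (real^'n \<Rightarrow> real) \<Rightarrow> (real^'n) set \<Rightarrow> real^'n \<Rightarrow> real^'n" where
  "jump \<T> v e x = (\<Sum>K | K \<in> \<T> \<and> e facet_of K. trace_from K v x *\<^sub>R outward_normal K e)"

text \<open>
  Surface measure: Lebesgue measure on the affine hull of a (flat) face, transported from
  orthonormal coordinates \<open>B\<close> with origin \<open>a\<close>. By isometry invariance it depends neither on \<open>B\<close>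
  nor on \<open>a\<close>.
\<close>

definition face_basis :: "(real^'n) set \<Rightarrow> (real^'n) set" where
  "face_basis e = (SOME B. pairwise orthogonal B \<and> (\<forall>b\<in>B. norm b = 1) \<and>
                           span B = span {x - y | x y. x \<in> e \<and> y \<in> e})"

definition face_measure :: "(real^'n) set \<Rightarrow> (real^'n) measure" where
  "face_measure e =
     (let B = face_basis e; a = (SOME a. a \<in> e)
      in distr (\<Pi>\<^sub>M b\<in>B. lborel) borel (\<lambda>f. a + (\<Sum>b\<in>B. f b *\<^sub>R b)))"

definition dg_norm :: "(real^'n) set set \<Rightarrow> (real^'n \<Rightarrow> real) \<Rightarrow> real" where
  "dg_norm \<T> v =
     sqrt ((\<Sum>K\<in>\<T>. set_lebesgue_integral lborel (interior K) (\<lambda>x. (norm (gradient v x))\<^sup>2)) +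
           (\<Sum>e\<in>faces \<T>. inverse (diameter e) *
              set_lebesgue_integral (face_measure e) e (\<lambda>x. (norm (jump \<T> v e x))\<^sup>2)))"

end

theory Submission
  imports Defs
begin

text \<open>
  Write \<open>v\<^sub>K\<close> for the value of a piecewise constant \<open>v\<close> on an element \<open>K\<close> and \<open>p\<^sub>K\<close> for the
  polynomial that the reconstruction attaches to \<open>K\<close>. Elementwise gradients of \<open>v\<close> vanish, so
  \<open>\<parallel>v\<parallel>\<^sup>2\<close> is the jump part alone, while \<open>\<parallel>Rv\<parallel>\<^sup>2\<close> consists of the gradients of the \<open>p\<^sub>K\<close> and of
  their jumps. Both inequalities follow from one comparison: if \<open>\<bar>p\<^sub>K - v\<^sub>K\<bar> \<le> s\<^sub>K\<close> on \<open>K\<close>, then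
  replacing one family by the other changes the squared jump part by at most a factor \<open>2\<close> and a
  term of order \<open>r\<^sup>d\<^sup>-\<^sup>2 \<Sum>\<^sub>K s\<^sub>K\<^sup>2\<close>, because a face of a mesh of size \<open>r\<close> has area of order \<open>r\<^sup>d\<^sup>-\<^sup>1\<close>
  and diameter of order \<open>r\<close> (\<open>jump_energy_perturbation\<close>). It remains to choose \<open>s\<^sub>K\<close>.

  For the first inequality, the constraint \<open>p\<^sub>K(x\<^sub>K) = v\<^sub>K\<close> makes \<open>p\<^sub>K - v\<^sub>K\<close> an oscillation of \<open>p\<^sub>K\<close>
  on \<open>K\<close>. On a space of polynomials of bounded degree all norms are equivalent, and scaling to the
  unit ball turns this into \<open>r\<^sup>d\<^sup>-\<^sup>2 s\<^sub>K\<^sup>2 \<le> C \<parallel>\<nabla>p\<^sub>K\<parallel>\<^sup>2\<close> (\<open>poly_oscillation_le_gradient\<close>).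

  For the second one, the constant \<open>v\<^sub>K\<close> competes in the least squares problem. Comparing with it
  bounds \<open>p\<^sub>K - v\<^sub>K\<close> at the nodes, and then, by the definition of \<open>\<Lambda>\<close>, on all of \<open>K\<close>, by
  \<open>2 \<Lambda>_bar\<close> times the largest difference \<open>v\<^sub>K - v\<^sub>K\<^sub>'\<close> over the patch (\<open>local_rec_stable\<close>). Gradients are
  controlled by the inverse inequality \<open>poly_inverse_inequality\<close>. A difference over the patch
  is a sum of differences across faces along a chain of elements (\<open>face_path\<close>): a segment between
  two elements in general position avoids the intersections of elements of codimension two, so it
  passes from element to element through facets. Volume counting bounds the length of the chains and
  the number of chains using a given face (\<open>card_elems_in_ball\<close>). Finally, the difference across
  a face is the full jump there, as the two outward normals are opposite, and the face is not too
  small (\<open>opposite_normals\<close>, \<open>face_measure_bounds\<close>).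

  The length \<open>r\<close> is a fixed fraction of the mesh size such that every element contains a ball of
  radius \<open>r\<close> and has diameter at most \<open>\<kappa> r\<close>. All constants depend on \<open>\<kappa>\<close>, the degree, the threshold
  and the dimension only.
\<close>


section \<open>Coercivity of definite forms on coefficients\<close>

text \<open>
  Coefficient vectors are functions on a possibly infinite index type; those supported in \<open>A\<close> and
  bounded by \<open>R\<close> form a product of compact sets, so Tychonoff's theorem applies.
\<close>
lemma compact_coefficient_box:
  "compact {c :: 'a \<Rightarrow> real. (\<forall>\<alpha>\<in>A. \<bar>c \<alpha>\<bar> \<le> R) \<and> (\<forall>\<alpha>. \<alpha> \<notin> A \<longrightarrow> c \<alpha> = 0)}"
proof -
  let ?S = "\<lambda>\<alpha>. if \<alpha> \<in> A then {-R..R} else {0::real}"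
  have "compactin (product_topology (\<lambda>i. euclidean) UNIV) (PiE UNIV ?S)"
    by (subst compactin_PiE) auto
  moreover have "PiE UNIV ?S = {c. (\<forall>\<alpha>\<in>A. \<bar>c \<alpha>\<bar> \<le> R) \<and> (\<forall>\<alpha>. \<alpha> \<notin> A \<longrightarrow> c \<alpha> = 0)}"
    by (force simp: PiE_def Pi_def abs_le_iff split: if_splits)
  ultimately show ?thesis
    by (simp add: euclidean_product_topology compactin_euclidean_iff)
qed

text \<open>
  The minimum of \<open>F\<close> on the compact unit sphere of coefficient vectors supported in \<open>A\<close> is positive,
  and homogeneity carries this bound to all coefficients. This is the equivalence of norms in finite
  dimension, in a form that needs no type for the coefficient space.
\<close>
lemma definite_form_coercive:
  fixes F :: "('a \<Rightarrow> real) \<Rightarrow> real"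
  assumes A: "finite A" and cont: "continuous_on UNIV F"
    and hom: "\<And>t c. F (\<lambda>\<alpha>. t * c \<alpha>) = t\<^sup>2 * F c"
    and restr: "\<And>c. F (\<lambda>\<alpha>. if \<alpha> \<in> A then c \<alpha> else 0) = F c"
    and nonneg: "\<And>c. F c \<ge> 0"
    and def: "\<And>c. F c = 0 \<Longrightarrow> \<forall>\<alpha>\<in>A. c \<alpha> = 0"
  shows "\<exists>l>0. \<forall>c. l * (\<Sum>\<alpha>\<in>A. (c \<alpha>)\<^sup>2) \<le> F c"
proof -
  define S where "S = {c. (\<forall>\<alpha>\<in>A. \<bar>c \<alpha>\<bar> \<le> 1) \<and> (\<forall>\<alpha>. \<alpha> \<notin> A \<longrightarrow> c \<alpha> = 0)} \<inter> {c. (\<Sum>\<alpha>\<in>A. (c \<alpha>)\<^sup>2) = (1::real)}"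
  have "closed {c :: 'a \<Rightarrow> real. (\<Sum>\<alpha>\<in>A. (c \<alpha>)\<^sup>2) = 1}"
    by (intro closed_Collect_eq continuous_intros continuous_on_product_coordinates)
  then have "compact S"
    unfolding S_def by (intro compact_Int_closed compact_coefficient_box)
  have normalised: "(\<Sum>\<alpha>\<in>A. (c \<alpha>)\<^sup>2) = 0 \<or> (\<lambda>\<alpha>. if \<alpha> \<in> A then c \<alpha> / sqrt (\<Sum>\<alpha>\<in>A. (c \<alpha>)\<^sup>2) else 0) \<in> S" for c :: "'a \<Rightarrow> real"
  proof (cases "(\<Sum>\<alpha>\<in>A. (c \<alpha>)\<^sup>2) = 0")
    case False
    let ?s = "\<Sum>\<alpha>\<in>A. (c \<alpha>)\<^sup>2"
    have s: "?s > 0" using False sum_nonneg[of A "\<lambda>\<alpha>. (c \<alpha>)\<^sup>2"] by simp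
    have "\<bar>c \<alpha> / sqrt ?s\<bar> \<le> 1" if "\<alpha> \<in> A" for \<alpha>
    proof -
      have "(c \<alpha>)\<^sup>2 \<le> ?s" using A that by (intro member_le_sum) auto
      then have "\<bar>c \<alpha>\<bar> \<le> sqrt ?s" by (metis real_sqrt_abs real_sqrt_le_iff)
      then show ?thesis using s by (simp add: abs_divide)
    qed
    moreover have "(\<Sum>\<alpha>\<in>A. (c \<alpha> / sqrt ?s)\<^sup>2) = 1"
      using s by (simp add: power_divide flip: sum_divide_distrib)
    ultimately show ?thesis by (simp add: S_def)
  qed simp
  show ?thesis
  proof (cases "S = {}")
    case True
    then have "(\<Sum>\<alpha>\<in>A. (c \<alpha>)\<^sup>2) = 0" for c :: "'a \<Rightarrow> real" using normalised[of c] by blast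
    then show ?thesis using nonneg by (intro exI[of _ 1]) auto
  next
    case False
    obtain c0 where c0: "c0 \<in> S" "\<And>c. c \<in> S \<Longrightarrow> F c0 \<le> F c"
      using continuous_attains_inf[OF \<open>compact S\<close> False continuous_on_subset[OF cont]] by auto
    have "F c0 \<noteq> 0"
    proof
      assume "F c0 = 0"
      then have "(\<Sum>\<alpha>\<in>A. (c0 \<alpha>)\<^sup>2) = 0" using def by (simp add: sum_nonneg_eq_0_iff A)
      then show False using c0(1) by (simp add: S_def)
    qed
    then have pos: "F c0 > 0" using nonneg[of c0] by simp
    have "F c0 * (\<Sum>\<alpha>\<in>A. (c \<alpha>)\<^sup>2) \<le> F c" for c
    proof (cases "(\<Sum>\<alpha>\<in>A. (c \<alpha>)\<^sup>2) = 0")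
      case False
      let ?s = "\<Sum>\<alpha>\<in>A. (c \<alpha>)\<^sup>2"
      have s: "?s > 0" using False sum_nonneg[of A "\<lambda>\<alpha>. (c \<alpha>)\<^sup>2"] by simp
      have "F c0 \<le> F (\<lambda>\<alpha>. if \<alpha> \<in> A then c \<alpha> / sqrt ?s else 0)"
        using normalised[of c] False c0 by blast
      also have "\<dots> = F (\<lambda>\<alpha>. (1 / sqrt ?s) * c \<alpha>)"
        using restr[of "\<lambda>\<alpha>. c \<alpha> / sqrt ?s"] by simp
      also have "\<dots> = F c / ?s"
        using s by (simp only: hom) (simp add: power_divide)
      finally show ?thesis using s by (simp add: field_simps)
    qed (use nonneg in auto)
    then show ?thesis using pos by blast
  qed
qed


section \<open>Polynomials of bounded degree\<close>

definition multi_indices :: "nat \<Rightarrow> ('n::finite \<Rightarrow> nat) set" where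
  "multi_indices m = {\<alpha>. sum \<alpha> UNIV \<le> m}"

definition monomial :: "('n \<Rightarrow> nat) \<Rightarrow> real^'n \<Rightarrow> real" where
  "monomial \<alpha> x = (\<Prod>i\<in>UNIV. x $ i ^ \<alpha> i)"

definition poly_of :: "nat \<Rightarrow> (('n \<Rightarrow> nat) \<Rightarrow> real) \<Rightarrow> real^'n \<Rightarrow> real" where
  "poly_of m c x = (\<Sum>\<alpha>\<in>multi_indices m. c \<alpha> * monomial \<alpha> x)"

lemma poly_space_iff: "p \<in> poly_space m \<longleftrightarrow> (\<exists>c. p = poly_of m c)"
  by (simp add: poly_space_def poly_of_def[abs_def] multi_indices_def monomial_def)

lemma poly_of_in_poly_space [simp]: "poly_of m c \<in> poly_space m"
  by (auto simp: poly_space_iff)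

lemma finite_multi_indices [simp]: "finite (multi_indices m :: ('n::finite \<Rightarrow> nat) set)"
proof -
  have "multi_indices m \<subseteq> (PiE UNIV (\<lambda>_. {..m}) :: ('n \<Rightarrow> nat) set)"
  proof
    fix \<alpha> :: "'n \<Rightarrow> nat" assume "\<alpha> \<in> multi_indices m"
    then have "\<alpha> i \<le> m" for i
      using member_le_sum[of i UNIV \<alpha>] by (simp add: multi_indices_def)
    then show "\<alpha> \<in> PiE UNIV (\<lambda>_. {..m})" by auto
  qed
  then show ?thesis by (rule finite_subset) (simp add: finite_PiE)
qed

lemma poly_space_add: "p \<in> poly_space m \<Longrightarrow> q \<in> poly_space m \<Longrightarrow> (\<lambda>x. p x + q x) \<in> poly_space m"
proof -
  assume "p \<in> poly_space m" "q \<in> poly_space m"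
  then obtain c c' where "p = poly_of m c" "q = poly_of m c'" by (auto simp: poly_space_iff)
  then have "(\<lambda>x. p x + q x) = poly_of m (\<lambda>\<alpha>. c \<alpha> + c' \<alpha>)"
    by (auto simp: poly_of_def sum.distrib algebra_simps)
  then show ?thesis by simp
qed

lemma poly_space_scale: "p \<in> poly_space m \<Longrightarrow> (\<lambda>x. a * p x) \<in> poly_space m"
proof -
  assume "p \<in> poly_space m"
  then obtain c where "p = poly_of m c" by (auto simp: poly_space_iff)
  then have "(\<lambda>x. a * p x) = poly_of m (\<lambda>\<alpha>. a * c \<alpha>)"
    by (auto simp: poly_of_def sum_distrib_left algebra_simps)
  then show ?thesis by simp
qed

lemma poly_space_diff: "p \<in> poly_space m \<Longrightarrow> q \<in> poly_space m \<Longrightarrow> (\<lambda>x. p x - q x) \<in> poly_space m"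
  using poly_space_add[of p m "\<lambda>x. (-1) * q x"] poly_space_scale[of q m "-1"] by simp

lemma monomial_in_poly_space: "sum \<alpha> UNIV \<le> m \<Longrightarrow> monomial \<alpha> \<in> poly_space m"
proof -
  assume "sum \<alpha> UNIV \<le> m"
  then have "poly_of m (\<lambda>\<beta>. if \<beta> = \<alpha> then 1 else 0) = monomial \<alpha>"
    unfolding poly_of_def
    by (intro ext, subst sum.remove[of _ \<alpha>]) (auto simp: multi_indices_def finite_multi_indices[unfolded multi_indices_def])
  then show ?thesis by (metis poly_of_in_poly_space)
qed

lemma const_in_poly_space [simp]: "(\<lambda>x. a) \<in> poly_space m"
proof -
  have "monomial (\<lambda>_. 0) \<in> poly_space m" by (rule monomial_in_poly_space) simp
  from poly_space_scale[OF this, of a] show ?thesis by (simp add: monomial_def[abs_def])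
qed

lemma poly_space_sum: "(\<And>i. i \<in> I \<Longrightarrow> f i \<in> poly_space m) \<Longrightarrow> (\<lambda>x. \<Sum>i\<in>I. f i x) \<in> poly_space m"
  by (induction I rule: infinite_finite_induct) (auto intro: poly_space_add)

lemma poly_space_mult:
  assumes "p \<in> poly_space a" "q \<in> poly_space b"
  shows "(\<lambda>x. p x * q x) \<in> poly_space (a + b)"
proof -
  obtain c d where p: "p = poly_of a c" and q: "q = poly_of b d" using assms by (auto simp: poly_space_iff)
  have "(\<lambda>x. p x * q x) = (\<lambda>x. \<Sum>\<alpha>\<in>multi_indices a. \<Sum>\<beta>\<in>multi_indices b. (c \<alpha> * d \<beta>) * monomial (\<lambda>i. \<alpha> i + \<beta> i) x)"
    unfolding p q poly_of_def
    by (simp add: sum_product monomial_def power_add prod.distrib ac_simps)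
  also have "\<dots> \<in> poly_space (a + b)"
    by (intro poly_space_sum poly_space_scale monomial_in_poly_space)
       (auto simp: multi_indices_def sum.distrib add_mono)
  finally show ?thesis .
qed

lemma poly_space_power: "p \<in> poly_space 1 \<Longrightarrow> (\<lambda>x. p x ^ k) \<in> poly_space k"
  by (induction k) (use poly_space_mult[of p 1] in auto)

lemma poly_space_prod:
  "finite I \<Longrightarrow> (\<And>i. i \<in> I \<Longrightarrow> f i \<in> poly_space (d i)) \<Longrightarrow> (\<lambda>x. \<Prod>i\<in>I. f i x) \<in> poly_space (\<Sum>i\<in>I. d i)"
  by (induction I rule: finite_induct) (auto intro: poly_space_mult)

lemma poly_space_mono: "p \<in> poly_space k \<Longrightarrow> k \<le> m \<Longrightarrow> p \<in> poly_space m"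
  using poly_space_mult[of p k "\<lambda>x. 1" "m - k"] by simp

lemma coordinate_in_poly_space: "(\<lambda>x. x $ i) \<in> poly_space 1"
proof -
  have "monomial (\<lambda>j. if j = i then 1 else 0) \<in> poly_space 1"
    by (rule monomial_in_poly_space) simp
  also have "monomial (\<lambda>j. if j = i then 1 else 0) = (\<lambda>x::real^'a. x $ i)"
    by (auto simp: monomial_def fun_eq_iff if_distrib[of "\<lambda>k. _ ^ k"] prod.delta cong: if_cong)
  finally show ?thesis .
qed

text \<open>
  This invariance is what allows estimates on the unit ball to be scaled to balls of any centre and radius.
\<close>
lemma poly_space_affine_subst:
  assumes "p \<in> poly_space m" shows "(\<lambda>z. p (a + s *\<^sub>R z)) \<in> poly_space m"
proof -
  obtain c where p: "p = poly_of m c" using assms by (auto simp: poly_space_iff)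
  have coord: "(\<lambda>z. a $ i + s * z $ i) \<in> poly_space 1" for i
    by (intro poly_space_add poly_space_scale coordinate_in_poly_space const_in_poly_space)
  have "(\<lambda>z. \<Prod>i\<in>UNIV. (a $ i + s * z $ i) ^ \<alpha> i) \<in> poly_space m" if "\<alpha> \<in> multi_indices m" for \<alpha>
    using poly_space_mono[OF poly_space_prod[of UNIV "\<lambda>i z. (a $ i + s * z $ i) ^ \<alpha> i" \<alpha>]] poly_space_power[OF coord] that
    by (simp add: multi_indices_def)
  then show ?thesis
    unfolding p poly_of_def monomial_def by (intro poly_space_sum poly_space_scale) simp
qed

definition monomial_deriv :: "('n \<Rightarrow> nat) \<Rightarrow> 'n \<Rightarrow> real^'n \<Rightarrow> real" where
  "monomial_deriv \<alpha> i x = real (\<alpha> i) * monomial (\<alpha>(i := \<alpha> i - 1)) x"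

lemma monomial_has_derivative:
  "(monomial \<alpha> has_derivative (\<lambda>y. \<Sum>i\<in>UNIV. y $ i * monomial_deriv \<alpha> i x)) (at x)"
proof -
  have 1: "((\<lambda>x. x $ i ^ \<alpha> i) has_derivative (\<lambda>y. of_nat (\<alpha> i) * y $ i * x $ i ^ (\<alpha> i - 1))) (at x)" for i
    by (intro has_derivative_power bounded_linear_imp_has_derivative bounded_linear_vec_nth)
  have *: "(\<Prod>j\<in>UNIV. x $ j ^ (\<alpha>(i := \<alpha> i - 1)) j) = x $ i ^ (\<alpha> i - 1) * (\<Prod>j\<in>UNIV - {i}. x $ j ^ \<alpha> j)" for i
    by (subst prod.remove[of _ i]) (auto intro: prod.cong)
  show ?thesis
    unfolding monomial_def[abs_def]
    by (rule has_derivative_eq_rhs[OF has_derivative_prod[OF 1]])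
       (simp add: monomial_deriv_def monomial_def * fun_eq_iff ac_simps del: fun_upd_apply One_nat_def)
qed

lemma frechet_derivative_eq: "(f has_derivative f') (at x) \<Longrightarrow> frechet_derivative f (at x) = f'"
  by (metis frechet_derivative_at)

lemma poly_of_has_derivative:
  "(poly_of m c has_derivative (\<lambda>y. \<Sum>i\<in>UNIV. y $ i * (\<Sum>\<alpha>\<in>multi_indices m. c \<alpha> * monomial_deriv \<alpha> i x))) (at x)"
  unfolding poly_of_def[abs_def]
  by (rule has_derivative_eq_rhs[OF has_derivative_sum[OF has_derivative_mult_right[OF monomial_has_derivative]]])
     (simp add: fun_eq_iff sum_distrib_left sum.swap[of _ UNIV] ac_simps)

lemma gradient_poly_of: "gradient (poly_of m c) x $ i = (\<Sum>\<alpha>\<in>multi_indices m. c \<alpha> * monomial_deriv \<alpha> i x)"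
  unfolding gradient_def frechet_derivative_eq[OF poly_of_has_derivative]
  by (simp add: axis_def if_distrib[of "\<lambda>z. z * _"] sum.delta cong: if_cong)

lemma poly_has_derivative:
  assumes "p \<in> poly_space m"
  shows "(p has_derivative (\<lambda>y. gradient p x \<bullet> y)) (at x)"
proof -
  obtain c where p: "p = poly_of m c" using assms by (auto simp: poly_space_iff)
  show ?thesis
    using poly_of_has_derivative[of m c x] unfolding p inner_vec_def gradient_poly_of by (simp add: mult.commute)
qed

lemma partial_deriv_in_poly_space:
  fixes p :: "real^'n \<Rightarrow> real"
  assumes "p \<in> poly_space m" shows "(\<lambda>x. gradient p x $ i) \<in> poly_space m"
proof -
  obtain c where p: "p = poly_of m c" using assms by (auto simp: poly_space_iff)
  have "sum (\<alpha>(i := \<alpha> i - 1)) UNIV \<le> sum \<alpha> UNIV" for \<alpha> :: "'n \<Rightarrow> nat" and i by (rule sum_mono) auto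
  then show ?thesis
    unfolding p gradient_poly_of monomial_deriv_def
    by (intro poly_space_sum poly_space_scale monomial_in_poly_space) (auto simp: multi_indices_def intro: order_trans)
qed

lemma continuous_on_poly: "p \<in> poly_space m \<Longrightarrow> continuous_on S p"
  by (meson continuous_at_imp_continuous_on has_derivative_continuous poly_has_derivative)

lemma continuous_on_gradient_poly:
  assumes "p \<in> poly_space m" shows "continuous_on S (gradient p)"
proof -
  have "continuous_on S (\<lambda>x. \<chi> i. gradient p x $ i)"
    by (intro continuous_on_vec_lambda continuous_on_poly[OF partial_deriv_in_poly_space[OF assms]])
  then show ?thesis by simp
qed

lemma gradient_cong_open:
  assumes "open U" "x \<in> U" "\<And>y. y \<in> U \<Longrightarrow> f y = g y" "(g has_derivative g') (at x)"
  shows "gradient f x = gradient g x"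
proof -
  have "(f has_derivative g') (at x)"
    using has_derivative_transform_within_open[OF assms(4,1,2)] assms(3) by metis
  then show ?thesis using assms(4) by (simp add: gradient_def frechet_derivative_eq)
qed

lemma gradient_shift: assumes "p \<in> poly_space m" shows "gradient (\<lambda>x. p x - a) x = gradient p x"
proof -
  have "((\<lambda>x. p x - a) has_derivative (\<lambda>y. gradient p x \<bullet> y)) (at x)"
    using has_derivative_diff[OF poly_has_derivative[OF assms, of x] has_derivative_const[of a]] by simp
  then show ?thesis
    using frechet_derivative_eq[OF poly_has_derivative[OF assms, of x]]
    by (simp add: frechet_derivative_eq gradient_def[of "\<lambda>x. p x - a"] vec_eq_iff inner_axis)
qed

lemma gradient_affine_subst:
  assumes "p \<in> poly_space m" shows "gradient (\<lambda>z. p (a + s *\<^sub>R z)) z = s *\<^sub>R gradient p (a + s *\<^sub>R z)"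
proof -
  have "((\<lambda>z. p (a + s *\<^sub>R z)) has_derivative (\<lambda>y. gradient p (a + s *\<^sub>R z) \<bullet> (s *\<^sub>R y))) (at z)"
    by (rule has_derivative_compose[OF _ poly_has_derivative[OF assms]]) (auto intro!: derivative_eq_intros)
  then show ?thesis
    by (simp add: frechet_derivative_eq gradient_def[of "\<lambda>z. p (a + s *\<^sub>R z)"] vec_eq_iff inner_axis)
qed


section \<open>A polynomial function determines its coefficients\<close>

lemma poly_eq_0_if_zeros_interval:
  fixes P :: "real poly"
  assumes "\<delta> > 0" "\<And>t. 0 < t \<Longrightarrow> t < \<delta> \<Longrightarrow> poly P t = 0" shows "P = 0"
proof (rule ccontr)
  assume "P \<noteq> 0"
  then have "finite {0<..<\<delta>}"
    by (intro finite_subset[OF _ poly_roots_finite]) (use assms in auto)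
  then show False using assms(1) by (simp add: infinite_Ioo)
qed

text \<open>
  Restricted to the line through \<open>a\<close> and any point \<open>y\<close>, the function is a univariate polynomial with
  infinitely many zeros.
\<close>
lemma poly_space_zero_on_ball:
  assumes "p \<in> poly_space m" "e > 0" "\<And>x. x \<in> ball a e \<Longrightarrow> p x = 0"
  shows "p = (\<lambda>x. 0)"
proof
  fix y
  obtain c where p: "p = poly_of m c" using assms by (auto simp: poly_space_iff)
  define P where "P = (\<Sum>\<alpha>\<in>multi_indices m. smult (c \<alpha>) (\<Prod>i\<in>UNIV. [:a $ i, (y - a) $ i:] ^ \<alpha> i))"
  \<comment> \<open>The value at \<open>y\<close> is the one at the parameter \<open>t = 1\<close>.\<close>
  have P: "poly P t = p (a + t *\<^sub>R (y - a))" for t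
    by (simp add: P_def p poly_of_def monomial_def poly_sum poly_prod)
  have "P = 0"
  proof (rule poly_eq_0_if_zeros_interval)
    show "e / (1 + norm (y - a)) > 0" using assms by (simp add: add_pos_nonneg)
    fix t :: real assume t: "0 < t" "t < e / (1 + norm (y - a))"
    then have "t * (1 + norm (y - a)) < e"
      by (simp add: pos_less_divide_eq add_pos_nonneg)
    then have "t * norm (y - a) < e" using t by (simp add: algebra_simps)
    then show "poly P t = 0"
      unfolding P using t by (intro assms) (simp add: dist_norm)
  qed
  then show "p y = 0" using P[of 1] by simp
qed

lemma digits_unique:
  fixes f g :: "nat \<Rightarrow> nat"
  assumes "(\<Sum>k<n. f k * b ^ k) = (\<Sum>k<n. g k * b ^ k)" "\<And>k. k < n \<Longrightarrow> f k < b" "\<And>k. k < n \<Longrightarrow> g k < b" "k < n"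
  shows "f k = g k"
  using assms
proof (induction n arbitrary: f g k)
  case (Suc n)
  have split: "(\<Sum>k<Suc n. h k * b ^ k) = h 0 + b * (\<Sum>k<n. h (Suc k) * b ^ k)" for h
    by (subst sum.lessThan_Suc_shift) (simp add: sum_distrib_left ac_simps)
  have eq: "f 0 + b * (\<Sum>k<n. f (Suc k) * b ^ k) = g 0 + b * (\<Sum>k<n. g (Suc k) * b ^ k)"
    using Suc.prems(1) unfolding split .
  have lt: "f 0 < b" "g 0 < b" using Suc.prems(2,3) by auto
  have "f 0 = g 0"
    using arg_cong[OF eq, of "\<lambda>n. n mod b"] lt by simp
  moreover from this have "(\<Sum>k<n. f (Suc k) * b ^ k) = (\<Sum>k<n. g (Suc k) * b ^ k)"
    using eq lt by simp
  then have "f (Suc j) = g (Suc j)" if "j < n" for j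
    using Suc.IH[of "\<lambda>k. f (Suc k)" "\<lambda>k. g (Suc k)" j] Suc.prems(2,3) that by simp
  ultimately show ?case using Suc.prems(4) by (cases k) auto
qed simp

text \<open>
  Kronecker's substitution \<open>x\<^sub>i = t ^ ((m+1) ^ h i)\<close>, for an enumeration \<open>h\<close> of the coordinates, sends distinct
  monomials of degree at most \<open>m\<close> to distinct powers of \<open>t\<close>: the exponents \<open>\<alpha> i\<close> are the digits of
  the new exponent in base \<open>m+1\<close>. The claim is thereby reduced to one variable.
\<close>
lemma poly_of_eq_0_coefficients:
  fixes c :: "('n::finite \<Rightarrow> nat) \<Rightarrow> real"
  assumes "poly_of m c = (\<lambda>x. 0)" "\<alpha> \<in> multi_indices m"
  shows "c \<alpha> = 0"
proof -
  obtain h :: "'n \<Rightarrow> nat" where h: "bij_betw h UNIV {..<CARD('n)}"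
    using ex_bij_betw_finite_nat[OF finite_class.finite_UNIV] by (auto simp: atLeast0LessThan)
  define code where "code \<alpha> = (\<Sum>i\<in>UNIV. \<alpha> i * Suc m ^ h i)" for \<alpha> :: "'n \<Rightarrow> nat"
  have code: "code \<alpha> = (\<Sum>k<CARD('n). \<alpha> (inv h k) * Suc m ^ k)" for \<alpha>
    unfolding code_def using sum.reindex_bij_betw[OF h, of "\<lambda>k. \<alpha> (inv h k) * Suc m ^ k"]
    using h by (simp add: bij_betw_def)
  have inj: "inj_on code (multi_indices m)"
  proof (intro inj_onI ext)
    fix \<alpha> \<beta> :: "'n \<Rightarrow> nat" and i
    assume in': "\<alpha> \<in> multi_indices m" "\<beta> \<in> multi_indices m" "code \<alpha> = code \<beta>"
    have bd: "\<gamma> i < Suc m" if "\<gamma> \<in> multi_indices m" for \<gamma> :: "'n \<Rightarrow> nat" and i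
      using that member_le_sum[of i UNIV \<gamma>] by (simp add: multi_indices_def)
    have "\<alpha> (inv h (h i)) = \<beta> (inv h (h i))"
      by (rule digits_unique[where n="CARD('n)" and b="Suc m"])
         (use in' code bd h in \<open>auto simp: bij_betw_def\<close>)
    then show "\<alpha> i = \<beta> i" using h by (simp add: bij_betw_def)
  qed
  define P where "P = (\<Sum>\<alpha>\<in>multi_indices m. monom (c \<alpha>) (code \<alpha>))"
  have "poly P t = poly_of m c (\<chi> i. t ^ (Suc m ^ h i))" for t
    by (simp add: P_def poly_sum poly_monom poly_of_def monomial_def code_def power_sum mult.commute
        flip: power_mult)
  then have "P = 0" using assms(1) by (intro poly_eq_0_if_zeros_interval[of 1]) auto
  then have "0 = coeff P (code \<alpha>)" by simp
  also have "\<dots> = (\<Sum>\<beta>\<in>multi_indices m. if code \<beta> = code \<alpha> then c \<beta> else 0)"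
    by (simp add: P_def coeff_sum)
  also have "\<dots> = (\<Sum>\<beta>\<in>multi_indices m. if \<beta> = \<alpha> then c \<beta> else 0)"
    using inj assms(2) by (intro sum.cong) (auto simp: inj_on_def)
  also have "\<dots> = c \<alpha>" using assms(2) by (simp add: sum.delta)
  finally show ?thesis by simp
qed


section \<open>Bounds for the coefficients and by the coefficients\<close>

lemma poly_of_scale: "poly_of m (\<lambda>\<alpha>. t * c \<alpha>) x = t * poly_of m c x"
  by (simp add: poly_of_def sum_distrib_left ac_simps)

lemma poly_of_restrict: "poly_of m (\<lambda>\<alpha>. if \<alpha> \<in> multi_indices m then c \<alpha> else 0) = poly_of m c"
  by (auto simp: poly_of_def intro!: sum.cong)

lemma continuous_on_poly_of_coefficients: "continuous_on UNIV (\<lambda>c. poly_of m c x)"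
  unfolding poly_of_def by (intro continuous_intros continuous_on_product_coordinates)

lemma set_integrable_continuous:
  fixes f :: "'a::euclidean_space \<Rightarrow> real"
  assumes "continuous_on UNIV f" "bounded S" "S \<in> sets borel"
  shows "set_integrable lborel S f"
proof (rule set_integrable_subset)
  show "set_integrable lborel (closure S) f"
    unfolding set_integrable_def using assms
    by (intro borel_integrable_compact continuous_on_subset[OF assms(1)]) auto
qed (use assms closure_subset in auto)

lemma set_integral_sum:
  fixes f :: "'i \<Rightarrow> 'a \<Rightarrow> real"
  assumes "\<And>i. i \<in> I \<Longrightarrow> set_integrable M A (f i)"
  shows "set_lebesgue_integral M A (\<lambda>x. \<Sum>i\<in>I. f i x) = (\<Sum>i\<in>I. set_lebesgue_integral M A (f i))"
  using assms unfolding set_lebesgue_integral_def set_integrable_def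
  by (simp add: sum_distrib_left Bochner_Integration.integral_sum)

text \<open>
  The squared norm in \<open>L\<^sup>2\<close> of the unit ball is a definite form in the coefficients. Continuity is seen by expanding it
  as a finite sum with the Gram matrix of the monomials as coefficients.
\<close>
lemma L2_coefficient_bound:
  "\<exists>l>0. \<forall>c. l * (\<Sum>\<alpha>\<in>multi_indices m. (c \<alpha>)\<^sup>2) \<le>
     set_lebesgue_integral lborel (ball (0::real^'n) 1) (\<lambda>x. (poly_of m c x)\<^sup>2)"
proof (rule definite_form_coercive)
  let ?B = "ball (0::real^'n) 1"
  have cont: "continuous_on UNIV (poly_of m c :: real^'n \<Rightarrow> real)" for c
    by (rule continuous_on_poly[OF poly_of_in_poly_space])
  have contm: "continuous_on UNIV (monomial \<alpha> :: real^'n \<Rightarrow> real)" for \<alpha>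
    by (rule continuous_on_poly[OF monomial_in_poly_space[OF order_refl]])
  have int: "set_integrable lborel ?B (\<lambda>x. (poly_of m c x)\<^sup>2)" for c
    by (intro set_integrable_continuous continuous_intros cont) auto
  define G where "G \<alpha> \<beta> = set_lebesgue_integral lborel ?B (\<lambda>x. monomial \<alpha> x * monomial \<beta> x)" for \<alpha> \<beta>
  have intG: "set_integrable lborel ?B (\<lambda>x. monomial \<alpha> x * monomial \<beta> x)" for \<alpha> \<beta>
    by (intro set_integrable_continuous continuous_intros contm) auto
  have eq: "set_lebesgue_integral lborel ?B (\<lambda>x. (poly_of m c x)\<^sup>2) =
      (\<Sum>\<alpha>\<in>multi_indices m. \<Sum>\<beta>\<in>multi_indices m. c \<alpha> * c \<beta> * G \<alpha> \<beta>)" for c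
  proof -
    have expand: "(\<lambda>x. (poly_of m c x)\<^sup>2) = (\<lambda>x::real^'n. \<Sum>\<alpha>\<in>multi_indices m. \<Sum>\<beta>\<in>multi_indices m. (c \<alpha> * c \<beta>) * (monomial \<alpha> x * monomial \<beta> x))"
      by (simp add: poly_of_def power2_eq_square sum_product ac_simps)
    have "set_lebesgue_integral lborel ?B (\<lambda>x. \<Sum>\<alpha>\<in>multi_indices m. \<Sum>\<beta>\<in>multi_indices m. (c \<alpha> * c \<beta>) * (monomial \<alpha> x * monomial \<beta> x)) =
        (\<Sum>\<alpha>\<in>multi_indices m. \<Sum>\<beta>\<in>multi_indices m. set_lebesgue_integral lborel ?B (\<lambda>x. (c \<alpha> * c \<beta>) * (monomial \<alpha> x * monomial \<beta> x)))"
      by (subst set_integral_sum set_integral_sum;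
          (intro sum.cong refl set_integral_sum)?;
          intro set_integrable_continuous continuous_intros contm; simp)
    then show ?thesis unfolding G_def expand by simp
  qed
  show "continuous_on UNIV (\<lambda>c. set_lebesgue_integral lborel ?B (\<lambda>x. (poly_of m c x)\<^sup>2))"
    unfolding eq by (intro continuous_intros continuous_on_product_coordinates)
  show "set_lebesgue_integral lborel ?B (\<lambda>x. (poly_of m (\<lambda>\<alpha>. t * c \<alpha>) x)\<^sup>2) =
        t\<^sup>2 * set_lebesgue_integral lborel ?B (\<lambda>x. (poly_of m c x)\<^sup>2)" for t c
    by (simp add: poly_of_scale power_mult_distrib)
  show "set_lebesgue_integral lborel ?B (\<lambda>x. (poly_of m c x)\<^sup>2) \<ge> 0" for c
    unfolding set_lebesgue_integral_def by (intro integral_nonneg_AE) auto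
  show "\<forall>\<alpha>\<in>multi_indices m. c \<alpha> = 0" if zero: "set_lebesgue_integral lborel ?B (\<lambda>x. (poly_of m c x)\<^sup>2) = 0" for c
  proof -
    let ?U = "{x \<in> ?B. poly_of m c x \<noteq> 0}"
    have "AE x in lborel. indicator ?B x *\<^sub>R (poly_of m c x)\<^sup>2 = 0"
      using zero int[of c] unfolding set_lebesgue_integral_def set_integrable_def
      by (subst (asm) integral_nonneg_eq_0_iff_AE) auto
    then have "AE x in lborel. x \<notin> ?U" by (auto elim!: eventually_mono simp: indicator_def split: if_splits)
    moreover have op: "open ?U"
    proof -
      have "?U = ?B \<inter> poly_of m c -` (- {0})" by auto
      then show ?thesis using cont[of c] by (auto intro!: open_Int open_vimage)
    qed
    ultimately have "?U \<in> null_sets lborel"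
      by (subst (asm) AE_iff_null_sets[symmetric]) auto
    then have "negligible ?U"
      by (simp add: negligible_iff_null_sets null_sets_completionI)
    then have "?U = {}" using op open_not_negligible by blast
    then have "poly_of m c = (\<lambda>x. 0)"
      by (intro poly_space_zero_on_ball[OF poly_of_in_poly_space, of 1 0]) auto
    then show ?thesis using poly_of_eq_0_coefficients by blast
  qed
qed (auto simp: poly_of_restrict)

text \<open>
  The same for the sum of squares over a unisolvent set of nodes. This is the source of existence of the
  least squares solution and of finiteness of the stability constant; the constant is allowed to depend on the nodes.
\<close>
lemma nodal_coefficient_bound:
  fixes I :: "(real^'n) set"
  assumes "finite I" "\<And>p. p \<in> poly_space m \<Longrightarrow> (\<And>x. x \<in> I \<Longrightarrow> p x = 0) \<Longrightarrow> p = (\<lambda>x. 0)"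
  shows "\<exists>l>0. \<forall>c. l * (\<Sum>\<alpha>\<in>multi_indices m. (c \<alpha>)\<^sup>2) \<le> (\<Sum>x\<in>I. (poly_of m c x)\<^sup>2)"
proof (rule definite_form_coercive)
  show "continuous_on UNIV (\<lambda>c. \<Sum>x\<in>I. (poly_of m c x)\<^sup>2)"
    by (intro continuous_intros continuous_on_poly_of_coefficients)
  show "(\<Sum>x\<in>I. (poly_of m (\<lambda>\<alpha>. t * c \<alpha>) x)\<^sup>2) = t\<^sup>2 * (\<Sum>x\<in>I. (poly_of m c x)\<^sup>2)" for t c
    by (simp add: poly_of_scale power_mult_distrib sum_distrib_left)
  show "\<forall>\<alpha>\<in>multi_indices m. c \<alpha> = 0" if "(\<Sum>x\<in>I. (poly_of m c x)\<^sup>2) = 0" for c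
  proof -
    have "poly_of m c = (\<lambda>x. 0)"
      using that assms(1) by (intro assms(2)) (auto simp: sum_nonneg_eq_0_iff)
    then show ?thesis using poly_of_eq_0_coefficients by blast
  qed
qed (auto simp: poly_of_restrict sum_nonneg)

lemma monomial_bound:
  fixes x :: "real^'n" and R :: real
  assumes "norm x \<le> R" "sum \<alpha> UNIV \<le> m"
  shows "\<bar>monomial \<alpha> x\<bar> \<le> (1 + R) ^ m"
proof -
  have R: "0 \<le> R" using assms(1) norm_ge_zero order_trans by blast
  have "\<bar>monomial \<alpha> x\<bar> = (\<Prod>i\<in>UNIV. \<bar>x $ i\<bar> ^ \<alpha> i)" by (simp add: monomial_def abs_prod power_abs)
  also have "\<dots> \<le> (\<Prod>i\<in>UNIV. (1 + R) ^ \<alpha> i)"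
  proof (intro prod_mono conjI power_mono)
    fix i show "\<bar>x $ i\<bar> \<le> 1 + R" using component_le_norm_cart[of x i] assms by simp
  qed auto
  also have "\<dots> = (1 + R) ^ sum \<alpha> UNIV" by (simp add: power_sum)
  also have "\<dots> \<le> (1 + R) ^ m" using assms R by (intro power_increasing) auto
  finally show ?thesis .
qed

lemma poly_of_pointwise_bound:
  fixes x :: "real^'n" and c :: "('n \<Rightarrow> nat) \<Rightarrow> real" and R :: real
  assumes "norm x \<le> R"
  shows "(poly_of m c x)\<^sup>2 \<le> (\<Sum>\<alpha>\<in>multi_indices m. (c \<alpha>)\<^sup>2) * (card (multi_indices m :: ('n \<Rightarrow> nat) set) * ((1 + R) ^ m)\<^sup>2)"
proof -
  have "(poly_of m c x)\<^sup>2 \<le> (\<Sum>\<alpha>\<in>multi_indices m. (c \<alpha>)\<^sup>2) * (\<Sum>\<alpha>\<in>multi_indices m. (monomial \<alpha> x)\<^sup>2)"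
    unfolding poly_of_def by (rule Cauchy_Schwarz_ineq_sum)
  also have "(\<Sum>\<alpha>\<in>multi_indices m. (monomial \<alpha> x)\<^sup>2) \<le> card (multi_indices m :: ('n \<Rightarrow> nat) set) * ((1 + R) ^ m)\<^sup>2"
  proof (rule sum_bounded_above)
    fix \<alpha> :: "'n \<Rightarrow> nat" assume "\<alpha> \<in> multi_indices m"
    then have "\<bar>monomial \<alpha> x\<bar> \<le> (1 + R) ^ m" using assms by (intro monomial_bound) (auto simp: multi_indices_def)
    then show "(monomial \<alpha> x)\<^sup>2 \<le> ((1 + R) ^ m)\<^sup>2" by (metis abs_ge_zero power2_abs power_mono)
  qed
  finally show ?thesis by (simp add: mult_left_mono sum_nonneg)
qed

lemma poly_of_gradient_bound:
  fixes x :: "real^'n" and c :: "('n \<Rightarrow> nat) \<Rightarrow> real" and R :: real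
  assumes "norm x \<le> R"
  shows "(norm (gradient (poly_of m c) x))\<^sup>2 \<le> (\<Sum>\<alpha>\<in>multi_indices m. (c \<alpha>)\<^sup>2) *
     (CARD('n) * (card (multi_indices m :: ('n \<Rightarrow> nat) set) * (m * (1 + R) ^ m)\<^sup>2))"
proof -
  let ?k = "real (card (multi_indices m :: ('n \<Rightarrow> nat) set)) * (m * (1 + R) ^ m)\<^sup>2"
  have "(gradient (poly_of m c) x $ i)\<^sup>2 \<le> (\<Sum>\<alpha>\<in>multi_indices m. (c \<alpha>)\<^sup>2) * ?k" for i
  proof -
    have "(gradient (poly_of m c) x $ i)\<^sup>2 \<le>
        (\<Sum>\<alpha>\<in>multi_indices m. (c \<alpha>)\<^sup>2) * (\<Sum>\<alpha>\<in>multi_indices m. (monomial_deriv \<alpha> i x)\<^sup>2)"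
      unfolding gradient_poly_of by (rule Cauchy_Schwarz_ineq_sum)
    also have "(\<Sum>\<alpha>\<in>multi_indices m. (monomial_deriv \<alpha> i x)\<^sup>2) \<le> ?k"
    proof (rule sum_bounded_above)
      fix \<alpha> :: "'n \<Rightarrow> nat" assume \<alpha>: "\<alpha> \<in> multi_indices m"
      have "\<alpha> i \<le> m" using \<alpha> member_le_sum[of i UNIV \<alpha>] by (simp add: multi_indices_def)
      moreover have "sum (\<alpha>(i := \<alpha> i - 1)) UNIV \<le> sum \<alpha> UNIV" by (rule sum_mono) auto
      then have "\<bar>monomial (\<alpha>(i := \<alpha> i - 1)) x\<bar> \<le> (1 + R) ^ m"
        using \<alpha> assms by (intro monomial_bound) (auto simp: multi_indices_def)
      ultimately have "\<bar>monomial_deriv \<alpha> i x\<bar> \<le> m * (1 + R) ^ m"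
        by (simp add: monomial_deriv_def abs_mult mult_mono)
      then show "(monomial_deriv \<alpha> i x)\<^sup>2 \<le> (m * (1 + R) ^ m)\<^sup>2"
        by (metis abs_ge_zero power2_abs power_mono)
    qed
    finally show ?thesis by (simp add: mult_left_mono sum_nonneg)
  qed
  then have "(\<Sum>i\<in>UNIV. (gradient (poly_of m c) x $ i)\<^sup>2) \<le> CARD('n) * ((\<Sum>\<alpha>\<in>multi_indices m. (c \<alpha>)\<^sup>2) * ?k)"
    by (intro sum_bounded_above)
  moreover have "(norm (gradient (poly_of m c) x))\<^sup>2 = (\<Sum>i\<in>UNIV. (gradient (poly_of m c) x $ i)\<^sup>2)"
    by (simp add: norm_vec_def L2_set_def sum_nonneg)
  ultimately show ?thesis by (simp add: algebra_simps)
qed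


section \<open>Inverse estimates at scale r\<close>

lemma set_integral_ball_affine:
  fixes f :: "real^'n \<Rightarrow> real"
  assumes cont: "continuous_on UNIV f" and r: "r > 0"
  shows "set_lebesgue_integral lborel (ball a r) f =
     r ^ CARD('n) * set_lebesgue_integral lborel (ball 0 1) (\<lambda>z. f (a + r *\<^sub>R z))"
proof -
  have [measurable]: "f \<in> borel_measurable borel" using cont by (rule borel_measurable_continuous_onI)
  have [measurable]: "(\<lambda>x. indicator (ball a r) x * f x) \<in> borel_measurable borel"
    by (intro borel_measurable_times borel_measurable_indicator) auto
  have ind: "indicator (ball a r) (a + r *\<^sub>R z) = (indicator (ball 0 1) z :: real)" for z
    using r by (auto simp: indicator_def dist_norm)
  have "set_lebesgue_integral lborel (ball a r) f =
      integral\<^sup>L (density (distr lborel borel (\<lambda>x. a + r *\<^sub>R x)) (\<lambda>_. ennreal (\<bar>r\<bar> ^ DIM(real^'n)))) (\<lambda>x. indicator (ball a r) x *\<^sub>R f x)"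
    unfolding set_lebesgue_integral_def using lborel_affine[of r a] r by simp
  also have "\<dots> = integral\<^sup>L (distr lborel borel (\<lambda>x. a + r *\<^sub>R x)) (\<lambda>x. \<bar>r\<bar> ^ DIM(real^'n) *\<^sub>R (indicator (ball a r) x *\<^sub>R f x))"
    by (subst integral_density) auto
  also have "\<dots> = integral\<^sup>L lborel (\<lambda>z. r ^ CARD('n) *\<^sub>R (indicator (ball 0 1) z *\<^sub>R f (a + r *\<^sub>R z)))"
    using r by (subst integral_distr) (auto simp: ind)
  finally show ?thesis by (simp add: set_lebesgue_integral_def)
qed

lemma norm_rescale: "r > 0 \<Longrightarrow> norm y \<le> \<kappa> * r \<Longrightarrow> norm (y /\<^sub>R r) \<le> \<kappa>" for r :: real
proof -
  assume "r > 0" "norm y \<le> \<kappa> * r"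
  moreover from this have "norm (y /\<^sub>R r) = norm y / r" by (simp add: divide_inverse mult.commute)
  ultimately show ?thesis by (simp add: pos_divide_le_eq)
qed

text \<open>
  On the unit ball both sides are comparable with the coefficients; the power of \<open>r\<close> is the Jacobian of the
  substitution \<open>x = a + r z\<close>. The constant depends on the points only through the ratio \<open>\<kappa>\<close>.
\<close>
lemma poly_sup_le_L2_ball:
  fixes \<kappa> :: real
  shows "\<exists>C>0. \<forall>p\<in>poly_space m. \<forall>a r (x::real^'n). r > 0 \<longrightarrow> norm (x - a) \<le> \<kappa> * r \<longrightarrow>
     r ^ CARD('n) * (p x)\<^sup>2 \<le> C * set_lebesgue_integral lborel (ball a r) (\<lambda>x. (p x)\<^sup>2)"
proof -
  obtain l where l: "l > 0" "\<And>c. l * (\<Sum>\<alpha>\<in>multi_indices m. (c \<alpha>)\<^sup>2) \<le>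
     set_lebesgue_integral lborel (ball (0::real^'n) 1) (\<lambda>x. (poly_of m c x)\<^sup>2)"
    using L2_coefficient_bound by blast
  define k where "k = card (multi_indices m :: ('n \<Rightarrow> nat) set) * ((1 + \<kappa>) ^ m)\<^sup>2"
  have k: "k \<ge> 0" by (simp add: k_def)
  have "r ^ CARD('n) * (p x)\<^sup>2 \<le> ((k + 1) / l) * set_lebesgue_integral lborel (ball a r) (\<lambda>x. (p x)\<^sup>2)"
    if p: "p \<in> poly_space m" and r: "r > 0" and x: "norm (x - a) \<le> \<kappa> * r" for p a r and x :: "real^'n"
  proof -
    obtain c where c: "(\<lambda>z. p (a + r *\<^sub>R z)) = poly_of m c"
      using poly_space_affine_subst[OF p] by (auto simp: poly_space_iff)
    define z where "z = (x - a) /\<^sub>R r"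
    have z: "x = a + r *\<^sub>R z" "norm z \<le> \<kappa>" using r norm_rescale[OF r x] by (auto simp: z_def)
    have "(p x)\<^sup>2 = (poly_of m c z)\<^sup>2" using z(1) c by metis
    also have "\<dots> \<le> (\<Sum>\<alpha>\<in>multi_indices m. (c \<alpha>)\<^sup>2) * k"
      unfolding k_def by (rule poly_of_pointwise_bound[OF z(2)])
    also have "\<dots> \<le> (\<Sum>\<alpha>\<in>multi_indices m. (c \<alpha>)\<^sup>2) * (k + 1)"
      by (intro mult_left_mono sum_nonneg) auto
    also have "\<dots> \<le> (set_lebesgue_integral lborel (ball 0 1) (\<lambda>x. (poly_of m c x)\<^sup>2) / l) * (k + 1)"
      using l(1) l(2)[of c] k by (intro mult_right_mono) (auto simp: field_simps)
    finally have "r ^ CARD('n) * (p x)\<^sup>2 \<le> r ^ CARD('n) * ((set_lebesgue_integral lborel (ball 0 1) (\<lambda>x. (poly_of m c x)\<^sup>2) / l) * (k + 1))"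
      using r by (intro mult_left_mono) auto
    also have "r ^ CARD('n) * set_lebesgue_integral lborel (ball 0 1) (\<lambda>x. (poly_of m c x)\<^sup>2) =
        set_lebesgue_integral lborel (ball a r) (\<lambda>x. (p x)\<^sup>2)"
      using set_integral_ball_affine[of "\<lambda>x. (p x)\<^sup>2" r a] r continuous_on_poly[OF p]
      by (simp add: c[symmetric] continuous_intros)
    then have "r ^ CARD('n) * ((set_lebesgue_integral lborel (ball 0 1) (\<lambda>x. (poly_of m c x)\<^sup>2) / l) * (k + 1)) =
        ((k + 1) / l) * set_lebesgue_integral lborel (ball a r) (\<lambda>x. (p x)\<^sup>2)"
      by (simp add: field_simps)
    finally show ?thesis .
  qed
  moreover have "(k + 1) / l > 0" using k l by simp
  ultimately show ?thesis by blast
qed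

lemma norm_vec_power2: "(norm (x::real^'n))\<^sup>2 = (\<Sum>i\<in>UNIV. (x $ i)\<^sup>2)"
  by (simp add: norm_vec_def L2_set_def sum_nonneg)

lemma poly_gradient_sup_le_L2_ball:
  fixes \<kappa> :: real
  shows "\<exists>C>0. \<forall>p\<in>poly_space m. \<forall>a r (x::real^'n). r > 0 \<longrightarrow> norm (x - a) \<le> \<kappa> * r \<longrightarrow>
     r ^ CARD('n) * (norm (gradient p x))\<^sup>2 \<le> C * set_lebesgue_integral lborel (ball a r) (\<lambda>x. (norm (gradient p x))\<^sup>2)"
proof -
  obtain C where C: "C > 0" "\<And>p a r x. p\<in>poly_space m \<Longrightarrow> r > 0 \<Longrightarrow> norm (x - a) \<le> \<kappa> * r \<Longrightarrow>
     r ^ CARD('n) * (p (x::real^'n))\<^sup>2 \<le> C * set_lebesgue_integral lborel (ball a r) (\<lambda>x. (p x)\<^sup>2)"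
    using poly_sup_le_L2_ball[of m \<kappa>] by blast
  have "r ^ CARD('n) * (norm (gradient p x))\<^sup>2 \<le> C * set_lebesgue_integral lborel (ball a r) (\<lambda>x. (norm (gradient p x))\<^sup>2)"
    if p: "p \<in> poly_space m" and r: "r > 0" and x: "norm (x - a) \<le> \<kappa> * r" for p a r and x :: "real^'n"
  proof -
    have "set_lebesgue_integral lborel (ball a r) (\<lambda>x. (norm (gradient p x))\<^sup>2) =
        (\<Sum>i\<in>UNIV. set_lebesgue_integral lborel (ball a r) (\<lambda>x. (gradient p x $ i)\<^sup>2))"
      unfolding norm_vec_power2
      by (intro set_integral_sum set_integrable_continuous continuous_intros continuous_on_poly[OF partial_deriv_in_poly_space[OF p]]) auto
    moreover have "r ^ CARD('n) * (gradient p x $ i)\<^sup>2 \<le> C * set_lebesgue_integral lborel (ball a r) (\<lambda>x. (gradient p x $ i)\<^sup>2)" for i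
      by (rule C(2)[OF partial_deriv_in_poly_space[OF p] r x])
    ultimately show ?thesis
      by (simp add: norm_vec_power2[of "gradient p x"] sum_distrib_left sum_mono)
  qed
  then show ?thesis using C(1) by blast
qed

lemma gradient_sq_integrable:
  assumes "p \<in> poly_space m" "bounded S" "S \<in> sets borel"
  shows "set_integrable lborel S (\<lambda>x. (norm (gradient p x))\<^sup>2)"
  using assms by (intro set_integrable_continuous continuous_intros continuous_on_gradient_poly)

lemma set_integral_mono_subset:
  fixes f :: "'a \<Rightarrow> real"
  assumes "set_integrable M B f" "A \<in> sets M" "A \<subseteq> B" "\<And>x. 0 \<le> f x"
  shows "set_lebesgue_integral M A f \<le> set_lebesgue_integral M B f"
  using assms set_integrable_subset[OF assms(1-3)] unfolding set_lebesgue_integral_def set_integrable_def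
  by (intro integral_mono) (auto simp: indicator_def)

text \<open>
  The partial derivatives are themselves polynomials of degree at most \<open>m\<close>, so their supremum is bounded by
  their \<open>L\<^sup>2\<close> norm; the mean value theorem on the convex set \<open>K\<close> contributes the diameter, hence two more powers of \<open>r\<close>.
  The constant is uniform in \<open>K\<close> because \<open>K\<close> lies between two concentric balls whose radii have the ratio \<open>\<kappa>\<close>.
\<close>
lemma poly_oscillation_le_gradient:
  fixes \<kappa> :: real
  assumes d: "CARD('n) \<ge> 2" and \<kappa>: "\<kappa> > 0"
  shows "\<exists>C>0. \<forall>p\<in>poly_space m. \<forall>K a r x y. r > 0 \<longrightarrow> convex K \<longrightarrow> ball a r \<subseteq> K \<longrightarrow> K \<subseteq> cball a (\<kappa> * r) \<longrightarrow>
     x \<in> K \<longrightarrow> y \<in> K \<longrightarrow>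
     r ^ (CARD('n) - 2) * (p x - p y)\<^sup>2 \<le> C * set_lebesgue_integral lborel (interior K) (\<lambda>x::real^'n. (norm (gradient p x))\<^sup>2)"
proof -
  obtain C where C: "C > 0" "\<And>p a r x. p\<in>poly_space m \<Longrightarrow> r > 0 \<Longrightarrow> norm (x - a) \<le> \<kappa> * r \<Longrightarrow>
     r ^ CARD('n) * (norm (gradient p (x::real^'n)))\<^sup>2 \<le> C * set_lebesgue_integral lborel (ball a r) (\<lambda>x. (norm (gradient p x))\<^sup>2)"
    using poly_gradient_sup_le_L2_ball[of m \<kappa>] by blast
  have "r ^ (CARD('n) - 2) * (p x - p y)\<^sup>2 \<le> (4 * \<kappa>\<^sup>2 * C) * set_lebesgue_integral lborel (interior K) (\<lambda>x::real^'n. (norm (gradient p x))\<^sup>2)"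
    if p: "p \<in> poly_space m" and r: "r > 0" and K: "convex K" "ball a r \<subseteq> K" "K \<subseteq> cball a (\<kappa> * r)" "x \<in> K" "y \<in> K" for p K a r x y
  proof -
    define J where "J = set_lebesgue_integral lborel (interior K) (\<lambda>x::real^'n. (norm (gradient p x))\<^sup>2)"
    define B where "B = sqrt (C * J / r ^ CARD('n))"
    have bdd: "bounded (interior K)"
      using K(3) bounded_subset[OF bounded_cball] interior_subset by (metis subset_trans)
    have J: "set_lebesgue_integral lborel (ball a r) (\<lambda>x. (norm (gradient p x))\<^sup>2) \<le> J"
      unfolding J_def
      using K(2) by (intro set_integral_mono_subset gradient_sq_integrable[OF p] bdd)
        (auto simp: interior_maximal)
    have J0: "J \<ge> 0" unfolding J_def set_lebesgue_integral_def by (intro integral_nonneg_AE) auto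
    have "norm (gradient p z) \<le> B" if "z \<in> K" for z
    proof -
      have "norm (z - a) \<le> \<kappa> * r" using K(3) that by (auto simp: dist_norm norm_minus_commute)
      from C(2)[OF p r this] have "r ^ CARD('n) * (norm (gradient p z))\<^sup>2 \<le> C * J"
        using J C(1) by (meson mult_left_mono less_imp_le order_trans)
      then have "(norm (gradient p z))\<^sup>2 \<le> C * J / r ^ CARD('n)"
        using r by (simp add: field_simps)
      then show ?thesis unfolding B_def by (simp add: real_le_rsqrt)
    qed
    then have "norm (p x - p y) \<le> B * norm (x - y)"
      using K(1,4,5)
    proof (intro differentiable_bound[of K p "\<lambda>x y. gradient p x \<bullet> y"])
      fix z assume z: "z \<in> K" and *: "\<And>z. z \<in> K \<Longrightarrow> norm (gradient p z) \<le> B"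
      show "(p has_derivative (\<bullet>) (gradient p z)) (at z within K)"
        using poly_has_derivative[OF p] has_derivative_at_withinI by blast
      have "onorm ((\<bullet>) (gradient p z)) \<le> norm (gradient p z)"
        by (intro onorm_le) (simp add: Cauchy_Schwarz_ineq2)
      then show "onorm ((\<bullet>) (gradient p z)) \<le> B" using *[OF z] by simp
    qed auto
    also have "norm (x - y) \<le> 2 * \<kappa> * r"
    proof -
      have "norm (x - a) \<le> \<kappa> * r" "norm (y - a) \<le> \<kappa> * r"
        using K(3,4,5) by (auto simp: dist_norm norm_minus_commute)
      then show ?thesis using norm_triangle_ineq4[of "x - a" "y - a"] by simp
    qed
    then have "B * norm (x - y) \<le> B * (2 * \<kappa> * r)"
      using J0 C(1) r by (intro mult_left_mono) (auto simp: B_def)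
    finally have "\<bar>p x - p y\<bar> \<le> B * (2 * \<kappa> * r)" by simp
    then have "(p x - p y)\<^sup>2 \<le> (B * (2 * \<kappa> * r))\<^sup>2" by (metis abs_ge_zero power2_abs power_mono)
    also have "\<dots> = C * J / r ^ CARD('n) * (2 * \<kappa> * r)\<^sup>2"
      using J0 C(1) r by (simp add: B_def power_mult_distrib)
    finally have "r ^ (CARD('n) - 2) * (p x - p y)\<^sup>2 \<le> r ^ (CARD('n) - 2) * (C * J / r ^ CARD('n) * (2 * \<kappa> * r)\<^sup>2)"
      using r by (intro mult_left_mono) auto
    also have "\<dots> = (r ^ (CARD('n) - 2) * r\<^sup>2) * (C * J / r ^ CARD('n) * (4 * \<kappa>\<^sup>2))"
      by (simp add: power2_eq_square algebra_simps)
    also have "r ^ (CARD('n) - 2) * r\<^sup>2 = r ^ CARD('n)"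
      using d by (metis power_add le_add_diff_inverse2)
    also have "r ^ CARD('n) * (C * J / r ^ CARD('n) * (4 * \<kappa>\<^sup>2)) = (4 * \<kappa>\<^sup>2 * C) * J"
      using r by simp
    finally show ?thesis unfolding J_def .
  qed
  moreover have "4 * \<kappa>\<^sup>2 * C > 0" using C \<kappa> by simp
  ultimately show ?thesis by blast
qed

text \<open>
  After rescaling, the gradient of \<open>p - b\<close> is bounded by the coefficients, those by the \<open>L\<^sup>2\<close> norm of \<open>p - b\<close> on the
  inscribed ball, and this by \<open>s\<close>. Undoing the scaling costs \<open>r\<^sup>-\<^sup>2\<close>, and integration over \<open>K\<close> gains \<open>r\<^sup>d\<close>.
\<close>
lemma poly_inverse_inequality:
  fixes \<kappa> :: real
  assumes d: "CARD('n) \<ge> 2" and \<kappa>: "\<kappa> > 0"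
  shows "\<exists>C>0. \<forall>p\<in>poly_space m. \<forall>K a r b s. r > 0 \<longrightarrow> ball a r \<subseteq> K \<longrightarrow> K \<subseteq> cball a (\<kappa> * r) \<longrightarrow>
     (\<forall>x\<in>K. \<bar>p x - b\<bar> \<le> s) \<longrightarrow>
     set_lebesgue_integral lborel (interior K) (\<lambda>x::real^'n. (norm (gradient p x))\<^sup>2) \<le> C * r ^ (CARD('n) - 2) * s\<^sup>2"
proof -
  obtain l where l: "l > 0" "\<And>c. l * (\<Sum>\<alpha>\<in>multi_indices m. (c \<alpha>)\<^sup>2) \<le>
     set_lebesgue_integral lborel (ball (0::real^'n) 1) (\<lambda>x. (poly_of m c x)\<^sup>2)"
    using L2_coefficient_bound by blast
  define k where "k = CARD('n) * (card (multi_indices m :: ('n \<Rightarrow> nat) set) * (m * (1 + \<kappa>) ^ m)\<^sup>2)"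
  define V where "V = measure lborel (ball (0::real^'n) 1)"
  define W where "W = unit_ball_vol CARD('n) * \<kappa> ^ CARD('n)"
  have k: "k \<ge> 0" by (simp add: k_def)
  have V: "V \<ge> 0" and W: "W \<ge> 0" using \<kappa> by (auto simp: V_def W_def)
  have "set_lebesgue_integral lborel (interior K) (\<lambda>x::real^'n. (norm (gradient p x))\<^sup>2) \<le> (W * (V / l * k) + 1) * r ^ (CARD('n) - 2) * s\<^sup>2"
    if p: "p \<in> poly_space m" and r: "r > 0" and K: "ball a r \<subseteq> K" "K \<subseteq> cball a (\<kappa> * r)" and s: "\<And>x. x \<in> K \<Longrightarrow> \<bar>p x - b\<bar> \<le> s" for p K a r b s
  proof -
    have bdd: "bounded (interior K)"
      using K(2) bounded_subset[OF bounded_cball] interior_subset by (metis subset_trans)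
    have q: "(\<lambda>x. p x - b) \<in> poly_space m" by (intro poly_space_diff p const_in_poly_space)
    obtain c where c: "(\<lambda>z. p (a + r *\<^sub>R z) - b) = poly_of m c"
      using poly_space_affine_subst[OF q] by (auto simp: poly_space_iff)
    have "set_lebesgue_integral lborel (ball 0 1) (\<lambda>x. (poly_of m c x)\<^sup>2) \<le> set_lebesgue_integral lborel (ball (0::real^'n) 1) (\<lambda>x. s\<^sup>2)"
    proof (intro set_integral_mono set_integrable_continuous continuous_intros continuous_on_poly[OF poly_of_in_poly_space])
      fix x :: "real^'n" assume "x \<in> ball 0 1"
      then have "a + r *\<^sub>R x \<in> K" using K(1) r by (intro subsetD[OF K(1)]) (auto simp: dist_norm)
      then have "\<bar>poly_of m c x\<bar> \<le> s" using s c[symmetric] by simp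
      then show "(poly_of m c x)\<^sup>2 \<le> s\<^sup>2" by (metis abs_ge_zero power2_abs power_mono)
    qed auto
    also have "\<dots> = V * s\<^sup>2" by (simp add: V_def set_lebesgue_integral_def)
    finally have cs: "(\<Sum>\<alpha>\<in>multi_indices m. (c \<alpha>)\<^sup>2) \<le> V / l * s\<^sup>2"
      using l(1) l(2)[of c] by (simp add: field_simps)
    have sup: "(norm (gradient p x))\<^sup>2 \<le> V / l * s\<^sup>2 * k / r\<^sup>2" if "x \<in> interior K" for x
    proof -
      define z where "z = (x - a) /\<^sub>R r"
      have "norm (x - a) \<le> \<kappa> * r" using K(2) that interior_subset[of K] by (auto simp: dist_norm norm_minus_commute)
      then have z: "x = a + r *\<^sub>R z" "norm z \<le> \<kappa>" using r norm_rescale[OF r] by (auto simp: z_def)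
      have "gradient (poly_of m c) z = r *\<^sub>R gradient p x"
        using gradient_affine_subst[OF q, of a r z] z(1) gradient_shift[OF p] by (simp add: c)
      then have "(r * norm (gradient p x))\<^sup>2 = (norm (gradient (poly_of m c) z))\<^sup>2" using r by simp
      also have "\<dots> \<le> (\<Sum>\<alpha>\<in>multi_indices m. (c \<alpha>)\<^sup>2) * k"
        unfolding k_def by (rule poly_of_gradient_bound[OF z(2)])
      also have "\<dots> \<le> (V / l * s\<^sup>2) * k" using cs k by (intro mult_right_mono)
      finally have "(norm (gradient p x))\<^sup>2 * r\<^sup>2 \<le> V / l * s\<^sup>2 * k" by (simp add: power_mult_distrib mult.commute)
      then show ?thesis using r by (subst pos_le_divide_eq) auto
    qed
    have fin: "emeasure lborel (interior K) < \<infinity>" using emeasure_bounded_finite[OF bdd] .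
    have "set_lebesgue_integral lborel (interior K) (\<lambda>x::real^'n. (norm (gradient p x))\<^sup>2) \<le>
        set_lebesgue_integral lborel (interior K) (\<lambda>x. V / l * s\<^sup>2 * k / r\<^sup>2)"
      using sup bdd by (intro set_integral_mono gradient_sq_integrable[OF p] set_integrable_continuous continuous_intros) auto
    also have "\<dots> = measure lborel (interior K) * (V / l * s\<^sup>2 * k / r\<^sup>2)"
      using fin by (simp add: set_lebesgue_integral_def)
    also have "\<dots> \<le> (W * r ^ CARD('n)) * (V / l * s\<^sup>2 * k / r\<^sup>2)"
    proof (intro mult_right_mono)
      have "cball a (\<kappa> * r) \<in> fmeasurable lborel"
        by (rule fmeasurableI[OF _ emeasure_lborel_cball_finite]) simp
      moreover have "interior K \<subseteq> cball a (\<kappa> * r)" using K(2) interior_subset by (rule subset_trans[rotated])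
      ultimately have "measure lborel (interior K) \<le> measure lborel (cball a (\<kappa> * r))"
        by (intro measure_mono_fmeasurable) simp_all
      then show "measure lborel (interior K) \<le> W * r ^ CARD('n)"
        using r \<kappa> by (simp add: content_cball W_def power_mult_distrib ac_simps)
    qed (use V l k in auto)
    also have "r ^ CARD('n) = r ^ (CARD('n) - 2) * r\<^sup>2" using d by (metis power_add le_add_diff_inverse2)
    also have "(W * (r ^ (CARD('n) - 2) * r\<^sup>2)) * (V / l * s\<^sup>2 * k / r\<^sup>2) = (W * (V / l * k)) * (r ^ (CARD('n) - 2) * s\<^sup>2)"
      using r by (simp add: field_simps)
    also have "\<dots> \<le> (W * (V / l * k) + 1) * (r ^ (CARD('n) - 2) * s\<^sup>2)"
      using r by (intro mult_right_mono) auto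
    finally show ?thesis by (simp add: mult.assoc)
  qed
  note bound = this
  have "W * (V / l * k) + 1 > 0" using W V l k by (intro add_nonneg_pos mult_nonneg_nonneg) auto
  then show ?thesis
    by (intro exI[of _ "W * (V / l * k) + 1"] conjI ballI allI impI bound) (assumption | erule bspec)+
qed


section \<open>Constrained least squares and the stability constant\<close>

text \<open>
  Existence: the constant \<open>v x0\<close> is admissible, and by the nodal coefficient bound the admissible polynomials that are
  not worse have coefficients in a compact set. Uniqueness: by the parallelogram law the mean of two distinct minimizers
  would be strictly better, unless they agree at the nodes.
\<close>
lemma constrained_least_squares_unique:
  fixes v :: "real^'n \<Rightarrow> real"
  assumes I: "finite I" and definite: "\<And>p. p \<in> poly_space m \<Longrightarrow> (\<And>x. x \<in> I \<Longrightarrow> p x = 0) \<Longrightarrow> p = (\<lambda>x. 0)"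
  shows "\<exists>!p. p \<in> poly_space m \<and> p x0 = v x0 \<and>
        (\<forall>q\<in>poly_space m. q x0 = v x0 \<longrightarrow> (\<Sum>x\<in>I. (p x - v x)\<^sup>2) \<le> (\<Sum>x\<in>I. (q x - v x)\<^sup>2))"
proof -
  define F where "F p = (\<Sum>x\<in>I. (p x - v x)\<^sup>2)" for p
  obtain l where l: "l > 0" "\<And>c. l * (\<Sum>\<alpha>\<in>multi_indices m. (c \<alpha>)\<^sup>2) \<le> (\<Sum>x\<in>I. (poly_of m c x)\<^sup>2)"
    using nodal_coefficient_bound[OF assms] by blast
  define M where "M = F (\<lambda>x. v x0)"
  define R where "R = sqrt ((2 * M + 2 * (\<Sum>x\<in>I. (v x)\<^sup>2)) / l)"
  define S where "S = {c. (\<forall>\<alpha>\<in>multi_indices m. \<bar>c \<alpha>\<bar> \<le> R) \<and> (\<forall>\<alpha>. \<alpha> \<notin> multi_indices m \<longrightarrow> c \<alpha> = 0)} \<inter> {c. poly_of m c x0 = v x0}"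
  have "closed {c. poly_of m c x0 = v x0}"
    by (intro closed_Collect_eq continuous_on_poly_of_coefficients continuous_on_const)
  then have compact: "compact S" unfolding S_def by (intro compact_Int_closed compact_coefficient_box)
  \<comment> \<open>Admissible polynomials at least as good as the constant have their coefficients in \<open>S\<close>; the radius \<open>R\<close> is chosen for this.\<close>
  have sublevel: "\<exists>c\<in>S. q = poly_of m c" if q: "q \<in> poly_space m" "q x0 = v x0" "F q \<le> M" for q
  proof -
    obtain c' where c': "q = poly_of m c'" using q by (auto simp: poly_space_iff)
    define c where "c = (\<lambda>\<alpha>. if \<alpha> \<in> multi_indices m then c' \<alpha> else 0)"
    have c: "q = poly_of m c" unfolding c_def poly_of_restrict by (rule c')
    have "\<bar>c \<alpha>\<bar> \<le> R" if "\<alpha> \<in> multi_indices m" for \<alpha>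
    proof -
      have "(q x)\<^sup>2 \<le> 2 * (q x - v x)\<^sup>2 + 2 * (v x)\<^sup>2" for x
        using zero_le_power2[of "q x - 2 * v x"] by (simp add: power2_eq_square algebra_simps)
      then have "(\<Sum>x\<in>I. (q x)\<^sup>2) \<le> 2 * F q + 2 * (\<Sum>x\<in>I. (v x)\<^sup>2)"
        unfolding F_def sum_distrib_left sum.distrib[symmetric] by (intro sum_mono) auto
      then have "l * (\<Sum>\<alpha>\<in>multi_indices m. (c \<alpha>)\<^sup>2) \<le> 2 * M + 2 * (\<Sum>x\<in>I. (v x)\<^sup>2)"
        using l(2)[of c] q(3) c by simp
      moreover have "(c \<alpha>)\<^sup>2 \<le> (\<Sum>\<alpha>\<in>multi_indices m. (c \<alpha>)\<^sup>2)" using that by (intro member_le_sum) auto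
      ultimately have "(c \<alpha>)\<^sup>2 \<le> (2 * M + 2 * (\<Sum>x\<in>I. (v x)\<^sup>2)) / l"
        using l(1) by (smt (verit, best) mult_left_mono pos_le_divide_eq mult.commute)
      then show ?thesis unfolding R_def using real_sqrt_le_mono by fastforce
    qed
    then have "c \<in> S" using q(2) c by (auto simp: S_def c_def)
    then show ?thesis using c by blast
  qed
  obtain c1 where c1: "c1 \<in> S" "(\<lambda>x. v x0) = poly_of m c1" using sublevel[of "\<lambda>x. v x0"] by (auto simp: M_def)
  have contF: "continuous_on S (\<lambda>c. F (poly_of m c))"
    unfolding F_def by (intro continuous_intros continuous_on_subset[OF continuous_on_poly_of_coefficients]) auto
  obtain c0 where c0: "c0 \<in> S" "\<And>c. c \<in> S \<Longrightarrow> F (poly_of m c0) \<le> F (poly_of m c)"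
    using continuous_attains_inf[OF compact _ contF] c1(1) by auto
  have min: "F (poly_of m c0) \<le> F q" if "q \<in> poly_space m" "q x0 = v x0" for q
  proof (cases "F q \<le> M")
    case True
    then show ?thesis using sublevel[OF that] c0 by auto
  next
    case False
    then show ?thesis using c0(2)[OF c1(1)] by (simp add: c1(2)[symmetric] M_def)
  qed
  show ?thesis unfolding F_def[symmetric]
  proof (rule ex1I)
    show "poly_of m c0 \<in> poly_space m \<and> poly_of m c0 x0 = v x0 \<and>
        (\<forall>q\<in>poly_space m. q x0 = v x0 \<longrightarrow> F (poly_of m c0) \<le> F q)"
      using c0(1) min by (auto simp: S_def)
    fix p assume p: "p \<in> poly_space m \<and> p x0 = v x0 \<and> (\<forall>q\<in>poly_space m. q x0 = v x0 \<longrightarrow> F p \<le> F q)"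
    let ?q = "poly_of m c0"
    have q: "?q x0 = v x0" using c0(1) by (simp add: S_def)
    have Fle: "F p \<le> F ?q" "F ?q \<le> F p" using p q min by auto
    define w where "w = (\<lambda>x. (1/2) * (p x + ?q x))"
    have "w \<in> poly_space m" unfolding w_def using p by (intro poly_space_scale poly_space_add) auto
    then have "F ?q \<le> F w" using min q p by (simp add: w_def)
    moreover have "F w = (F p + F ?q) / 2 - (\<Sum>x\<in>I. (p x - ?q x)\<^sup>2) / 4"
      unfolding F_def w_def sum.distrib[symmetric] sum_divide_distrib sum_subtractf[symmetric]
      by (intro sum.cong refl) (simp add: power2_eq_square field_simps)
    ultimately have "(\<Sum>x\<in>I. (p x - ?q x)\<^sup>2) \<le> 0" using Fle by simp
    then have "(\<Sum>x\<in>I. (p x - ?q x)\<^sup>2) = 0" by (meson antisym sum_nonneg zero_le_power2)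
    then have "\<And>x. x \<in> I \<Longrightarrow> p x - ?q x = 0" using I by (simp add: sum_nonneg_eq_0_iff)
    moreover have "(\<lambda>x. p x - ?q x) \<in> poly_space m" using p by (intro poly_space_diff) auto
    ultimately have "(\<lambda>x. p x - ?q x) = (\<lambda>x. 0)" using definite by blast
    then show "p = ?q" by (auto simp: fun_eq_iff)
  qed
qed

text \<open>
  A real supremum bounds its members only if the family is bounded above. The explicit bound \<open>B\<close>, from the nodal
  coefficient bound, supplies this.
\<close>
lemma sup_le_stability_constant:
  fixes P I :: "(real^'n) set"
  assumes P: "bounded P" and I: "finite I" "I \<noteq> {}"
    and definite: "\<And>p. p \<in> poly_space m \<Longrightarrow> (\<And>x. x \<in> I \<Longrightarrow> p x = 0) \<Longrightarrow> p = (\<lambda>x. 0)"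
    and p: "p \<in> poly_space m" and x: "x \<in> P"
  shows "\<bar>p x\<bar> \<le> (SUP p\<in>{p\<in>poly_space m. p \<noteq> (\<lambda>x. 0)}. (SUP x\<in>P. \<bar>p x\<bar>) / Max ((\<lambda>x. \<bar>p x\<bar>) ` I)) *
     Max ((\<lambda>x. \<bar>p x\<bar>) ` I)"
proof (cases "p = (\<lambda>x. 0)")
  case True
  then show ?thesis using I by (simp add: image_constant_conv)
next
  case False
  let ?M = "\<lambda>p::real^'n\<Rightarrow>real. Max ((\<lambda>x. \<bar>p x\<bar>) ` I)"
  obtain l where l: "l > 0" "\<And>c. l * (\<Sum>\<alpha>\<in>multi_indices m. (c \<alpha>)\<^sup>2) \<le> (\<Sum>x\<in>I. (poly_of m c x)\<^sup>2)"
    using nodal_coefficient_bound[OF I(1) definite] by blast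
  obtain R where R: "\<And>x. x \<in> P \<Longrightarrow> norm x \<le> R" using P by (auto simp: bounded_iff)
  define k where "k = card (multi_indices m :: ('n \<Rightarrow> nat) set) * ((1 + R) ^ m)\<^sup>2"
  define B where "B = sqrt (real (card I) / l * k)"
  have M: "\<bar>q x\<bar> \<le> ?M q" if "x \<in> I" for q x using I that by auto
  have M0: "?M q \<ge> 0" for q using I M by (metis abs_ge_zero equals0I order_trans)
  have Mpos: "?M q > 0" if "q \<in> poly_space m" "q \<noteq> (\<lambda>x. 0)" for q
    using that definite M0[of q] M[of _ q] by (metis abs_le_zero_iff less_eq_real_def)
  have ub: "\<bar>q x\<bar> \<le> B * ?M q" if q: "q \<in> poly_space m" and x: "x \<in> P" for q x
  proof -
    obtain c where c: "q = poly_of m c" using q by (auto simp: poly_space_iff)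
    have k: "k \<ge> 0" by (simp add: k_def)
    have "(q x)\<^sup>2 \<le> (\<Sum>\<alpha>\<in>multi_indices m. (c \<alpha>)\<^sup>2) * k"
      unfolding c k_def by (rule poly_of_pointwise_bound[OF R[OF x]])
    also have "\<dots> \<le> ((\<Sum>x\<in>I. (q x)\<^sup>2) / l) * k"
      using l(1) l(2)[of c] k by (intro mult_right_mono) (auto simp: field_simps c)
    also have "\<dots> \<le> (card I * (?M q)\<^sup>2 / l) * k"
    proof (intro mult_right_mono divide_right_mono sum_bounded_above)
      fix y assume "y \<in> I"
      then show "(q y)\<^sup>2 \<le> (?M q)\<^sup>2" using M[of y q] by (metis abs_ge_zero power2_abs power_mono)
    qed (use l k in auto)
    also have "\<dots> = (card I / l * k) * (?M q)\<^sup>2" by simp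
    finally have "sqrt ((q x)\<^sup>2) \<le> sqrt ((card I / l * k) * (?M q)\<^sup>2)" by (rule real_sqrt_le_mono)
    also have "\<dots> = B * ?M q"
      unfolding B_def real_sqrt_mult[of "card I / l * k"] using M0[of q] by simp
    finally show ?thesis by simp
  qed
  have P0: "P \<noteq> {}" using x by auto
  have "bdd_above ((\<lambda>p. (SUP x\<in>P. \<bar>p x\<bar>) / ?M p) ` {p\<in>poly_space m. p \<noteq> (\<lambda>x. 0)})"
  proof (rule bdd_aboveI2)
    fix q :: "real^'n \<Rightarrow> real" assume "q \<in> {p\<in>poly_space m. p \<noteq> (\<lambda>x. 0)}"
    then have q: "q \<in> poly_space m" "q \<noteq> (\<lambda>x. 0)" by auto
    have "(SUP x\<in>P. \<bar>q x\<bar>) \<le> B * ?M q" using ub[OF q(1)] P0 by (intro cSUP_least)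
    then show "(SUP x\<in>P. \<bar>q x\<bar>) / ?M q \<le> B" using Mpos[OF q] by (simp add: field_simps)
  qed
  then have "(SUP x\<in>P. \<bar>p x\<bar>) / ?M p \<le> (SUP p\<in>{p\<in>poly_space m. p \<noteq> (\<lambda>x::real^'n. 0)}. (SUP x\<in>P. \<bar>p x\<bar>) / ?M p)"
    using p False by (intro cSUP_upper) auto
  moreover have "\<bar>p x\<bar> \<le> (SUP x\<in>P. \<bar>p x\<bar>)"
    using x ub[OF p] by (intro cSUP_upper bdd_aboveI2)
  ultimately show ?thesis using Mpos[OF p False]
    by (smt (verit, ccfv_SIG) pos_divide_le_eq)
qed


section \<open>Facets of a simplex\<close>

text \<open>
  A simplex \<open>K\<close> seen from its facet \<open>e\<close>: a cone with apex \<open>u\<close> over the base \<open>e\<close>, where \<open>n\<close> is the unit normal pointing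
  out of \<open>K\<close> and \<open>b\<close> the level of the hyperplane containing \<open>e\<close>. Cone sections parallel to the base, and projections from the apex, are
  then available without reference to the vertices.
\<close>
definition facet_frame :: "(real^'n) set \<Rightarrow> (real^'n) set \<Rightarrow> real^'n \<Rightarrow> real^'n \<Rightarrow> real \<Rightarrow> bool" where
  "facet_frame K e u n b \<longleftrightarrow> norm n = 1 \<and> affine hull e = {x. n \<bullet> x = b} \<and> n \<bullet> u < b \<and>
     K = convex hull (insert u e) \<and> e \<noteq> {} \<and> compact e \<and> convex e"

lemma facet_frameD:
  assumes "facet_frame K e u n b"
  shows "norm n = 1" "n \<bullet> n = 1" "affine hull e = {x. n \<bullet> x = b}" "n \<bullet> u < b" "K = convex hull (insert u e)"
    "e \<noteq> {}" "compact e" "convex e" "\<And>x. x \<in> e \<Longrightarrow> n \<bullet> x = b" "u \<in> K" "e \<subseteq> K"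
  using assms hull_subset[of "insert u e" convex] hull_subset[of e affine]
  by (auto simp: facet_frame_def norm_eq_1)

text \<open>
  The parameter \<open>t\<close> is the height above the apex, measured so that the base has height \<open>1\<close>.
\<close>
lemma facet_frame_point:
  assumes "facet_frame K e u n b" "x \<in> K"
  obtains t y where "0 \<le> t" "t \<le> 1" "y \<in> e" "x = (1 - t) *\<^sub>R u + t *\<^sub>R y" "n \<bullet> x = n \<bullet> u + t * (b - n \<bullet> u)"
proof -
  note f = facet_frameD[OF assms(1)]
  have "x \<in> convex hull (insert u e)" using assms f by simp
  then obtain s t y where *: "0 \<le> s" "0 \<le> t" "s + t = 1" "y \<in> e" "x = s *\<^sub>R u + t *\<^sub>R y"
    using f(6,8) by (auto simp: convex_hull_insert convex_hull_eq[symmetric])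
  then have s: "s = 1 - t" by simp
  have "n \<bullet> x = (1 - t) * (n \<bullet> u) + t * b" using *(5) f(9)[OF *(4)] by (simp add: s inner_add_right)
  then have nx: "n \<bullet> x = n \<bullet> u + t * (b - n \<bullet> u)" by (simp add: algebra_simps)
  show ?thesis
    by (rule that[OF *(2) _ *(4) *(5)[unfolded s] nx]) (use *(1,3) in simp)
qed

lemma unit_normals_of_hyperplane:
  fixes n n' :: "'a::euclidean_space"
  assumes "norm n = 1" "norm n' = 1" "\<And>w. n \<bullet> w = 0 \<Longrightarrow> n' \<bullet> w = 0"
  shows "n' = n \<or> n' = - n"
proof -
  let ?w = "n' - (n \<bullet> n') *\<^sub>R n"
  have nn: "n \<bullet> n = 1" using assms by (simp add: norm_eq_1)
  have 0: "n \<bullet> ?w = 0" by (simp add: inner_diff_right nn)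
  then have "n' \<bullet> ?w = 0" by (rule assms(3))
  then have "?w \<bullet> ?w = 0" using 0 by (simp add: inner_diff_left)
  then have *: "n' = (n \<bullet> n') *\<^sub>R n" by simp
  then have "\<bar>n \<bullet> n'\<bar> = 1" using assms(1,2) by (metis mult.right_neutral norm_scaleR)
  then show ?thesis using * by (metis abs_eq_iff abs_1 scaleR_minus1_left scaleR_one)
qed

lemma facet_frame_normal_orthogonal:
  assumes "facet_frame K e u n b" "\<And>x y. x \<in> e \<Longrightarrow> y \<in> e \<Longrightarrow> n' \<bullet> (x - y) = 0" "n \<bullet> w = 0"
  shows "n' \<bullet> w = 0"
proof -
  note f = facet_frameD[OF assms(1)]
  obtain y where y: "y \<in> e" using f by blast
  have "affine {x. n' \<bullet> x = n' \<bullet> y}" by (rule affine_hyperplane)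
  moreover have "e \<subseteq> {x. n' \<bullet> x = n' \<bullet> y}" using assms(2)[OF _ y] by (auto simp: inner_diff_right)
  ultimately have "affine hull e \<subseteq> {x. n' \<bullet> x = n' \<bullet> y}" by (simp add: hull_minimal)
  moreover have "y + w \<in> affine hull e" using f(3) f(9)[OF y] assms(3) by (simp add: inner_add_right)
  ultimately show ?thesis by (auto simp: inner_add_right)
qed

lemma facet_frame_exists:
  fixes K :: "(real^'n) set"
  assumes K: "int CARD('n) simplex K" and e: "e facet_of K"
  shows "\<exists>u n b. facet_frame K e u n b"
proof -
  obtain C where C: "\<not> affine_dependent C" "K = convex hull C" using K by (auto simp: simplex_def)
  obtain u where u: "u \<in> C" "e = convex hull (C - {u})" "e \<noteq> {}"
    using e facet_of_convex_hull_affine_independent[OF C(1)] C(2) by blast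
  have "aff_dim e = int (DIM(real^'n)) - 1"
    using e aff_dim_simplex[OF K] by (simp add: facet_of_def)
  then obtain n' b' where n': "n' \<noteq> 0" "affine hull e = {x. n' \<bullet> x = b'}"
    using aff_dim_eq_hyperplane[of e] by (auto simp: of_nat_diff)
  have "u \<notin> affine hull e"
    using C(1) u unfolding affine_dependent_def by (simp add: affine_hull_convex_hull)
  then have ne: "n' \<bullet> u \<noteq> b'" using n' by auto
  define s where "s = (if n' \<bullet> u < b' then 1 / norm n' else - 1 / norm n')"
  have s: "s \<noteq> 0" "\<bar>s\<bar> * norm n' = 1" using n' by (auto simp: s_def)
  have "facet_frame K e u (s *\<^sub>R n') (s * b')"
    unfolding facet_frame_def
  proof (intro conjI)
    show "norm (s *\<^sub>R n') = 1" using s by simp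
    show "affine hull e = {x. (s *\<^sub>R n') \<bullet> x = s * b'}" using n' s by simp
    show "(s *\<^sub>R n') \<bullet> u < s * b'" using ne n'(1) by (auto simp: s_def divide_simps)
    show "K = convex hull (insert u e)"
      unfolding u(2) hull_insert[symmetric] C(2) using u(1) by (simp add: insert_absorb)
    show "compact e" using u aff_independent_finite[OF C(1)] by (simp add: finite_imp_compact_convex_hull)
  qed (use u in auto)
  then show ?thesis by blast
qed

text \<open>
  The description of the outward normal determines it: orthogonality to \<open>e\<close> leaves two opposite unit vectors, and the
  apex decides between them.
\<close>
lemma outward_normal_frame:
  fixes K :: "(real^'n) set"
  assumes "int CARD('n) simplex K" "e facet_of K"
  shows "\<exists>u b. facet_frame K e u (outward_normal K e) b"
proof -
  obtain u n b where F: "facet_frame K e u n b" using facet_frame_exists[OF assms] by blast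
  note f = facet_frameD[OF F]
  obtain y0 where y0: "y0 \<in> e" using f by blast
  have "outward_normal K e = n"
    unfolding outward_normal_def
  proof (rule the_equality)
    have "n \<bullet> (x - y) \<le> 0" if x: "x \<in> K" and y: "y \<in> e" for x y
    proof -
      obtain t where t: "0 \<le> t" "t \<le> 1" "n \<bullet> x = n \<bullet> u + t * (b - n \<bullet> u)"
        using facet_frame_point[OF F x] by metis
      have "t * (b - n \<bullet> u) \<le> 1 * (b - n \<bullet> u)" using t f(4) by (intro mult_right_mono) auto
      then show ?thesis using t f(9)[OF y] by (simp add: inner_diff_right)
    qed
    then show "norm n = 1 \<and> (\<forall>x\<in>e. \<forall>y\<in>e. n \<bullet> (x - y) = 0) \<and> (\<forall>x\<in>K. \<forall>y\<in>e. n \<bullet> (x - y) \<le> 0)"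
      using f by (auto simp: inner_diff_right)
    fix n' assume n': "norm n' = 1 \<and> (\<forall>x\<in>e. \<forall>y\<in>e. n' \<bullet> (x - y) = 0) \<and> (\<forall>x\<in>K. \<forall>y\<in>e. n' \<bullet> (x - y) \<le> 0)"
    have "n' = n \<or> n' = - n"
      using unit_normals_of_hyperplane[of n n'] facet_frame_normal_orthogonal[OF F, of n'] n' f(1) by blast
    moreover have "n \<bullet> (u - y0) < 0" using f(4) f(9)[OF y0] by (simp add: inner_diff_right)
    then have "n' \<noteq> - n" using n' f(10) y0 by force
    ultimately show "n' = n" by blast
  qed
  then show ?thesis using F by blast
qed

text \<open>
  Near a relative interior point of the facet, \<open>K\<close> coincides with the half space. This is what prevents two elements
  from lying on the same side of a common facet.
\<close>
lemma facet_half_ball: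
  assumes F: "facet_frame K e u n b" and y: "y \<in> rel_interior e"
  shows "\<exists>\<delta>>0. \<forall>z. dist y z < \<delta> \<longrightarrow> n \<bullet> z \<le> b \<longrightarrow> z \<in> K"
proof -
  note f = facet_frameD[OF F]
  have ye: "y \<in> e" using y rel_interior_subset by blast
  obtain \<epsilon> where \<epsilon>: "\<epsilon> > 0" "ball y \<epsilon> \<inter> affine hull e \<subseteq> e" using y by (auto simp: mem_rel_interior_ball)
  define H where "H = b - n \<bullet> u"
  define D where "D = norm (u - y)"
  have H: "H > 0" using f by (simp add: H_def)
  have D: "D \<ge> 0" by (simp add: D_def)
  \<comment> \<open>The first bound keeps the weight \<open>t\<close> of the apex below \<open>1/2\<close>, the second one keeps the projection \<open>y'\<close> of \<open>z\<close> from the apex within \<open>\<epsilon>\<close> of \<open>y\<close>.\<close>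
  define \<delta> where "\<delta> = min (H / 2) (\<epsilon> / (2 * (1 + D / H)))"
  have \<delta>: "\<delta> > 0" using H \<epsilon> D by (simp add: \<delta>_def add_pos_nonneg)
  have "z \<in> K" if z: "dist y z < \<delta>" "n \<bullet> z \<le> b" for z
  proof -
    define t where "t = (b - n \<bullet> z) / H"
    \<comment> \<open>The central projection of \<open>z\<close> from the apex to the hyperplane of \<open>e\<close>.\<close>
    define y' where "y' = (z - t *\<^sub>R u) /\<^sub>R (1 - t)"
    have t0: "t \<ge> 0" using z H by (simp add: t_def)
    have "b - n \<bullet> z = n \<bullet> (y - z)" using f(9)[OF ye] by (simp add: inner_diff_right)
    also have "\<dots> \<le> norm (y - z)" using Cauchy_Schwarz_ineq2[of n "y - z"] f(1) by simp
    finally have tle: "t * H \<le> dist y z" using H by (simp add: t_def dist_norm)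
    then have "t * H < H / 2" using z(1) by (simp add: \<delta>_def)
    then have t1: "t < 1/2" using H by simp
    have z_eq: "z = t *\<^sub>R u + (1 - t) *\<^sub>R y'" using t1 by (simp add: y'_def)
    have "n \<bullet> z = b - t * H" using H by (simp add: t_def)
    then have "(1 - t) * (n \<bullet> y') = (1 - t) * b"
      using arg_cong[OF z_eq, of "\<lambda>x. n \<bullet> x"] by (simp add: inner_add_right H_def algebra_simps)
    then have aff: "y' \<in> affine hull e" using t1 f(3) by simp
    have "(1 - t) *\<^sub>R (y' - y) = (z - y) - t *\<^sub>R (u - y)"
      by (subst z_eq) (simp add: algebra_simps)
    then have "(1 - t) * norm (y' - y) = norm ((z - y) - t *\<^sub>R (u - y))"
      using t1 norm_scaleR[of "1 - t" "y' - y"] by simp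
    also have "\<dots> \<le> dist y z + t * D"
      using norm_triangle_ineq4[of "z - y" "t *\<^sub>R (u - y)"] t0 by (simp add: D_def dist_norm norm_minus_commute)
    also have "t * D \<le> dist y z / H * D"
      using tle H D by (intro mult_right_mono) (auto simp: pos_le_divide_eq)
    finally have "(1 - t) * norm (y' - y) \<le> dist y z * (1 + D / H)" by (simp add: algebra_simps)
    moreover have "dist y z * (1 + D / H) < \<epsilon> / (2 * (1 + D / H)) * (1 + D / H)"
      using z(1) D H by (intro mult_strict_right_mono) (auto simp: \<delta>_def add_pos_nonneg)
    moreover have "\<epsilon> / (2 * (1 + D / H)) * (1 + D / H) = \<epsilon> / 2"
      using D H add_pos_nonneg[of 1 "D / H"] nonzero_mult_divide_mult_cancel_right[of "1 + D / H" \<epsilon> 2] by simp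
    moreover have "1/2 * norm (y' - y) \<le> (1 - t) * norm (y' - y)" using t1 by (intro mult_right_mono) auto
    ultimately have "norm (y' - y) < \<epsilon>" by linarith
    then have "y' \<in> e" using \<epsilon>(2) aff by (auto simp: dist_norm norm_minus_commute)
    then have "y' \<in> K" "u \<in> K" using f(10,11) by auto
    moreover have "convex K" using f(5) by simp
    ultimately show ?thesis using t0 t1 unfolding z_eq by (intro convexD) auto
  qed
  then show ?thesis using \<delta> by blast
qed

text \<open>
  Project the disc through the centre of the inscribed ball, parallel to \<open>e\<close>, from the apex onto the base. It lies at a
  height \<open>s \<le> 1\<close>, so the projection enlarges it by the factor \<open>1 / s \<ge> 1\<close>.
\<close>
lemma facet_flat_ball:
  assumes F: "facet_frame K e u n b" and c: "cball c r \<subseteq> K" "r > 0"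
  shows "\<exists>y\<in>e. \<forall>w. n \<bullet> w = 0 \<longrightarrow> norm w \<le> r \<longrightarrow> y + w \<in> e"
proof -
  note f = facet_frameD[OF F]
  define H where "H = b - n \<bullet> u"
  have H: "H > 0" using f by (simp add: H_def)
  have "c \<in> K" using c by (intro subsetD[OF c(1)]) auto
  then obtain s y where s: "0 \<le> s" "s \<le> 1" "y \<in> e" "c = (1 - s) *\<^sub>R u + s *\<^sub>R y" "n \<bullet> c = n \<bullet> u + s * H"
    using facet_frame_point[OF F] unfolding H_def by metis
  \<comment> \<open>The lowest point of the ball is not below the apex, so the centre has positive height.\<close>
  have "c - r *\<^sub>R n \<in> K" using c f(1) by (intro subsetD[OF c(1)]) (auto simp: dist_norm)
  then obtain s' where s': "0 \<le> s'" "n \<bullet> (c - r *\<^sub>R n) = n \<bullet> u + s' * H"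
    using facet_frame_point[OF F] unfolding H_def by metis
  have "s * H = s' * H + r" using s s' f(2) by (simp add: inner_diff_right)
  then have spos: "s > 0" using s(1) s'(1) H c(2) by (metis add_nonneg_pos less_imp_le mult_nonneg_nonneg less_eq_real_def mult_zero_left order_less_irrefl)
  have "y + w \<in> e" if w: "n \<bullet> w = 0" "norm w \<le> r" for w
  proof -
    have "s * norm w \<le> 1 * r" using s w c by (intro mult_mono) auto
    then have "c + s *\<^sub>R w \<in> K" using s by (intro subsetD[OF c(1)]) (auto simp: dist_norm)
    then obtain t y' where t: "y' \<in> e" "c + s *\<^sub>R w = (1 - t) *\<^sub>R u + t *\<^sub>R y'" "n \<bullet> (c + s *\<^sub>R w) = n \<bullet> u + t * H"
      using facet_frame_point[OF F] unfolding H_def by metis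
    have "t = s" using t(3) s(5) w(1) H by (simp add: inner_add_right)
    then have "s *\<^sub>R (y + w) = s *\<^sub>R y'" using t(2) s(4) by (simp add: scaleR_add_right algebra_simps)
    then show ?thesis using spos t(1) by simp
  qed
  then show ?thesis using s(3) by blast
qed

lemma facet_directions:
  assumes F: "facet_frame K e u n b" and c: "cball c r \<subseteq> K" "r > 0"
  shows "span {x - y | x y. x \<in> e \<and> y \<in> e} = {w. n \<bullet> w = 0}"
proof
  note f = facet_frameD[OF F]
  have "subspace {w. n \<bullet> w = 0}" by (rule subspace_hyperplane)
  moreover have "{x - y | x y. x \<in> e \<and> y \<in> e} \<subseteq> {w. n \<bullet> w = 0}" using f(9) by (auto simp: inner_diff_right)
  ultimately show "span {x - y | x y. x \<in> e \<and> y \<in> e} \<subseteq> {w. n \<bullet> w = 0}" by (simp add: span_minimal)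
  obtain y where y: "y \<in> e" "\<And>w. n \<bullet> w = 0 \<Longrightarrow> norm w \<le> r \<Longrightarrow> y + w \<in> e"
    using facet_flat_ball[OF assms] by blast
  show "{w. n \<bullet> w = 0} \<subseteq> span {x - y | x y. x \<in> e \<and> y \<in> e}"
  proof
    fix w assume "w \<in> {w. n \<bullet> w = 0}"
    then have w: "n \<bullet> w = 0" by simp
    show "w \<in> span {x - y | x y. x \<in> e \<and> y \<in> e}"
    proof (cases "w = 0")
      case False
      have "y + (r / norm w) *\<^sub>R w \<in> e" using w c False by (intro y(2)) auto
      then have "(y + (r / norm w) *\<^sub>R w) - y \<in> {x - y | x y. x \<in> e \<and> y \<in> e}" using y(1) by blast
      then have "(norm w / r) *\<^sub>R ((r / norm w) *\<^sub>R w) \<in> span {x - y | x y. x \<in> e \<and> y \<in> e}"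
        by (intro span_scale span_base) auto
      then show ?thesis using False c by simp
    qed (simp add: span_zero)
  qed
qed

lemma facet_diameter_ge:
  fixes K :: "(real^'n) set"
  assumes d: "CARD('n) \<ge> 2" and F: "facet_frame K e u n b" and c: "cball c r \<subseteq> K" "r > 0"
  shows "r \<le> diameter e"
proof -
  obtain y where y: "y \<in> e" "\<And>w. n \<bullet> w = 0 \<Longrightarrow> norm w \<le> r \<Longrightarrow> y + w \<in> e"
    using facet_flat_ball[OF F c] by blast
  obtain w where w: "w \<noteq> 0" "orthogonal n w"
    using orthogonal_to_vector_exists[of n] d by auto
  have "y + (r / norm w) *\<^sub>R w \<in> e" using w c by (intro y(2)) (auto simp: orthogonal_def)
  then have "dist (y + (r / norm w) *\<^sub>R w) y \<le> diameter e"
    using y(1) facet_frameD(7)[OF F] by (intro diameter_bounded_bound compact_imp_bounded) auto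
  then show ?thesis using w c by (simp add: dist_norm)
qed


section \<open>The size of a facet\<close>

lemma face_basis_props:
  fixes K :: "(real^'n) set"
  assumes F: "facet_frame K e u n b" and c: "cball c r \<subseteq> K" "r > 0"
  shows "pairwise orthogonal (face_basis e)" "\<And>b. b \<in> face_basis e \<Longrightarrow> norm b = 1"
    "span (face_basis e) = {w. n \<bullet> w = 0}" "finite (face_basis e)" "card (face_basis e) = CARD('n) - 1"
proof -
  note f = facet_frameD[OF F]
  let ?W = "{x - y | x y. x \<in> e \<and> y \<in> e}"
  obtain B where "pairwise orthogonal B" "\<And>x. x \<in> B \<Longrightarrow> norm x = 1" "span B = span ?W"
    by (rule orthonormal_basis_subspace[OF subspace_span[of ?W]]) (rule that; assumption)
  then have "\<exists>B. pairwise orthogonal B \<and> (\<forall>b\<in>B. norm b = 1) \<and> span B = span ?W" by blast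
  from someI_ex[OF this]
  have *: "pairwise orthogonal (face_basis e) \<and> (\<forall>b\<in>face_basis e. norm b = 1) \<and> span (face_basis e) = span ?W"
    unfolding face_basis_def .
  then show "pairwise orthogonal (face_basis e)" "\<And>b. b \<in> face_basis e \<Longrightarrow> norm b = 1" by auto
  show sp: "span (face_basis e) = {w. n \<bullet> w = 0}" using * facet_directions[OF assms] by simp
  have ind: "independent (face_basis e)" using * by (intro pairwise_orthogonal_independent) auto
  then show "finite (face_basis e)" by (rule independent_imp_finite)
  have "n \<noteq> 0" using f(1) by auto
  then show "card (face_basis e) = CARD('n) - 1"
    using dim_span_eq_card_independent[OF ind] dim_hyperplane[of n] by (simp add: sp)
qed

lemma sets_face_measure [simp]: "sets (face_measure e) = sets borel"
  by (simp add: face_measure_def Let_def)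

text \<open>
  In the orthonormal coordinates defining the measure, the facet lies in a cube of half width \<open>h\<close> around its base point
  and contains a cube of half width \<open>r / d\<close> around the centre of its inscribed disc. There are \<open>d - 1\<close> coordinates.
\<close>
lemma face_measure_bounds:
  fixes K :: "(real^'n) set"
  assumes F: "facet_frame K e u n b" and c: "cball c r \<subseteq> K" "r > 0" and h: "diameter e \<le> h"
  shows "emeasure (face_measure e) e < \<infinity>"
    "measure (face_measure e) e \<le> (2 * h) ^ (CARD('n) - 1)"
    "(2 * (r / CARD('n))) ^ (CARD('n) - 1) \<le> measure (face_measure e) e"
proof -
  note f = facet_frameD[OF F]
  let ?B = "face_basis e"
  note B = face_basis_props[OF F c]
  interpret product_sigma_finite "\<lambda>_::real^'n. lborel :: real measure"
    by (rule product_sigma_finite.intro) (rule sigma_finite_lborel)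
  let ?P = "\<Pi>\<^sub>M b\<in>?B. (lborel :: real measure)"
  define a where "a = (SOME a. a \<in> e)"
  have a: "a \<in> e" unfolding a_def using f(6) by (auto intro: someI)
  define \<phi> where "\<phi> = (\<lambda>g. a + (\<Sum>b\<in>?B. g b *\<^sub>R b))"
  have e_meas: "e \<in> sets borel" using f(7) by (simp add: compact_imp_closed borel_closed)
  have \<phi>_meas [measurable]: "\<phi> \<in> measurable ?P borel" unfolding \<phi>_def by measurable
  have fm: "face_measure e = distr ?P borel \<phi>" by (simp add: face_measure_def Let_def a_def \<phi>_def)
  have em: "emeasure (face_measure e) e = emeasure ?P (\<phi> -` e \<inter> space ?P)"
    unfolding fm using e_meas by (simp add: emeasure_distr)
  have vi: "\<phi> -` e \<inter> space ?P \<in> sets ?P" using measurable_sets[OF \<phi>_meas e_meas] by simp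
  have inner_B: "b \<bullet> b' = (if b = b' then 1 else 0)" if "b \<in> ?B" "b' \<in> ?B" for b b'
    using B(1) B(2)[OF that(1)] that by (auto simp: pairwise_def orthogonal_def norm_eq_1)
  have box: "emeasure ?P (PiE ?B (\<lambda>b. {g b - s..g b + s})) = ennreal ((2 * s) ^ (CARD('n) - 1))" if "s \<ge> 0" for g s
    using that B(4,5) by (subst emeasure_PiM) (auto simp: ennreal_power power_mult_distrib)
  have h0: "h \<ge> 0" using h diameter_ge_0[OF compact_imp_bounded[OF f(7)]] by linarith
  have "\<phi> -` e \<inter> space ?P \<subseteq> PiE ?B (\<lambda>b. {0 - h..0 + h})"
  proof
    fix g assume g: "g \<in> \<phi> -` e \<inter> space ?P"
    have "\<bar>g b\<bar> \<le> h" if b: "b \<in> ?B" for b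
    proof -
      have "b \<bullet> (\<phi> g - a) = (\<Sum>b'\<in>?B. g b' * (b \<bullet> b'))" by (simp add: \<phi>_def inner_sum_right)
      also have "\<dots> = (\<Sum>b'\<in>?B. if b' = b then g b' else 0)" using inner_B[OF b] by (intro sum.cong) auto
      also have "\<dots> = g b" using b B(4) by simp
      finally have "\<bar>g b\<bar> \<le> norm (\<phi> g - a)"
        using Cauchy_Schwarz_ineq2[of b "\<phi> g - a"] B(2)[OF b] by simp
      also have "\<dots> \<le> diameter e"
        using g a f(7) diameter_bounded_bound[of e "\<phi> g" a] by (auto simp: dist_norm compact_imp_bounded)
      finally show ?thesis using h by simp
    qed
    then show "g \<in> PiE ?B (\<lambda>b. {0 - h..0 + h})" using g by (force simp: space_PiM PiE_def Pi_def abs_le_iff)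
  qed
  then have "emeasure (face_measure e) e \<le> ennreal ((2 * h) ^ (CARD('n) - 1))"
    unfolding em box[OF h0, of "\<lambda>_. 0", symmetric] by (intro emeasure_mono sets_PiM_I_finite B(4)) auto
  then show fin: "emeasure (face_measure e) e < \<infinity>" "measure (face_measure e) e \<le> (2 * h) ^ (CARD('n) - 1)"
    using h0 by (auto simp: measure_def intro: le_less_trans ennreal_less_top enn2real_leI)
  obtain y where y: "y \<in> e" "\<And>w. n \<bullet> w = 0 \<Longrightarrow> norm w \<le> r \<Longrightarrow> y + w \<in> e"
    using facet_flat_ball[OF F c] by blast
  let ?s = "r / CARD('n)"
  have "PiE ?B (\<lambda>b. {(y - a) \<bullet> b - ?s..(y - a) \<bullet> b + ?s}) \<subseteq> \<phi> -` e \<inter> space ?P"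
  proof
    fix g assume g: "g \<in> PiE ?B (\<lambda>b. {(y - a) \<bullet> b - ?s..(y - a) \<bullet> b + ?s})"
    have "y - a \<in> span ?B" using B(3) f(9) y(1) a by (simp add: inner_diff_right)
    then have exp: "(\<Sum>b\<in>?B. ((y - a) \<bullet> b) *\<^sub>R b) = y - a"
      using orthonormal_basis_expand[OF B(1,2) _ B(4)] by blast
    define w where "w = (\<Sum>b\<in>?B. (g b - (y - a) \<bullet> b) *\<^sub>R b)"
    have "\<phi> g = y + w"
      using exp by (simp add: \<phi>_def w_def scaleR_diff_left sum_subtractf)
    moreover have "n \<bullet> w = 0"
    proof -
      have "w \<in> span ?B" unfolding w_def by (intro span_sum span_scale span_base)
      then show ?thesis using B(3) by simp
    qed
    moreover have "norm w \<le> r"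
    proof -
      have "norm w \<le> (\<Sum>b\<in>?B. norm ((g b - (y - a) \<bullet> b) *\<^sub>R b))" unfolding w_def by (rule norm_sum)
      also have "\<dots> \<le> (\<Sum>b\<in>?B. ?s)"
      proof (intro sum_mono)
        fix b assume b: "b \<in> ?B"
        then have "g b \<in> {(y - a) \<bullet> b - ?s..(y - a) \<bullet> b + ?s}" using g by blast
        then show "norm ((g b - (y - a) \<bullet> b) *\<^sub>R b) \<le> ?s" using B(2)[OF b] by (simp add: abs_le_iff)
      qed
      also have "\<dots> = real (CARD('n) - 1) * ?s" using B(5) by simp
      also have "\<dots> \<le> real CARD('n) * ?s" using c by (intro mult_right_mono) auto
      finally show ?thesis by simp
    qed
    ultimately show "g \<in> \<phi> -` e \<inter> space ?P" using g y(2) by (auto simp: space_PiM PiE_def)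
  qed
  then have "emeasure ?P (PiE ?B (\<lambda>b. {(y - a) \<bullet> b - ?s..(y - a) \<bullet> b + ?s})) \<le> emeasure ?P (\<phi> -` e \<inter> space ?P)"
    using vi by (rule emeasure_mono)
  then have "ennreal ((2 * ?s) ^ (CARD('n) - 1)) \<le> emeasure (face_measure e) e"
    unfolding em using c by (subst (asm) box) auto
  also have "\<dots> = ennreal (measure (face_measure e) e)"
    using fin(1) by (intro emeasure_eq_ennreal_measure) auto
  finally show "(2 * ?s) ^ (CARD('n) - 1) \<le> measure (face_measure e) e"
    by (subst (asm) ennreal_le_iff) auto
qed


section \<open>Interior, barycenter and traces of an element\<close>

lemma simplex_interior_nonempty:
  fixes K :: "(real^'n) set"
  assumes "int CARD('n) simplex K" shows "interior K \<noteq> {}" "rel_interior K = interior K"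
proof -
  have *: "aff_dim K = int (DIM(real^'n))" using aff_dim_simplex[OF assms] by simp
  show "rel_interior K = interior K" by (rule interior_rel_interior[OF *])
  moreover have "K \<noteq> {}" using * by auto
  ultimately show "interior K \<noteq> {}"
    using rel_interior_eq_empty[OF convex_simplex[OF assms]] by simp
qed

lemma barycenter_in_interior:
  fixes K :: "(real^'n) set"
  assumes K: "int CARD('n) simplex K" shows "barycenter K \<in> interior K"
proof -
  obtain C where C: "\<not> affine_dependent C" "int (card C) = int CARD('n) + 1" "K = convex hull C"
    using K by (auto simp: simplex_def)
  have "vertices K = C"
    using extreme_point_of_convex_hull_affine_independent[OF C(1)] by (auto simp: vertices_def C(3))
  then have "barycenter K = (\<Sum>x\<in>C. (1 / real (card C)) *\<^sub>R x)"
    by (simp add: barycenter_def scaleR_sum_right divide_inverse)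
  moreover have "card C > 0" using C(2) by linarith
  ultimately have "barycenter K \<in> rel_interior (convex hull C)"
    by (subst rel_interior_convex_hull_explicit[OF C(1)]) (auto intro!: exI[of _ "\<lambda>_. 1 / real (card C)"])
  then show ?thesis using simplex_interior_nonempty(2)[OF K] C(3) by simp
qed

lemma simplex_facets:
  fixes K :: "(real^'n) set"
  assumes K: "int CARD('n) simplex K"
  shows "finite {e. e facet_of K}" "card {e. e facet_of K} \<le> CARD('n) + 1"
proof -
  obtain C where C: "\<not> affine_dependent C" "int (card C) = int CARD('n) + 1" "K = convex hull C"
    using K by (auto simp: simplex_def)
  have fin: "finite C" using aff_independent_finite[OF C(1)] .
  have sub: "{e. e facet_of K} \<subseteq> (\<lambda>u. convex hull (C - {u})) ` C"
    using facet_of_convex_hull_affine_independent[OF C(1)] C(3) by auto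
  then show "finite {e. e facet_of K}" using fin finite_subset by blast
  have "card {e. e facet_of K} \<le> card C" using sub fin by (meson card_image_le card_mono finite_imageI order_trans)
  then show "card {e. e facet_of K} \<le> CARD('n) + 1" using C(2) by simp
qed

lemma trace_from_eq:
  fixes K :: "(real^'n) set" and p :: "real^'n \<Rightarrow> real"
  assumes K: "int CARD('n) simplex K" and x: "x \<in> K" and p: "continuous_on UNIV p"
    and w: "\<And>y. y \<in> interior K \<Longrightarrow> w y = p y"
  shows "trace_from K w x = p x"
  unfolding trace_from_def
proof (rule tendsto_Lim)
  have "x \<in> closure (interior K)"
    using x convex_closure_interior[OF convex_simplex[OF K] simplex_interior_nonempty(1)[OF K]] closure_subset by blast
  then have "x islimpt interior K"
    unfolding closure_def using interior_limit_point[of x "interior K"] by auto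
  then show "at x within interior K \<noteq> bot" by (simp add: trivial_limit_within)
  have "(p \<longlongrightarrow> p x) (at x within interior K)"
    using p by (meson UNIV_I continuous_on_def subset_UNIV tendsto_within_subset)
  moreover have "\<forall>\<^sub>F y in at x within interior K. p y = w y"
    unfolding eventually_at_filter using w by (auto intro: always_eventually)
  ultimately show "(w \<longlongrightarrow> p x) (at x within interior K)" by (rule Lim_transform_eventually)
qed


section \<open>Chains of elements\<close>

text \<open>
  In a finite relation a path can be shortened to at most \<open>card R\<close> steps, each bounded by the root of the sum on the
  right. The constant is crude, but depends on \<open>card R\<close> alone.
\<close>
lemma diff_along_path:
  fixes f :: "'a \<Rightarrow> real"
  assumes R: "finite R" and path: "(a, b) \<in> R\<^sup>*"
  shows "(f a - f b)\<^sup>2 \<le> (real (card R))\<^sup>2 * (\<Sum>(x, y)\<in>R. (f x - f y)\<^sup>2)"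
proof -
  define D where "D = (\<Sum>(x, y)\<in>R. (f x - f y)\<^sup>2)"
  have D0: "D \<ge> 0" unfolding D_def by (intro sum_nonneg) auto
  have step: "\<bar>f x - f y\<bar> \<le> sqrt D" if "(x, y) \<in> R" for x y
  proof -
    have "(f x - f y)\<^sup>2 \<le> D"
      unfolding D_def using member_le_sum[OF that, of "\<lambda>(x, y). (f x - f y)\<^sup>2"] R by auto
    then show ?thesis by (metis real_sqrt_abs real_sqrt_le_iff)
  qed
  have steps: "(a, b) \<in> R ^^ j \<Longrightarrow> \<bar>f a - f b\<bar> \<le> real j * sqrt D" for j a b
  proof (induction j arbitrary: b)
    case (Suc j)
    then obtain c where c: "(a, c) \<in> R ^^ j" "(c, b) \<in> R" by auto
    then show ?case using Suc.IH[OF c(1)] step[OF c(2)] by (simp add: algebra_simps)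
  qed simp
  obtain j where j: "j \<le> card R" "(a, b) \<in> R ^^ j"
    using path unfolding rtrancl_finite_eq_relpow[OF R] by auto
  have "\<bar>f a - f b\<bar> \<le> real (card R) * sqrt D"
    using steps[OF j(2)] j(1) D0 by (meson mult_right_mono of_nat_mono order_trans real_sqrt_ge_zero)
  then have "(f a - f b)\<^sup>2 \<le> (real (card R) * sqrt D)\<^sup>2" by (metis abs_ge_zero power2_abs power_mono)
  then show ?thesis using D0 by (simp add: power_mult_distrib D_def)
qed

text \<open>
  For such a point \<open>b\<close>, the line through \<open>a\<close> and \<open>b\<close> meets the sets \<open>F\<close> at most in \<open>a\<close>. It exists since joining a set of
  codimension two with \<open>a\<close> raises the dimension by at most one, and finitely many proper affine subspaces, being null sets, do not cover
  a nonempty open set.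
\<close>
lemma not_in_affine_hulls_exists:
  fixes U :: "'a::euclidean_space set"
  assumes "open U" "U \<noteq> {}" "finite \<F>" "\<And>F. F \<in> \<F> \<Longrightarrow> aff_dim F \<le> int (DIM('a)) - 2"
  shows "\<exists>b\<in>U. \<forall>F\<in>\<F>. b \<notin> affine hull (insert a F)"
proof (rule ccontr)
  assume "\<not> ?thesis"
  then have "U \<subseteq> (\<Union>F\<in>\<F>. affine hull (insert a F))" by blast
  moreover have "negligible (affine hull (insert a F))" if "F \<in> \<F>" for F
  proof -
    have "aff_dim (insert a F) \<le> aff_dim F + 1" by (simp add: aff_dim_insert)
    then have "aff_dim (affine hull (insert a F)) < int (DIM('a))"
      using assms(4)[OF that] by simp
    then have "interior (affine hull (insert a F)) = {}" by (rule low_dim_interior[OF less_imp_neq])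
    then show ?thesis
      by (simp add: negligible_convex_interior affine_imp_convex)
  qed
  then have "negligible (\<Union>F\<in>\<F>. affine hull (insert a F))"
    using assms(3) by (intro negligible_Union) auto
  ultimately have "negligible U" using negligible_subset by blast
  then show False using assms(1,2) open_not_negligible by blast
qed

text \<open>
  The volume bound for the number of elements near a given one; it limits both the size of a \<open>region\<close> and the number of
  regions to which an element belongs. The summand \<open>3\<close> collects the \<open>N + 1\<close> layers and two element diameters.
\<close>
definition overlap_bound :: "real \<Rightarrow> nat \<Rightarrow> nat \<Rightarrow> real" where
  "overlap_bound \<kappa> N d = ((real N + 3) * \<kappa>) ^ d"

text \<open>
  Quasi-uniformity enters through a length \<open>r\<close>, comparable with the mesh size, such that each element contains a ball of radius \<open>r\<close>.
\<close>
locale regular_mesh =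
  fixes \<Omega> :: "(real^'n) set" and \<T> :: "(real^'n) set set" and r \<kappa> :: real
  assumes dim_ge_2: "CARD('n) \<ge> 2"
    and convex_domain: "convex \<Omega>" and mesh: "simplicial_mesh \<Omega> \<T>"
    and r_pos: "r > 0" and \<kappa>_pos: "\<kappa> > 0"
    and inscribed_ball: "\<And>K. K \<in> \<T> \<Longrightarrow> \<exists>c. cball c r \<subseteq> K"
    and diameter_le: "\<And>K. K \<in> \<T> \<Longrightarrow> diameter K \<le> \<kappa> * r"
begin

lemma finite_mesh: "finite \<T>"
  and simplex_elem: "K \<in> \<T> \<Longrightarrow> int CARD('n) simplex K"
  and faces_meet: "K \<in> \<T> \<Longrightarrow> K' \<in> \<T> \<Longrightarrow> K \<inter> K' face_of K"
  and mesh_covers: "\<Union>\<T> = closure \<Omega>"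
  using mesh by (auto simp: simplicial_mesh_def triangulation_def)

lemma faces_meet': "K \<in> \<T> \<Longrightarrow> K' \<in> \<T> \<Longrightarrow> K \<inter> K' face_of K'"
  using faces_meet[of K' K] by (simp add: Int_commute)

lemma convex_elem: "K \<in> \<T> \<Longrightarrow> convex K"
  and compact_elem: "K \<in> \<T> \<Longrightarrow> compact K"
  and aff_dim_elem: "K \<in> \<T> \<Longrightarrow> aff_dim K = int CARD('n)"
  using simplex_elem convex_simplex compact_simplex aff_dim_simplex by blast+

definition center :: "(real^'n) set \<Rightarrow> real^'n" where
  "center K = (SOME c. cball c r \<subseteq> K)"

lemma center: "K \<in> \<T> \<Longrightarrow> cball (center K) r \<subseteq> K"
  unfolding center_def using inscribed_ball by (rule someI_ex)

lemma center_in: "K \<in> \<T> \<Longrightarrow> center K \<in> K"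
  using center r_pos by (metis centre_in_cball less_imp_le subsetD)

lemma dist_elem: "K \<in> \<T> \<Longrightarrow> x \<in> K \<Longrightarrow> y \<in> K \<Longrightarrow> dist x y \<le> \<kappa> * r"
  using diameter_bounded_bound[of K x y] diameter_le[of K] compact_elem[of K] by (auto dest: compact_imp_bounded)

lemma elem_subset: "K \<in> \<T> \<Longrightarrow> K \<subseteq> cball (center K) (\<kappa> * r)"
  using dist_elem center_in by auto

text \<open>
  All elements have full dimension, so none is a proper face of another.
\<close>
lemma elem_eq_if_face: assumes "K \<in> \<T>" "K' \<in> \<T>" "K \<inter> K' = K" shows "K = K'"
proof (rule ccontr)
  assume "K \<noteq> K'"
  moreover have "K face_of K'" using faces_meet'[OF assms(1,2)] assms(3) by simp
  ultimately show False
    using face_of_aff_dim_lt[OF convex_elem[OF assms(2)]] aff_dim_elem assms by fastforce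
qed

lemma interior_meets_imp_eq:
  assumes "K \<in> \<T>" "K' \<in> \<T>" "x \<in> interior K" "x \<in> K'" shows "K = K'"
proof (rule ccontr)
  assume "K \<noteq> K'"
  then have "(K \<inter> K') \<inter> interior K = {}"
    using face_of_disjoint_interior[OF faces_meet[OF assms(1,2)]] elem_eq_if_face assms by blast
  then show False using assms interior_subset by blast
qed

text \<open>
  The inscribed balls of distinct elements are disjoint; compare volumes.
\<close>
lemma card_elems_in_ball:
  assumes S: "S \<subseteq> \<T>" and R: "R \<ge> 0" and sub: "\<And>K. K \<in> S \<Longrightarrow> K \<subseteq> cball x (R * r)"
  shows "real (card S) \<le> R ^ CARD('n)"
proof -
  have fin: "finite S" using S finite_mesh finite_subset by blast
  let ?V = "unit_ball_vol (real CARD('n))"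
  have V: "?V > 0" by simp
  have inner: "ball (center K) r \<subseteq> interior K" if "K \<in> S" for K
    using center[of K] S that by (meson ball_subset_cball interior_maximal open_ball order_trans subsetD)
  have disj: "disjoint_family_on (\<lambda>K. ball (center K) r) S"
    unfolding disjoint_family_on_def
  proof (intro ballI impI)
    fix K K' assume K: "K \<in> S" "K' \<in> S" "K \<noteq> K'"
    have "interior K \<inter> K' = {}" using interior_meets_imp_eq[of K K'] K S by blast
    then show "ball (center K) r \<inter> ball (center K') r = {}"
      using inner[OF K(1)] inner[OF K(2)] interior_subset[of K'] by blast
  qed
  have "ennreal (real (card S) * (?V * r ^ CARD('n))) = (\<Sum>K\<in>S. emeasure lborel (ball (center K) r))"
    using r_pos by (simp add: emeasure_ball ennreal_mult ennreal_of_nat_eq_real_of_nat)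
  also have "\<dots> = emeasure lborel (\<Union>K\<in>S. ball (center K) r)"
    using fin disj by (intro sum_emeasure) auto
  also have "\<dots> \<le> emeasure lborel (cball x (R * r))"
  proof (intro emeasure_mono UN_least)
    show "ball (center K) r \<subseteq> cball x (R * r)" if "K \<in> S" for K
      using inner[OF that] sub[OF that] interior_subset[of K] by blast
  qed simp
  also have "\<dots> = ennreal (?V * (R * r) ^ CARD('n))"
    using R r_pos by (simp add: emeasure_cball)
  finally have "real (card S) * (?V * r ^ CARD('n)) \<le> ?V * (R * r) ^ CARD('n)"
    using R r_pos by (subst (asm) ennreal_le_iff) auto
  then have "real (card S) * (?V * r ^ CARD('n)) \<le> R ^ CARD('n) * (?V * r ^ CARD('n))"
    by (simp add: power_mult_distrib ac_simps)
  then show ?thesis using V r_pos by (simp add: mult_le_cancel_right)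
qed


section \<open>Chains of elements through common facets\<close>

definition face_adjacent :: "(real^'n) set set \<Rightarrow> ((real^'n) set \<times> (real^'n) set) set" where
  "face_adjacent Z = {(K, K'). K \<in> Z \<and> K' \<in> Z \<and> K \<noteq> K' \<and> (\<exists>e. e facet_of K \<and> e facet_of K')}"

lemma finite_face_adjacent: "Z \<subseteq> \<T> \<Longrightarrow> finite (face_adjacent Z)"
  by (rule finite_subset[of _ "\<T> \<times> \<T>"]) (use finite_mesh in \<open>auto simp: face_adjacent_def\<close>)

lemma card_face_adjacent: "Z \<subseteq> \<T> \<Longrightarrow> card (face_adjacent Z) \<le> (card Z)\<^sup>2"
proof -
  assume Z: "Z \<subseteq> \<T>"
  then have "finite (Z \<times> Z)" using finite_mesh finite_subset by blast
  moreover have "face_adjacent Z \<subseteq> Z \<times> Z" by (auto simp: face_adjacent_def)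
  ultimately have "card (face_adjacent Z) \<le> card (Z \<times> Z)" by (intro card_mono)
  then show ?thesis by (simp add: card_cartesian_product power2_eq_square)
qed

text \<open>
  Among the elements meeting the ball, let \<open>A\<close> be those reachable from \<open>K\<close>. An element of \<open>A\<close> and one outside of \<open>A\<close> share no facet, so they meet in codimension at
  least two. If \<open>K'\<close> were outside of \<open>A\<close>, a generic segment from \<open>K\<close> to \<open>K'\<close> would avoid all these intersections and be
  split by \<open>\<Union>A\<close> and the union of the other elements into two disjoint closed parts, although it is connected. The domain
  and the ball being convex, the segment is covered by the elements that meet the ball.
\<close>
lemma face_path:
  assumes K: "K \<in> \<T>" "K' \<in> \<T>" "K \<subseteq> cball x \<rho>" "K' \<subseteq> cball x \<rho>"
  shows "(K, K') \<in> (face_adjacent {T \<in> \<T>. T \<inter> cball x \<rho> \<noteq> {}})\<^sup>*"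
proof (rule ccontr)
  let ?Z = "{T \<in> \<T>. T \<inter> cball x \<rho> \<noteq> {}}"
  let ?R = "face_adjacent ?Z"
  assume not_path: "(K, K') \<notin> ?R\<^sup>*"
  define A where "A = {T \<in> ?Z. (K, T) \<in> ?R\<^sup>*}"
  have KZ: "K \<in> ?Z" "K' \<in> ?Z" using K center_in by auto
  have codim: "aff_dim (K1 \<inter> K2) \<le> int (DIM(real^'n)) - 2" if K12: "K1 \<in> A" "K2 \<in> ?Z - A" for K1 K2
  proof (rule ccontr)
    assume neg: "\<not> ?thesis"
    have in': "K1 \<in> \<T>" "K2 \<in> \<T>" "K1 \<noteq> K2" using K12 by (auto simp: A_def)
    have "K1 \<inter> K2 \<noteq> K1" using elem_eq_if_face in' by blast
    then have "aff_dim (K1 \<inter> K2) < int CARD('n)"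
      using face_of_aff_dim_lt[of K1 "K1 \<inter> K2"] convex_elem faces_meet in' aff_dim_elem by simp
    then have dimF: "aff_dim (K1 \<inter> K2) = int CARD('n) - 1" using neg by simp
    then have "K1 \<inter> K2 \<noteq> {}" using dim_ge_2 by auto
    then have "(K1 \<inter> K2) facet_of K1" "(K1 \<inter> K2) facet_of K2"
      using dimF faces_meet faces_meet' in' aff_dim_elem by (auto simp: facet_of_def)
    then have "(K1, K2) \<in> ?R" using K12 in' by (auto simp: face_adjacent_def A_def)
    then have "(K, K2) \<in> ?R\<^sup>*" using K12(1) by (auto simp: A_def intro: rtrancl_into_rtrancl)
    then show False using K12(2) by (auto simp: A_def)
  qed
  obtain a where a: "a \<in> interior K" using simplex_interior_nonempty(1)[OF simplex_elem[OF K(1)]] by blast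
  define \<F> where "\<F> = (\<lambda>(K1, K2). K1 \<inter> K2) ` (A \<times> (?Z - A))"
  have "finite (A \<times> (?Z - A))"
    using finite_mesh by (intro finite_cartesian_product finite_Diff) (auto simp: A_def)
  then have finF: "finite \<F>" unfolding \<F>_def by (rule finite_imageI)
  have dimF: "aff_dim F \<le> int (DIM(real^'n)) - 2" if "F \<in> \<F>" for F
  proof -
    obtain K1 K2 where "K1 \<in> A" "K2 \<in> ?Z - A" "F = K1 \<inter> K2" using \<open>F \<in> \<F>\<close> by (auto simp: \<F>_def)
    then show ?thesis using codim[of K1 K2] by simp
  qed
  have "\<exists>b\<in>interior K'. \<forall>F\<in>\<F>. b \<notin> affine hull (insert a F)"
    by (rule not_in_affine_hulls_exists[OF open_interior simplex_interior_nonempty(1)[OF simplex_elem[OF K(2)]] finF dimF])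
  then obtain b where b: "b \<in> interior K'" "\<forall>F\<in>\<F>. b \<notin> affine hull (insert a F)"
    by (rule bexE)
  let ?s = "closed_segment a b"
  have ab: "a \<in> K" "b \<in> K'" using a b(1) interior_subset by auto
  have s_ball: "?s \<subseteq> cball x \<rho>" using ab K by (intro closed_segment_subset) auto
  have "?s \<subseteq> closure \<Omega>"
    using ab K mesh_covers by (intro closed_segment_subset convex_closure convex_domain) auto
  then have "?s \<subseteq> \<Union>?Z" using s_ball mesh_covers by blast
  then have cover: "?s \<subseteq> \<Union>A \<union> \<Union>(?Z - A)" by auto
  have closed: "closed (\<Union>A)" "closed (\<Union>(?Z - A))"
    using finite_mesh compact_elem by (auto intro!: closed_Union simp: A_def compact_imp_closed)
  have "a \<in> \<Union>A \<inter> ?s" using ab KZ by (auto simp: A_def)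
  moreover have "b \<in> \<Union>(?Z - A) \<inter> ?s" using ab KZ not_path by (auto simp: A_def)
  moreover have "\<Union>A \<inter> \<Union>(?Z - A) \<inter> ?s = {}"
  proof (rule ccontr)
    assume "\<Union>A \<inter> \<Union>(?Z - A) \<inter> ?s \<noteq> {}"
    then obtain z K1 K2 where z: "z \<in> ?s" "K1 \<in> A" "z \<in> K1" "K2 \<in> ?Z - A" "z \<in> K2" by blast
    \<comment> \<open>As an interior point of \<open>K\<close>, the point \<open>a\<close> lies in no other element.\<close>
    have "z \<noteq> a"
    proof
      assume "z = a"
      then have "K = K1" "K = K2" using interior_meets_imp_eq[OF K(1) _ a] z by (auto simp: A_def)
      then show False using z by auto
    qed
    obtain t where t: "z = (1 - t) *\<^sub>R a + t *\<^sub>R b" "0 \<le> t" using z(1) by (auto simp: in_segment)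
    have "t \<noteq> 0" using t \<open>z \<noteq> a\<close> by auto
    \<comment> \<open>A common point \<open>z\<close> would put \<open>b\<close> on the line through \<open>a\<close> and \<open>z\<close>, against the choice of \<open>b\<close>.\<close>
    then have "b = (1 - 1 / t) *\<^sub>R a + (1 / t) *\<^sub>R z"
      using t(1) by (simp add: vec_eq_iff field_simps)
    then have "b \<in> affine hull {a, z}" unfolding affine_hull_2 by force
    also have "\<dots> \<subseteq> affine hull (insert a (K1 \<inter> K2))" using z by (intro hull_mono) auto
    finally show False using b(2) z(2,4) by (force simp: \<F>_def)
  qed
  ultimately show False
    using connected_closedD[OF connected_segment(1)[of a b] _ cover closed] by blast
qed


section \<open>Patches stay local\<close>

lemma layer_subset: "K \<in> \<T> \<Longrightarrow> layer \<T> t K \<subseteq> \<T>"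
  by (induction t) (auto simp: neighbours_def)

lemma layer_mono: "K \<in> \<T> \<Longrightarrow> layer \<T> t K \<subseteq> layer \<T> (Suc t) K"
proof
  fix T assume "K \<in> \<T>" and T: "T \<in> layer \<T> t K"
  then have "T \<in> \<T>" using layer_subset by blast
  then have "T \<in> neighbours \<T> T" using center_in[of T] by (auto simp: neighbours_def)
  then show "T \<in> layer \<T> (Suc t) K" using T by auto
qed

lemma self_in_layer: "K \<in> \<T> \<Longrightarrow> K \<in> layer \<T> t K"
proof (induction t)
  case (Suc t)
  then show ?case using layer_mono[of K t] by (meson subsetD)
qed simp

lemma layer_subset_ball:
  assumes "K \<in> \<T>" "T \<in> layer \<T> t K" shows "T \<subseteq> cball (center K) ((real t + 1) * \<kappa> * r)"
  using assms(2)
proof (induction t arbitrary: T)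
  case 0
  then show ?case using elem_subset[OF assms(1)] by simp
next
  case (Suc t)
  then obtain K' z where K': "K' \<in> layer \<T> t K" "T \<in> \<T>" "z \<in> K'" "z \<in> T" by (auto simp: neighbours_def)
  show ?case
  proof
    fix w assume "w \<in> T"
    then have "dist z w \<le> \<kappa> * r" using dist_elem[of T z w] K' by auto
    moreover have "dist (center K) z \<le> (real t + 1) * \<kappa> * r" using Suc.IH[OF K'(1)] K'(3) by auto
    ultimately show "w \<in> cball (center K) ((real (Suc t) + 1) * \<kappa> * r)"
      using dist_triangle[of "center K" w z] by (simp add: algebra_simps)
  qed
qed

text \<open>
  A layer that adds no element is stationary from then on. Hence every layer before the threshold \<open>N\<close> is reached adds at
  least one element, and \<open>N\<close> layers suffice. So the radius of a patch is bounded in terms of \<open>N\<close> and \<open>r\<close>.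
\<close>
lemma patch_index_le:
  assumes K: "K \<in> \<T>" and ex: "patches_exist N \<T>"
  shows "(LEAST t. N \<le> card (layer \<T> t K)) \<le> N"
proof -
  define t0 where "t0 = (LEAST t. N \<le> card (layer \<T> t K))"
  have ex': "\<exists>t. N \<le> card (layer \<T> t K)" using ex K by (auto simp: patches_exist_def)
  have t0: "N \<le> card (layer \<T> t0 K)" unfolding t0_def using ex' by (rule LeastI_ex)
  have least: "card (layer \<T> t K) < N" if "t < t0" for t
    using not_less_Least[of t "\<lambda>t. N \<le> card (layer \<T> t K)"] that by (simp add: t0_def)
  have fin: "finite (layer \<T> t K)" for t using layer_subset[OF K] finite_mesh finite_subset by blast
  have growth: "t \<le> t0 \<Longrightarrow> Suc t \<le> card (layer \<T> t K)" for t
  proof (induction t)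
    case (Suc t)
    have "layer \<T> t K \<noteq> layer \<T> (Suc t) K"
    proof
      assume stat: "layer \<T> t K = layer \<T> (Suc t) K"
      have "layer \<T> (t + j) K = layer \<T> t K" for j
      proof (induction j)
        case (Suc j)
        then have "layer \<T> (t + Suc j) K = layer \<T> (Suc t) K" by simp
        then show ?case by (simp only: stat)
      qed simp
      from this[of "t0 - t"] show False using t0 least[of t] Suc.prems by simp
    qed
    then have "card (layer \<T> t K) < card (layer \<T> (Suc t) K)"
      using layer_mono[OF K, of t] by (intro psubset_card_mono fin psubsetI)
    then show ?case using Suc by simp
  qed simp
  show ?thesis
  proof (cases t0)
    case (Suc t)
    then show ?thesis using growth[of t] least[of t] by (simp add: t0_def)
  qed (simp add: t0_def)
qed

lemma patch_subset: "K \<in> \<T> \<Longrightarrow> patch N \<T> K \<subseteq> \<T>"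
  and self_in_patch: "K \<in> \<T> \<Longrightarrow> K \<in> patch N \<T> K"
  unfolding patch_def using layer_subset self_in_layer by blast+

lemma finite_patch: "K \<in> \<T> \<Longrightarrow> finite (patch N \<T> K)"
  using patch_subset finite_mesh finite_subset by blast

lemma patch_subset_ball:
  assumes "K \<in> \<T>" "patches_exist N \<T>" "T \<in> patch N \<T> K"
  shows "T \<subseteq> cball (center K) ((real N + 1) * \<kappa> * r)"
proof -
  have "T \<subseteq> cball (center K) ((real (LEAST t. N \<le> card (layer \<T> t K)) + 1) * \<kappa> * r)"
    using layer_subset_ball assms by (auto simp: patch_def)
  also have "\<dots> \<subseteq> cball (center K) ((real N + 1) * \<kappa> * r)"
    using patch_index_le[OF assms(1,2)] \<kappa>_pos r_pos by (intro subset_cball mult_right_mono) auto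
  finally show ?thesis .
qed


section \<open>Differences over patches\<close>

text \<open>
  The elements that a chain inside the ball containing the patch of \<open>K\<close> can visit. A patch itself need not contain
  these chains, since its elements may touch in lower-dimensional faces only.
\<close>
definition region :: "nat \<Rightarrow> (real^'n) set \<Rightarrow> (real^'n) set set" where
  "region N K = {T \<in> \<T>. T \<inter> cball (center K) ((real N + 1) * \<kappa> * r) \<noteq> {}}"

lemma region_subset: "region N K \<subseteq> \<T>" by (auto simp: region_def)

lemma card_region: assumes "K \<in> \<T>" shows "real (card (region N K)) \<le> overlap_bound \<kappa> N CARD('n)"
  unfolding overlap_bound_def
proof (rule card_elems_in_ball[OF region_subset])
  fix T assume "T \<in> region N K"
  then obtain z where z: "T \<in> \<T>" "z \<in> T" "dist (center K) z \<le> (real N + 1) * \<kappa> * r" by (auto simp: region_def)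
  show "T \<subseteq> cball (center K) (((real N + 3) * \<kappa>) * r)"
  proof
    fix w assume "w \<in> T"
    then have "dist z w \<le> \<kappa> * r" using dist_elem z by auto
    then have "dist (center K) w \<le> (real N + 2) * \<kappa> * r"
      using z(3) dist_triangle[of "center K" w z] by (simp add: algebra_simps)
    also have "\<dots> \<le> (real N + 3) * \<kappa> * r" using \<kappa>_pos r_pos by (intro mult_right_mono) auto
    finally show "w \<in> cball (center K) (((real N + 3) * \<kappa>) * r)" by simp
  qed
qed (use \<kappa>_pos in simp_all)

lemma card_regions_containing:
  assumes "T \<in> \<T>" shows "real (card {K \<in> \<T>. T \<in> region N K}) \<le> overlap_bound \<kappa> N CARD('n)"
  unfolding overlap_bound_def
proof (rule card_elems_in_ball)
  fix K assume "K \<in> {K \<in> \<T>. T \<in> region N K}"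
  then obtain z where z: "K \<in> \<T>" "z \<in> T" "dist (center K) z \<le> (real N + 1) * \<kappa> * r" by (auto simp: region_def)
  show "K \<subseteq> cball (center T) (((real N + 3) * \<kappa>) * r)"
  proof
    fix w assume "w \<in> K"
    then have "dist (center K) w \<le> \<kappa> * r" using dist_elem z(1) center_in by auto
    moreover have "dist (center T) z \<le> \<kappa> * r" using dist_elem assms z(2) center_in by auto
    ultimately have "dist (center T) w \<le> \<kappa> * r + (real N + 1) * \<kappa> * r + \<kappa> * r"
      using z(3) dist_triangle[of "center T" w z] dist_triangle[of z w "center K"] by (simp add: dist_commute)
    then show "w \<in> cball (center T) (((real N + 3) * \<kappa>) * r)" by (simp add: algebra_simps)
  qed
qed (use \<kappa>_pos in auto)

lemma patch_oscillation:
  fixes f :: "(real^'n) set \<Rightarrow> real"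
  assumes "K \<in> \<T>" "patches_exist N \<T>" "T \<in> patch N \<T> K"
  shows "(f K - f T)\<^sup>2 \<le> (overlap_bound \<kappa> N CARD('n)) ^ 4 * (\<Sum>(K1, K2)\<in>face_adjacent (region N K). (f K1 - f K2)\<^sup>2)"
proof -
  let ?R = "face_adjacent (region N K)"
  have path: "(K, T) \<in> ?R\<^sup>*"
    unfolding region_def
    using face_path[of K T] assms patch_subset patch_subset_ball[OF assms(1,2)] self_in_patch by blast
  have "(f K - f T)\<^sup>2 \<le> (real (card ?R))\<^sup>2 * (\<Sum>(K1, K2)\<in>?R. (f K1 - f K2)\<^sup>2)"
    by (rule diff_along_path[OF finite_face_adjacent[OF region_subset] path])
  also have "\<dots> \<le> (overlap_bound \<kappa> N CARD('n)) ^ 4 * (\<Sum>(K1, K2)\<in>?R. (f K1 - f K2)\<^sup>2)"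
  proof (intro mult_right_mono sum_nonneg)
    have "real (card ?R) \<le> (real (card (region N K)))\<^sup>2"
      using card_face_adjacent[OF region_subset] of_nat_mono by (metis of_nat_power)
    also have "\<dots> \<le> (overlap_bound \<kappa> N CARD('n))\<^sup>2" using card_region[OF assms(1)] by (intro power_mono) auto
    finally have "(real (card ?R))\<^sup>2 \<le> ((overlap_bound \<kappa> N CARD('n))\<^sup>2)\<^sup>2" by (intro power_mono) auto
    then show "(real (card ?R))\<^sup>2 \<le> (overlap_bound \<kappa> N CARD('n)) ^ 4" by (simp flip: power_mult)
  qed auto
  finally show ?thesis .
qed

text \<open>
  Each pair of adjacent elements is counted once for every region containing it.
\<close>
lemma sum_over_regions:
  fixes g :: "(real^'n) set \<times> (real^'n) set \<Rightarrow> real"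
  assumes "\<And>z. g z \<ge> 0"
  shows "(\<Sum>K\<in>\<T>. \<Sum>z\<in>face_adjacent (region N K). g z) \<le> overlap_bound \<kappa> N CARD('n) * (\<Sum>z\<in>face_adjacent \<T>. g z)"
proof -
  have sub: "face_adjacent (region N K) \<subseteq> face_adjacent \<T>" for K using region_subset by (auto simp: face_adjacent_def)
  have fin: "finite (face_adjacent \<T>)" by (rule finite_face_adjacent) simp
  have "(\<Sum>K\<in>\<T>. \<Sum>z\<in>face_adjacent (region N K). g z) =
      (\<Sum>K\<in>\<T>. \<Sum>z\<in>face_adjacent \<T>. if z \<in> face_adjacent (region N K) then g z else 0)"
    by (intro sum.cong refl sum.mono_neutral_cong_left fin sub) auto
  also have "\<dots> = (\<Sum>z\<in>face_adjacent \<T>. \<Sum>K\<in>\<T>. if z \<in> face_adjacent (region N K) then g z else 0)"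
    by (rule sum.swap)
  also have "\<dots> = (\<Sum>z\<in>face_adjacent \<T>. real (card {K \<in> \<T>. z \<in> face_adjacent (region N K)}) * g z)"
    using finite_mesh by (intro sum.cong refl) (simp add: sum.If_cases Collect_conj_eq flip: sum.inter_filter)
  also have "\<dots> \<le> (\<Sum>z\<in>face_adjacent \<T>. overlap_bound \<kappa> N CARD('n) * g z)"
  proof (intro sum_mono mult_right_mono assms)
    fix z assume z: "z \<in> face_adjacent \<T>"
    have "{K \<in> \<T>. z \<in> face_adjacent (region N K)} \<subseteq> {K \<in> \<T>. fst z \<in> region N K}"
      by (auto simp: face_adjacent_def)
    then have "card {K \<in> \<T>. z \<in> face_adjacent (region N K)} \<le> card {K \<in> \<T>. fst z \<in> region N K}"
      using finite_mesh by (intro card_mono) auto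
    also have "real \<dots> \<le> overlap_bound \<kappa> N CARD('n)" using z by (intro card_regions_containing) (auto simp: face_adjacent_def)
    finally show "real (card {K \<in> \<T>. z \<in> face_adjacent (region N K)}) \<le> overlap_bound \<kappa> N CARD('n)" by simp
  qed
  finally show ?thesis by (simp add: sum_distrib_left)
qed

end


section \<open>Two elements at a facet\<close>

context regular_mesh
begin

definition elems :: "(real^'n) set \<Rightarrow> (real^'n) set set" where
  "elems e = {K \<in> \<T>. e facet_of K}"

lemma elemsD: "K \<in> elems e \<Longrightarrow> K \<in> \<T>" "K \<in> elems e \<Longrightarrow> e facet_of K" "K \<in> elems e \<Longrightarrow> e \<subseteq> K"
  by (auto simp: elems_def dest: facet_of_imp_subset)

lemma finite_elems: "finite (elems e)"
  using finite_mesh by (simp add: elems_def)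

lemma normal_frame: "K \<in> elems e \<Longrightarrow> \<exists>u b. facet_frame K e u (outward_normal K e) b"
  using outward_normal_frame simplex_elem elemsD by blast

lemma norm_normal: "K \<in> elems e \<Longrightarrow> norm (outward_normal K e) = 1"
  using normal_frame facet_frameD(1) by blast

text \<open>
  The intersection is a common proper face containing \<open>e\<close>, so its dimension leaves no room for more.
\<close>
lemma common_facet_eq_Int:
  assumes K: "K1 \<in> elems e" "K2 \<in> elems e" "K1 \<noteq> K2"
  shows "K1 \<inter> K2 = e"
proof (rule ccontr)
  assume ne: "K1 \<inter> K2 \<noteq> e"
  note T = elemsD(1)[OF K(1)] elemsD(1)[OF K(2)]
  have sub: "e \<subseteq> K1 \<inter> K2" using elemsD(3) K by blast
  have "K1 \<inter> K2 \<noteq> K1" using elem_eq_if_face[OF T] K(3) by blast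
  then have 1: "aff_dim (K1 \<inter> K2) < int CARD('n)"
    using face_of_aff_dim_lt[OF convex_elem[OF T(1)] faces_meet[OF T]] aff_dim_elem[OF T(1)] by simp
  have "e face_of K1 \<inter> K2"
    using face_of_subset[OF facet_of_imp_face_of[OF elemsD(2)[OF K(1)]] sub] by simp
  then have "aff_dim e < aff_dim (K1 \<inter> K2)"
    using face_of_aff_dim_lt ne convex_Int convex_elem T by metis
  moreover have "aff_dim e = int CARD('n) - 1"
    using elemsD(2)[OF K(1)] aff_dim_elem[OF T(1)] by (simp add: facet_of_def)
  ultimately show False using 1 by simp
qed

text \<open>
  Unit vectors normal to the same hyperplane are equal or opposite. If they were equal, both elements would contain a half ball
  on the same side of the facet and meet outside of it.
\<close>
lemma opposite_normals:
  assumes K: "K1 \<in> elems e" "K2 \<in> elems e" "K1 \<noteq> K2"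
  shows "outward_normal K2 e = - outward_normal K1 e"
proof -
  let ?n1 = "outward_normal K1 e" and ?n2 = "outward_normal K2 e"
  obtain u1 b1 u2 b2 where F: "facet_frame K1 e u1 ?n1 b1" "facet_frame K2 e u2 ?n2 b2"
    using normal_frame K by blast
  note f1 = facet_frameD[OF F(1)] and f2 = facet_frameD[OF F(2)]
  have "?n2 \<bullet> w = 0" if "?n1 \<bullet> w = 0" for w
    using facet_frame_normal_orthogonal[OF F(1), of ?n2] f2(9) that by (simp add: inner_diff_right)
  then have "?n2 = ?n1 \<or> ?n2 = - ?n1" using unit_normals_of_hyperplane[OF f1(1) f2(1)] by blast
  moreover have "?n2 \<noteq> ?n1"
  proof
    assume eq: "?n2 = ?n1"
    obtain y where y: "y \<in> rel_interior e" using rel_interior_eq_empty[OF f1(8)] f1(6) by blast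
    have ye: "y \<in> e" using y rel_interior_subset by blast
    obtain \<delta>1 where d1: "\<delta>1 > 0" "\<And>z. dist y z < \<delta>1 \<Longrightarrow> ?n1 \<bullet> z \<le> b1 \<Longrightarrow> z \<in> K1"
      using facet_half_ball[OF F(1) y] by blast
    obtain \<delta>2 where d2: "\<delta>2 > 0" "\<And>z. dist y z < \<delta>2 \<Longrightarrow> ?n2 \<bullet> z \<le> b2 \<Longrightarrow> z \<in> K2"
      using facet_half_ball[OF F(2) y] by blast
    define t where "t = min \<delta>1 \<delta>2 / 2"
    define z where "z = y - t *\<^sub>R ?n1"
    have t: "t > 0" "t < \<delta>1" "t < \<delta>2" using d1 d2 by (auto simp: t_def)
    have dz: "dist y z = t" using t f1(1) by (simp add: z_def dist_norm)
    have nz: "?n1 \<bullet> z = b1 - t" using f1(2) f1(9)[OF ye] by (simp add: z_def inner_diff_right)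
    have "b1 = b2" using f1(9)[OF ye] f2(9)[OF ye] eq by simp
    then have "z \<in> K1 \<inter> K2" using d1(2)[of z] d2(2)[of z] dz nz t eq by simp
    then have "z \<in> e" using common_facet_eq_Int[OF K] by simp
    then show False using f1(9) nz t by force
  qed
  ultimately show ?thesis by blast
qed

text \<open>
  A third element would have a normal opposite to each of two opposite normals.
\<close>
lemma card_elems_le: "card (elems e) \<le> 2"
proof (cases "elems e = {}")
  case False
  then obtain K0 where K0: "K0 \<in> elems e" by blast
  let ?n = "\<lambda>K. outward_normal K e"
  have "inj_on ?n (elems e)"
  proof (rule inj_onI, rule ccontr)
    fix K K' assume K: "K \<in> elems e" "K' \<in> elems e" "?n K = ?n K'" "K \<noteq> K'"
    then have "?n K = - ?n K" using opposite_normals[OF K(1,2,4)] by simp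
    then have "?n K = 0" by (simp add: eq_neg_iff_add_eq_0 flip: scaleR_2)
    then show False using norm_normal[OF K(1)] by simp
  qed
  moreover have "?n ` elems e \<subseteq> {?n K0, - ?n K0}" using opposite_normals[OF K0] by blast
  ultimately have "card (elems e) \<le> card {?n K0, - ?n K0}" by (rule card_inj_on_le) simp
  also have "\<dots> \<le> 2" by (rule card_insert_le_m1) auto
  finally show ?thesis .
qed simp

lemma elems_of_pair:
  assumes K: "K1 \<in> elems e" "K2 \<in> elems e" "K1 \<noteq> K2"
  shows "elems e = {K1, K2}"
proof -
  have "card {K1, K2} = 2" using K(3) by simp
  then have "card (elems e) \<le> card {K1, K2}" using card_elems_le[of e] by linarith
  then have "{K1, K2} = elems e" using K by (intro card_seteq finite_elems) auto
  then show ?thesis by simp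
qed

lemma faces_iff: "e \<in> faces \<T> \<longleftrightarrow> elems e \<noteq> {}"
  by (auto simp: faces_def elems_def)

lemma finite_faces: "finite (faces \<T>)"
proof -
  have "faces \<T> = (\<Union>K\<in>\<T>. {e. e facet_of K})" by (auto simp: faces_def)
  then show ?thesis using finite_mesh simplex_facets(1) simplex_elem by auto
qed

lemma face_props:
  assumes "e \<in> faces \<T>"
  shows "compact e" "r \<le> diameter e" "diameter e \<le> \<kappa> * r" "emeasure (face_measure e) e < \<infinity>"
    "measure (face_measure e) e \<le> (2 * (\<kappa> * r)) ^ (CARD('n) - 1)"
    "(2 * (r / CARD('n))) ^ (CARD('n) - 1) \<le> measure (face_measure e) e"
proof -
  obtain K where K: "K \<in> elems e" using assms faces_iff by blast
  note T = elemsD[OF K]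
  obtain u n b where F: "facet_frame K e u n b" using normal_frame[OF K] by blast
  show "compact e" using facet_frameD[OF F] by blast
  show "r \<le> diameter e" by (rule facet_diameter_ge[OF dim_ge_2 F center[OF T(1)] r_pos])
  have "diameter e \<le> diameter K" using T compact_elem by (intro diameter_subset compact_imp_bounded)
  then show d: "diameter e \<le> \<kappa> * r" using diameter_le[OF T(1)] by simp
  show "emeasure (face_measure e) e < \<infinity>"
    "measure (face_measure e) e \<le> (2 * (\<kappa> * r)) ^ (CARD('n) - 1)"
    "(2 * (r / CARD('n))) ^ (CARD('n) - 1) \<le> measure (face_measure e) e"
    by (rule face_measure_bounds[OF F center[OF T(1)] r_pos d])+
qed

lemma set_integrable_face:
  fixes f :: "real^'n \<Rightarrow> real"
  assumes e: "e \<in> faces \<T>" and f: "continuous_on UNIV f"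
  shows "set_integrable (face_measure e) e f"
proof -
  have "compact (f ` e)" using face_props(1)[OF e] f by (intro compact_continuous_image continuous_on_subset[OF f]) auto
  then have "bounded (f ` e)" by (rule compact_imp_bounded)
  then obtain B where "\<forall>y\<in>f ` e. norm y \<le> B" unfolding bounded_iff by (rule exE)
  then have B: "norm (f x) \<le> B" if "x \<in> e" for x using that by simp
  have meas: "f \<in> borel_measurable (face_measure e)"
    by (subst measurable_cong_sets[OF sets_face_measure refl]) (rule borel_measurable_continuous_onI[OF f])
  have "e \<in> sets (face_measure e)" using face_props(1)[OF e] by (simp add: borel_closed compact_imp_closed)
  then show ?thesis
    unfolding set_integrable_def
    using face_props(4)[OF e] B meas by (intro integrableI_bounded_set_indicator[where B=B]) auto
qed

lemma set_integral_face_const: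
  assumes "e \<in> faces \<T>"
  shows "set_lebesgue_integral (face_measure e) e (\<lambda>x. a) = measure (face_measure e) e * (a::real)"
  using face_props(1)[OF assms] face_props(4)[OF assms]
  by (simp add: set_lebesgue_integral_def borel_closed compact_imp_closed)


section \<open>The norm in terms of elementwise polynomials\<close>

definition elem_jump :: "((real^'n) set \<Rightarrow> real^'n \<Rightarrow> real) \<Rightarrow> (real^'n) set \<Rightarrow> real^'n \<Rightarrow> real^'n" where
  "elem_jump p e x = (\<Sum>K\<in>elems e. p K x *\<^sub>R outward_normal K e)"

definition jump_energy :: "((real^'n) set \<Rightarrow> real^'n \<Rightarrow> real) \<Rightarrow> real" where
  "jump_energy p = (\<Sum>e\<in>faces \<T>. inverse (diameter e) *
     set_lebesgue_integral (face_measure e) e (\<lambda>x. (norm (elem_jump p e x))\<^sup>2))"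

definition grad_energy :: "(real^'n \<Rightarrow> real) \<Rightarrow> (real^'n) set \<Rightarrow> real" where
  "grad_energy q K = set_lebesgue_integral lborel (interior K) (\<lambda>x. (norm (gradient q x))\<^sup>2)"

lemma grad_energy_nonneg: "grad_energy q K \<ge> 0"
  unfolding grad_energy_def set_lebesgue_integral_def by (intro integral_nonneg_AE) auto

lemma inverse_diameter_nonneg: "e \<in> faces \<T> \<Longrightarrow> inverse (diameter e) \<ge> 0"
  using face_props(2)[of e] r_pos by simp

lemma jump_energy_term_nonneg:
  "e \<in> faces \<T> \<Longrightarrow> 0 \<le> inverse (diameter e) * set_lebesgue_integral (face_measure e) e (\<lambda>x. (norm (elem_jump p e x))\<^sup>2)"
  unfolding set_lebesgue_integral_def by (intro mult_nonneg_nonneg integral_nonneg_AE inverse_diameter_nonneg) auto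

lemma jump_energy_nonneg: "jump_energy p \<ge> 0"
  unfolding jump_energy_def by (intro sum_nonneg jump_energy_term_nonneg)

text \<open>
  Gradients and traces see only the interiors of the elements, where \<open>w\<close> agrees with polynomials; the traces are the values of these
  polynomials on the face.
\<close>
lemma dg_norm_elementwise:
  assumes p: "\<And>K. K \<in> \<T> \<Longrightarrow> p K \<in> poly_space m"
    and w: "\<And>K x. K \<in> \<T> \<Longrightarrow> x \<in> interior K \<Longrightarrow> w x = p K x"
  shows "dg_norm \<T> w = sqrt ((\<Sum>K\<in>\<T>. grad_energy (p K) K) + jump_energy p)"
proof -
  have grad: "set_lebesgue_integral lborel (interior K) (\<lambda>x. (norm (gradient w x))\<^sup>2) = grad_energy (p K) K"
    if K: "K \<in> \<T>" for K
    unfolding grad_energy_def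
  proof (rule set_lebesgue_integral_cong, simp, intro allI impI)
    fix x assume "x \<in> interior K"
    then have "gradient w x = gradient (p K) x"
      using gradient_cong_open[OF open_interior, of x K w "p K"] w[OF K] poly_has_derivative[OF p[OF K]] by blast
    then show "(norm (gradient w x))\<^sup>2 = (norm (gradient (p K) x))\<^sup>2" by simp
  qed
  have jumps: "jump \<T> w e x = elem_jump p e x" if "x \<in> e" for e x
    unfolding jump_def elem_jump_def elems_def[symmetric]
  proof (intro sum.cong refl)
    fix K assume K: "K \<in> elems e"
    note T = elemsD[OF K]
    have "trace_from K w x = p K x"
      using T that w by (intro trace_from_eq simplex_elem continuous_on_poly[OF p]) auto
    then show "trace_from K w x *\<^sub>R outward_normal K e = p K x *\<^sub>R outward_normal K e" by simp
  qed
  have "set_lebesgue_integral (face_measure e) e (\<lambda>x. (norm (jump \<T> w e x))\<^sup>2) =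
      set_lebesgue_integral (face_measure e) e (\<lambda>x. (norm (elem_jump p e x))\<^sup>2)" if "e \<in> faces \<T>" for e
    using face_props(1)[OF that] jumps
    by (intro set_lebesgue_integral_cong) (auto simp: borel_closed compact_imp_closed)
  then show ?thesis
    unfolding dg_norm_def jump_energy_def using grad by simp
qed

lemma continuous_on_elem_jump:
  assumes "\<And>K. K \<in> \<T> \<Longrightarrow> continuous_on UNIV (p K)"
  shows "continuous_on UNIV (elem_jump p e)"
  unfolding elem_jump_def[abs_def] by (intro continuous_intros assms elemsD(1))

lemma power_pred_div: "r ^ (CARD('n) - 1) = r ^ (CARD('n) - 2) * r"
proof -
  have "CARD('n) - 1 = Suc (CARD('n) - 2)" using dim_ge_2 by simp
  then show ?thesis by simp
qed

lemma sum_elems_le: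
  assumes "\<And>K. g K \<ge> (0::real)"
  shows "(\<Sum>e\<in>faces \<T>. \<Sum>K\<in>elems e. g K) \<le> real (CARD('n) + 1) * (\<Sum>K\<in>\<T>. g K)"
proof -
  have "(\<Sum>e\<in>faces \<T>. \<Sum>K\<in>elems e. g K) = (\<Sum>e\<in>faces \<T>. \<Sum>K\<in>\<T>. if e facet_of K then g K else 0)"
    using finite_mesh by (simp add: elems_def sum.inter_filter)
  also have "\<dots> = (\<Sum>K\<in>\<T>. \<Sum>e\<in>faces \<T>. if e facet_of K then g K else 0)" by (rule sum.swap)
  also have "\<dots> = (\<Sum>K\<in>\<T>. real (card {e \<in> faces \<T>. e facet_of K}) * g K)"
    using finite_faces by (simp flip: sum.inter_filter)
  also have "\<dots> \<le> (\<Sum>K\<in>\<T>. real (CARD('n) + 1) * g K)"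
  proof (intro sum_mono mult_right_mono assms of_nat_mono)
    fix K assume K: "K \<in> \<T>"
    have "card {e \<in> faces \<T>. e facet_of K} \<le> card {e. e facet_of K}"
      using simplex_facets(1)[OF simplex_elem[OF K]] by (intro card_mono) auto
    also have "\<dots> \<le> CARD('n) + 1" by (rule simplex_facets(2)[OF simplex_elem[OF K]])
    finally show "card {e \<in> faces \<T>. e facet_of K} \<le> CARD('n) + 1" .
  qed
  finally show ?thesis by (simp add: sum_distrib_left)
qed

text \<open>
  At most two elements share a face, so the jump of the difference is at most the sum of two terms \<open>s K\<close>. Summing over
  faces counts each element once per facet. The powers of \<open>r\<close> combine from \<open>r\<^sup>d\<^sup>-\<^sup>1\<close> for the measure of a face and
  \<open>r\<^sup>-\<^sup>1\<close> for its inverse diameter.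
\<close>
lemma jump_energy_perturbation:
  assumes cont: "\<And>K. K \<in> \<T> \<Longrightarrow> continuous_on UNIV (p K)" "\<And>K. K \<in> \<T> \<Longrightarrow> continuous_on UNIV (q K)"
    and close: "\<And>K x. K \<in> \<T> \<Longrightarrow> x \<in> K \<Longrightarrow> \<bar>p K x - q K x\<bar> \<le> s K"
  shows "jump_energy p \<le> 2 * jump_energy q +
     4 * (2 * \<kappa>) ^ (CARD('n) - 1) * real (CARD('n) + 1) * (r ^ (CARD('n) - 2) * (\<Sum>K\<in>\<T>. (s K)\<^sup>2))"
proof -
  let ?c = "(2 * \<kappa>) ^ (CARD('n) - 1) * r ^ (CARD('n) - 2)"
  have c: "?c \<ge> 0" using \<kappa>_pos r_pos by simp
  have pointwise: "(norm (elem_jump p e x))\<^sup>2 \<le> 2 * (norm (elem_jump q e x))\<^sup>2 + 4 * (\<Sum>K\<in>elems e. (s K)\<^sup>2)"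
    if x: "x \<in> e" for e x
  proof -
    let ?d = "\<Sum>K\<in>elems e. (p K x - q K x) *\<^sub>R outward_normal K e"
    have "norm ?d \<le> (\<Sum>K\<in>elems e. \<bar>p K x - q K x\<bar>)"
      by (rule order_trans[OF norm_sum]) (simp add: norm_normal)
    also have "\<dots> \<le> (\<Sum>K\<in>elems e. s K)" using close elemsD x by (intro sum_mono) blast
    finally have "(norm ?d)\<^sup>2 \<le> (\<Sum>K\<in>elems e. s K)\<^sup>2" by (intro power_mono) auto
    also have "\<dots> \<le> real (card (elems e)) * (\<Sum>K\<in>elems e. (s K)\<^sup>2)"
      using Cauchy_Schwarz_ineq_sum[of "\<lambda>_. 1" s "elems e"] by simp
    also have "\<dots> \<le> 2 * (\<Sum>K\<in>elems e. (s K)\<^sup>2)"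
      using card_elems_le[of e] by (intro mult_right_mono sum_nonneg) auto
    finally have d: "(norm ?d)\<^sup>2 \<le> 2 * (\<Sum>K\<in>elems e. (s K)\<^sup>2)" .
    have "elem_jump p e x = elem_jump q e x + ?d"
      by (simp add: elem_jump_def scaleR_diff_left sum_subtractf)
    then have "norm (elem_jump p e x) \<le> norm (elem_jump q e x) + norm ?d" using norm_triangle_ineq[of "elem_jump q e x" ?d] by simp
    then have "(norm (elem_jump p e x))\<^sup>2 \<le> (norm (elem_jump q e x) + norm ?d)\<^sup>2" by (intro power_mono) auto
    also have "\<dots> \<le> 2 * (norm (elem_jump q e x))\<^sup>2 + 2 * (norm ?d)\<^sup>2"
      using zero_le_power2[of "norm (elem_jump q e x) - norm ?d"] by (simp add: power2_eq_square algebra_simps)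
    finally show ?thesis using d by linarith
  qed
  have face: "inverse (diameter e) * set_lebesgue_integral (face_measure e) e (\<lambda>x. (norm (elem_jump p e x))\<^sup>2) \<le>
      2 * (inverse (diameter e) * set_lebesgue_integral (face_measure e) e (\<lambda>x. (norm (elem_jump q e x))\<^sup>2)) +
      4 * ?c * (\<Sum>K\<in>elems e. (s K)\<^sup>2)" if e: "e \<in> faces \<T>" for e
  proof -
    let ?S = "\<Sum>K\<in>elems e. (s K)\<^sup>2"
    let ?I = "set_lebesgue_integral (face_measure e) e"
    have S: "?S \<ge> 0" by (intro sum_nonneg) auto
    have int: "set_integrable (face_measure e) e (\<lambda>x. 2 * (norm (elem_jump q e x))\<^sup>2)"
        "set_integrable (face_measure e) e (\<lambda>x. 4 * ?S)"
        "set_integrable (face_measure e) e (\<lambda>x. (norm (elem_jump p e x))\<^sup>2)"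
      using cont by (auto intro!: set_integrable_face[OF e] continuous_intros continuous_on_elem_jump)
    have "?I (\<lambda>x. (norm (elem_jump p e x))\<^sup>2) \<le> ?I (\<lambda>x. 2 * (norm (elem_jump q e x))\<^sup>2 + 4 * ?S)"
      using int pointwise by (intro set_integral_mono set_integral_add)
    also have "\<dots> = 2 * ?I (\<lambda>x. (norm (elem_jump q e x))\<^sup>2) + measure (face_measure e) e * (4 * ?S)"
      using int by (subst set_integral_add) (simp_all add: set_integral_face_const[OF e])
    finally have "inverse (diameter e) * ?I (\<lambda>x. (norm (elem_jump p e x))\<^sup>2) \<le>
        inverse (diameter e) * (2 * ?I (\<lambda>x. (norm (elem_jump q e x))\<^sup>2) + measure (face_measure e) e * (4 * ?S))"
      by (intro mult_left_mono inverse_diameter_nonneg e)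
    moreover have "inverse (diameter e) * measure (face_measure e) e \<le> ?c"
    proof -
      have "inverse (diameter e) * measure (face_measure e) e \<le> inverse r * (2 * (\<kappa> * r)) ^ (CARD('n) - 1)"
        using face_props[OF e] r_pos by (intro mult_mono le_imp_inverse_le) auto
      also have "\<dots> = ?c"
        using r_pos power_pred_div by (simp add: power_mult_distrib field_simps)
      finally show ?thesis .
    qed
    then have "inverse (diameter e) * measure (face_measure e) e * (4 * ?S) \<le> ?c * (4 * ?S)"
      using S by (intro mult_right_mono) auto
    ultimately show ?thesis by (simp add: algebra_simps)
  qed
  have "jump_energy p \<le> (\<Sum>e\<in>faces \<T>. 2 * (inverse (diameter e) * set_lebesgue_integral (face_measure e) e (\<lambda>x. (norm (elem_jump q e x))\<^sup>2)) +
      4 * ?c * (\<Sum>K\<in>elems e. (s K)\<^sup>2))"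
    unfolding jump_energy_def[of p] by (intro sum_mono face)
  also have "\<dots> = 2 * jump_energy q + 4 * ?c * (\<Sum>e\<in>faces \<T>. \<Sum>K\<in>elems e. (s K)\<^sup>2)"
    by (simp add: sum.distrib jump_energy_def sum_distrib_left)
  also have "\<dots> \<le> 2 * jump_energy q + 4 * ?c * (real (CARD('n) + 1) * (\<Sum>K\<in>\<T>. (s K)\<^sup>2))"
    using c sum_elems_le[of "\<lambda>K. (s K)\<^sup>2"] by (intro add_left_mono mult_left_mono) auto
  finally show ?thesis by (simp add: algebra_simps)
qed

lemma adjacent_common_face:
  assumes "(K1, K2) \<in> face_adjacent \<T>"
  shows "K1 \<in> elems (K1 \<inter> K2)" "K2 \<in> elems (K1 \<inter> K2)" "K1 \<noteq> K2" "K1 \<inter> K2 \<in> faces \<T>"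
proof -
  obtain e where e: "K1 \<in> elems e" "K2 \<in> elems e" "K1 \<noteq> K2"
    using assms by (auto simp: face_adjacent_def elems_def)
  then show "K1 \<in> elems (K1 \<inter> K2)" "K2 \<in> elems (K1 \<inter> K2)" "K1 \<noteq> K2" "K1 \<inter> K2 \<in> faces \<T>"
    using common_facet_eq_Int[OF e] faces_iff by auto
qed

text \<open>
  On the common face of two elements, the jump of a piecewise constant function is the difference of the two values times a unit vector,
  since the normals are opposite. This is where the face measure must be bounded from below. The factor \<open>4\<close> bounds the
  number of ordered pairs with a given common face.
\<close>
lemma adjacent_differences_le_jump_energy:
  fixes f :: "(real^'n) set \<Rightarrow> real"
  shows "r ^ (CARD('n) - 2) * (\<Sum>(K1, K2)\<in>face_adjacent \<T>. (f K1 - f K2)\<^sup>2) \<le>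
     4 * (\<kappa> / (2 / CARD('n)) ^ (CARD('n) - 1)) * jump_energy (\<lambda>K x. f K)"
proof -
  define J where "J e = inverse (diameter e) * set_lebesgue_integral (face_measure e) e (\<lambda>x. (norm (elem_jump (\<lambda>K x. f K) e x))\<^sup>2)" for e
  let ?c = "(2 / real CARD('n)) ^ (CARD('n) - 1) / \<kappa>"
  have c: "?c > 0" using \<kappa>_pos by simp
  have J0: "J e \<ge> 0" if "e \<in> faces \<T>" for e unfolding J_def by (rule jump_energy_term_nonneg[OF that])
  have pair: "?c * (r ^ (CARD('n) - 2) * (f K1 - f K2)\<^sup>2) \<le> J (K1 \<inter> K2)" if "(K1, K2) \<in> face_adjacent \<T>" for K1 K2
  proof -
    let ?e = "K1 \<inter> K2"
    note adj = adjacent_common_face[OF that]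
    note fp = face_props[OF adj(4)]
    have "elem_jump (\<lambda>K x. f K) ?e x = (f K1 - f K2) *\<^sub>R outward_normal K1 ?e" for x
      unfolding elem_jump_def elems_of_pair[OF adj(1-3)]
      using adj(3) opposite_normals[OF adj(1-3)] by (simp add: scaleR_diff_left)
    then have "(norm (elem_jump (\<lambda>K x. f K) ?e x))\<^sup>2 = (f K1 - f K2)\<^sup>2" for x
      using norm_normal[OF adj(1)] by simp
    then have J: "J ?e = inverse (diameter ?e) * measure (face_measure ?e) ?e * (f K1 - f K2)\<^sup>2"
      unfolding J_def by (simp add: set_integral_face_const[OF adj(4)])
    have "?c * r ^ (CARD('n) - 2) = inverse (\<kappa> * r) * (2 * (r / CARD('n))) ^ (CARD('n) - 1)"
      using power_pred_div r_pos \<kappa>_pos by (simp add: power_mult_distrib power_divide field_simps)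
    also have "\<dots> \<le> inverse (diameter ?e) * measure (face_measure ?e) ?e"
      using fp r_pos by (intro mult_mono le_imp_inverse_le) auto
    finally have "?c * r ^ (CARD('n) - 2) * (f K1 - f K2)\<^sup>2 \<le> J ?e"
      unfolding J by (intro mult_right_mono) auto
    then show ?thesis by (simp add: mult.assoc)
  qed
  have fin: "finite (face_adjacent \<T>)" by (rule finite_face_adjacent) simp
  have "?c * (r ^ (CARD('n) - 2) * (\<Sum>(K1, K2)\<in>face_adjacent \<T>. (f K1 - f K2)\<^sup>2)) =
      (\<Sum>(K1, K2)\<in>face_adjacent \<T>. ?c * (r ^ (CARD('n) - 2) * (f K1 - f K2)\<^sup>2))"
    by (simp add: sum_distrib_left case_prod_unfold)
  also have "\<dots> \<le> (\<Sum>z\<in>face_adjacent \<T>. J (fst z \<inter> snd z))"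
    using pair by (intro sum_mono) auto
  also have "\<dots> = (\<Sum>z\<in>face_adjacent \<T>. \<Sum>e\<in>faces \<T>. if e = fst z \<inter> snd z then J e else 0)"
    using adjacent_common_face(4) finite_faces by (intro sum.cong refl) (auto simp: sum.delta')
  also have "\<dots> = (\<Sum>e\<in>faces \<T>. \<Sum>z\<in>face_adjacent \<T>. if e = fst z \<inter> snd z then J e else 0)"
    by (rule sum.swap)
  also have "\<dots> = (\<Sum>e\<in>faces \<T>. real (card {z \<in> face_adjacent \<T>. e = fst z \<inter> snd z}) * J e)"
    by (intro sum.cong refl) (simp only: sum.inter_filter[OF fin, symmetric] sum_constant)
  also have "\<dots> \<le> (\<Sum>e\<in>faces \<T>. 4 * J e)"
  proof (intro sum_mono mult_right_mono J0)
    fix e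
    have "{z \<in> face_adjacent \<T>. e = fst z \<inter> snd z} \<subseteq> elems e \<times> elems e"
      using adjacent_common_face by auto
    then have "card {z \<in> face_adjacent \<T>. e = fst z \<inter> snd z} \<le> card (elems e \<times> elems e)"
      by (intro card_mono finite_cartesian_product finite_elems)
    also have "\<dots> = card (elems e) * card (elems e)" by (rule card_cartesian_product)
    also have "\<dots> \<le> 2 * 2" using card_elems_le by (intro mult_mono) auto
    finally show "real (card {z \<in> face_adjacent \<T>. e = fst z \<inter> snd z}) \<le> 4" by simp
  qed
  also have "\<dots> = 4 * jump_energy (\<lambda>K x. f K)" by (simp add: jump_energy_def J_def sum_distrib_left)
  finally have "?c * (r ^ (CARD('n) - 2) * (\<Sum>(K1, K2)\<in>face_adjacent \<T>. (f K1 - f K2)\<^sup>2)) \<le> 4 * jump_energy (\<lambda>K x. f K)" .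
  then show ?thesis using c \<kappa>_pos by (simp add: field_simps)
qed

end


section \<open>The local reconstruction\<close>

locale reconstruction_mesh = regular_mesh \<Omega> \<T> r \<kappa>
  for \<Omega> :: "(real^'n) set" and \<T> :: "(real^'n) set set" and r \<kappa> :: real +
  fixes m N :: nat
  assumes patches: "patches_exist N \<T>" and unisolvence: "unisolvent m N \<T>"
begin

abbreviation local_rec :: "(real^'n \<Rightarrow> real) \<Rightarrow> (real^'n) set \<Rightarrow> real^'n \<Rightarrow> real" where
  "local_rec v K \<equiv> reconstruction_on m N \<T> v K"

lemma finite_nodes: "K \<in> \<T> \<Longrightarrow> finite (nodes N \<T> K)"
  by (simp add: nodes_def finite_patch)

lemma nodes_nonempty: "K \<in> \<T> \<Longrightarrow> nodes N \<T> K \<noteq> {}"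
  using self_in_patch by (auto simp: nodes_def)

lemma nodes_definite:
  assumes K: "K \<in> \<T>" and p: "p \<in> poly_space m" "\<And>x. x \<in> nodes N \<T> K \<Longrightarrow> p x = 0"
  shows "p = (\<lambda>x. 0)"
proof (rule poly_space_zero_on_ball[OF p(1) r_pos])
  fix x assume "x \<in> ball (center K) r"
  then have "x \<in> \<Union>(patch N \<T> K)" using center[OF K] self_in_patch[OF K] by (meson UnionI ball_subset_cball subsetD)
  then show "p x = 0" using unisolvence K p unfolding unisolvent_def by blast
qed

lemma local_rec_props:
  assumes K: "K \<in> \<T>"
  shows "local_rec v K \<in> poly_space m" "local_rec v K (barycenter K) = v (barycenter K)"
    "\<And>q. q \<in> poly_space m \<Longrightarrow> q (barycenter K) = v (barycenter K) \<Longrightarrow>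
       (\<Sum>x\<in>nodes N \<T> K. (local_rec v K x - v x)\<^sup>2) \<le> (\<Sum>x\<in>nodes N \<T> K. (q x - v x)\<^sup>2)"
  using theI'[OF constrained_least_squares_unique[OF finite_nodes[OF K] nodes_definite[OF K], of m "barycenter K" v]]
  unfolding reconstruction_on_def by blast+

lemma reconstruction_on_interior:
  assumes "K \<in> \<T>" "x \<in> interior K"
  shows "reconstruction m N \<T> v x = local_rec v K x"
proof -
  have "(THE K. K \<in> \<T> \<and> x \<in> interior K) = K"
    using assms interior_meets_imp_eq interior_subset by (intro the_equality) blast+
  then show ?thesis using assms unfolding reconstruction_def by auto
qed

lemma patch_region_bounded:
  assumes K: "K \<in> \<T>" shows "bounded (\<Union>(patch N \<T> K))"
proof (rule bounded_Union[OF finite_patch[OF K]], rule ballI)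
  fix S assume "S \<in> patch N \<T> K"
  then show "bounded S" using patch_subset[OF K] by (intro compact_imp_bounded compact_elem) blast
qed

lemma sup_le_\<Lambda>_elem:
  assumes K: "K \<in> \<T>" and p: "p \<in> poly_space m" and x: "x \<in> \<Union>(patch N \<T> K)"
  shows "\<bar>p x\<bar> \<le> \<Lambda>_elem m N \<T> K * Max ((\<lambda>x. \<bar>p x\<bar>) ` nodes N \<T> K)"
  unfolding \<Lambda>_elem_def
  by (rule sup_le_stability_constant[OF patch_region_bounded[OF K] finite_nodes[OF K] nodes_nonempty[OF K] nodes_definite[OF K] p x])

lemma \<Lambda>_elem_le: "K \<in> \<T> \<Longrightarrow> \<Lambda>_elem m N \<T> K \<le> \<Lambda>_max m N \<T>"
  unfolding \<Lambda>_max_def using finite_mesh by (intro Max_ge) auto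

lemma \<Lambda>_elem_ge_1:
  assumes K: "K \<in> \<T>" shows "1 \<le> \<Lambda>_elem m N \<T> K"
proof -
  have "center K \<in> \<Union>(patch N \<T> K)" using center_in self_in_patch K by blast
  from sup_le_\<Lambda>_elem[OF K const_in_poly_space[of 1] this]
  show ?thesis using nodes_nonempty[OF K] by (simp add: image_constant_conv)
qed

lemma \<Lambda>_bar_ge:
  assumes K: "K \<in> \<T>"
  shows "1 + \<Lambda>_max m N \<T> * sqrt (real (card (patch N \<T> K))) \<le> \<Lambda>_bar m N \<T>"
  unfolding \<Lambda>_bar_def using finite_mesh K by (intro Max_ge) auto

lemma \<Lambda>_bar_ge_1:
  assumes K: "K \<in> \<T>" shows "1 \<le> \<Lambda>_bar m N \<T>"
proof -
  have "0 \<le> \<Lambda>_max m N \<T>" using \<Lambda>_elem_ge_1[OF K] \<Lambda>_elem_le[OF K] by linarith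
  then have "0 \<le> \<Lambda>_max m N \<T> * sqrt (real (card (patch N \<T> K)))" by simp
  then show ?thesis using \<Lambda>_bar_ge[OF K] by linarith
qed

text \<open>
  The constant \<open>v (barycenter K)\<close> is admissible in the least squares problem, with residual at most \<open>D\<close> at each of the at most
  \<open>card (patch N \<T> K)\<close> nodes. So \<open>p - v (barycenter K)\<close> is at most \<open>2 s D\<close> at the nodes, with \<open>s\<close> the root of this number, and
  the stability constant extends this bound to the patch.
\<close>
lemma local_rec_stable:
  assumes K: "K \<in> \<T>" and x: "x \<in> K"
    and D: "\<And>T. T \<in> patch N \<T> K \<Longrightarrow> \<bar>v (barycenter K) - v (barycenter T)\<bar> \<le> D"
  shows "\<bar>local_rec v K x - v (barycenter K)\<bar> \<le> 2 * \<Lambda>_bar m N \<T> * D"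
proof -
  let ?p = "local_rec v K" and ?a = "v (barycenter K)" and ?I = "nodes N \<T> K"
  let ?q = "\<lambda>x. ?p x - ?a"
  define s where "s = sqrt (real (card (patch N \<T> K)))"
  have D0: "0 \<le> D" using D[OF self_in_patch[OF K]] by simp
  have "card (patch N \<T> K) \<noteq> 0" using finite_patch[OF K] self_in_patch[OF K] by auto
  then have s1: "1 \<le> s" unfolding s_def by simp
  have near: "\<bar>v y - ?a\<bar> \<le> D" if "y \<in> ?I" for y
    using that D by (auto simp: nodes_def abs_minus_commute)
  have "(\<Sum>y\<in>?I. (?p y - v y)\<^sup>2) \<le> (\<Sum>y\<in>?I. (?a - v y)\<^sup>2)"
    using local_rec_props(3)[OF K const_in_poly_space[of ?a]] by simp
  also have "\<dots> \<le> real (card ?I) * D\<^sup>2"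
  proof (rule sum_bounded_above)
    fix y assume "y \<in> ?I"
    then have "\<bar>?a - v y\<bar> \<le> D" using near by (simp add: abs_minus_commute)
    then show "(?a - v y)\<^sup>2 \<le> D\<^sup>2" by (metis abs_ge_zero power2_abs power_mono)
  qed
  also have "\<dots> \<le> real (card (patch N \<T> K)) * D\<^sup>2"
    using card_image_le[OF finite_patch[OF K, of N], of barycenter] by (intro mult_right_mono) (auto simp: nodes_def)
  also have "\<dots> = (s * D)\<^sup>2" by (simp add: s_def power_mult_distrib)
  finally have total: "(\<Sum>y\<in>?I. (?p y - v y)\<^sup>2) \<le> (s * D)\<^sup>2" .
  have node: "\<bar>?q y\<bar> \<le> 2 * s * D" if y: "y \<in> ?I" for y
  proof -
    have "(?p y - v y)\<^sup>2 \<le> (\<Sum>y\<in>?I. (?p y - v y)\<^sup>2)" using finite_nodes[OF K] y by (intro member_le_sum) auto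
    then have "(?p y - v y)\<^sup>2 \<le> (s * D)\<^sup>2" using total by simp
    then have "\<bar>?p y - v y\<bar> \<le> s * D" using s1 D0 by (simp add: abs_le_square_iff[symmetric])
    moreover have "D \<le> s * D" using mult_right_mono[OF s1 D0] by simp
    ultimately show ?thesis using near[OF y] by linarith
  qed
  have "?q \<in> poly_space m" by (intro poly_space_diff local_rec_props(1)[OF K] const_in_poly_space)
  moreover have "x \<in> \<Union>(patch N \<T> K)" using x self_in_patch[OF K] by blast
  ultimately have "\<bar>?q x\<bar> \<le> \<Lambda>_elem m N \<T> K * Max ((\<lambda>x. \<bar>?q x\<bar>) ` ?I)" by (rule sup_le_\<Lambda>_elem[OF K])
  also have "\<dots> \<le> \<Lambda>_max m N \<T> * (2 * s * D)"
  proof (rule mult_mono)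
    show "Max ((\<lambda>x. \<bar>?q x\<bar>) ` ?I) \<le> 2 * s * D"
      using finite_nodes[OF K] nodes_nonempty[OF K] node by (subst Max_le_iff) auto
    show "0 \<le> Max ((\<lambda>x. \<bar>?q x\<bar>) ` ?I)"
      using finite_nodes[OF K] nodes_nonempty[OF K] by (subst Max_ge_iff) auto
  qed (use \<Lambda>_elem_le[OF K] \<Lambda>_elem_ge_1[OF K] in auto)
  also have "\<dots> = 2 * (\<Lambda>_max m N \<T> * s) * D" by simp
  also have "\<dots> \<le> 2 * \<Lambda>_bar m N \<T> * D"
    using \<Lambda>_bar_ge[OF K] D0 by (intro mult_right_mono) (auto simp: s_def)
  finally show ?thesis .
qed

lemma dg_norm_reconstruction:
  "dg_norm \<T> (reconstruction m N \<T> v) =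
     sqrt ((\<Sum>K\<in>\<T>. grad_energy (local_rec v K) K) + jump_energy (local_rec v))"
  using local_rec_props(1) reconstruction_on_interior by (intro dg_norm_elementwise)

lemma dg_norm_piecewise_const:
  assumes "v \<in> piecewise_const \<T>"
  shows "dg_norm \<T> v = sqrt (jump_energy (\<lambda>K x. v (barycenter K)))"
proof -
  have "dg_norm \<T> v = sqrt ((\<Sum>K\<in>\<T>. grad_energy (\<lambda>x. v (barycenter K)) K) + jump_energy (\<lambda>K x. v (barycenter K)))"
  proof (rule dg_norm_elementwise[of _ m])
    fix K x assume K: "K \<in> \<T>" "x \<in> interior K"
    then show "v x = v (barycenter K)"
      using assms barycenter_in_interior[OF simplex_elem[OF K(1)]]
      by (auto simp: piecewise_const_def constant_on_def)
  qed simp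
  moreover have "gradient (\<lambda>x. a) x = 0" for a :: real and x :: "real^'n"
    by (simp add: gradient_def vec_eq_iff frechet_derivative_eq[OF has_derivative_const])
  then have "grad_energy (\<lambda>x. a) K = 0" for a K by (simp add: grad_energy_def)
  ultimately show ?thesis by simp
qed


section \<open>The two inequalities on one mesh\<close>

text \<open>
  The summand for \<open>K\<close> bounds the squared differences over the patch of \<open>K\<close>. Four powers of the overlap bound stem from the length
  of the chains and one from the overlap of the regions.
\<close>
lemma patch_variation_le_jump_energy:
  fixes f :: "(real^'n) set \<Rightarrow> real"
  shows "r ^ (CARD('n) - 2) * (\<Sum>K\<in>\<T>. overlap_bound \<kappa> N CARD('n) ^ 4 * (\<Sum>(K1, K2)\<in>face_adjacent (region N K). (f K1 - f K2)\<^sup>2)) \<le>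
     overlap_bound \<kappa> N CARD('n) ^ 5 * (4 * (\<kappa> / (2 / CARD('n)) ^ (CARD('n) - 1))) * jump_energy (\<lambda>K x. f K)"
proof -
  let ?o = "overlap_bound \<kappa> N CARD('n)"
  have o: "?o \<ge> 0" using \<kappa>_pos by (simp add: overlap_bound_def)
  have "(\<Sum>K\<in>\<T>. ?o ^ 4 * (\<Sum>(K1, K2)\<in>face_adjacent (region N K). (f K1 - f K2)\<^sup>2)) \<le>
      ?o ^ 4 * (?o * (\<Sum>(K1, K2)\<in>face_adjacent \<T>. (f K1 - f K2)\<^sup>2))"
    unfolding sum_distrib_left[symmetric] using o sum_over_regions[of "\<lambda>(K1, K2). (f K1 - f K2)\<^sup>2" N]
    by (intro mult_left_mono) auto
  then have "r ^ (CARD('n) - 2) * (\<Sum>K\<in>\<T>. ?o ^ 4 * (\<Sum>(K1, K2)\<in>face_adjacent (region N K). (f K1 - f K2)\<^sup>2)) \<le>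
      r ^ (CARD('n) - 2) * (?o ^ 4 * (?o * (\<Sum>(K1, K2)\<in>face_adjacent \<T>. (f K1 - f K2)\<^sup>2)))"
    using r_pos by (intro mult_left_mono) auto
  also have "\<dots> = ?o ^ 5 * (r ^ (CARD('n) - 2) * (\<Sum>(K1, K2)\<in>face_adjacent \<T>. (f K1 - f K2)\<^sup>2))"
    by (simp add: power_numeral_reduce algebra_simps)
  also have "\<dots> \<le> ?o ^ 5 * (4 * (\<kappa> / (2 / CARD('n)) ^ (CARD('n) - 1)) * jump_energy (\<lambda>K x. f K))"
    using o by (intro mult_left_mono adjacent_differences_le_jump_energy) auto
  finally show ?thesis by (simp add: mult.assoc)
qed

text \<open>
  The value \<open>v (barycenter K)\<close> is attained by the reconstruction at the barycenter, so its distance to the reconstruction on \<open>K\<close> is an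
  oscillation and bounded by the gradient. The constant \<open>C\<close> is a parameter because it must not depend on the mesh.
\<close>
lemma dg_norm_le_reconstruction:
  assumes osc: "\<And>p K a x y. p \<in> poly_space m \<Longrightarrow> convex K \<Longrightarrow> ball a r \<subseteq> K \<Longrightarrow> K \<subseteq> cball a (\<kappa> * r) \<Longrightarrow>
      x \<in> K \<Longrightarrow> y \<in> K \<Longrightarrow> r ^ (CARD('n) - 2) * (p x - p y)\<^sup>2 \<le> C * grad_energy p K"
    and C: "C > 0" and v: "v \<in> piecewise_const \<T>"
  shows "dg_norm \<T> v \<le> sqrt (2 + 4 * (2 * \<kappa>) ^ (CARD('n) - 1) * real (CARD('n) + 1) * C) * dg_norm \<T> (reconstruction m N \<T> v)"
proof -
  let ?p = "local_rec v" and ?E = "\<Sum>K\<in>\<T>. grad_energy (local_rec v K) K"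
  define A where "A = 4 * (2 * \<kappa>) ^ (CARD('n) - 1) * real (CARD('n) + 1)"
  have A: "A \<ge> 0" using \<kappa>_pos by (simp add: A_def)
  define s where "s K = sqrt (C * grad_energy (?p K) K / r ^ (CARD('n) - 2))" for K
  have s2: "r ^ (CARD('n) - 2) * (s K)\<^sup>2 = C * grad_energy (?p K) K" for K
    using r_pos C grad_energy_nonneg by (simp add: s_def)
  have E0: "?E \<ge> 0" by (intro sum_nonneg grad_energy_nonneg)
  have "jump_energy (\<lambda>K x. v (barycenter K)) \<le> 2 * jump_energy ?p + A * (r ^ (CARD('n) - 2) * (\<Sum>K\<in>\<T>. (s K)\<^sup>2))"
    unfolding A_def
  proof (rule jump_energy_perturbation)
    fix K x assume K: "K \<in> \<T>" "x \<in> K"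
    have b: "barycenter K \<in> K" using barycenter_in_interior[OF simplex_elem[OF K(1)]] interior_subset by blast
    have "ball (center K) r \<subseteq> K" using center[OF K(1)] ball_subset_cball by blast
    from osc[OF local_rec_props(1)[OF K(1)] convex_elem[OF K(1)] this elem_subset[OF K(1)] b K(2)]
    have "(v (barycenter K) - ?p K x)\<^sup>2 \<le> C * grad_energy (?p K) K / r ^ (CARD('n) - 2)"
      using r_pos local_rec_props(2)[OF K(1)] by (simp add: field_simps)
    then show "\<bar>v (barycenter K) - ?p K x\<bar> \<le> s K"
      unfolding s_def by (metis real_sqrt_abs real_sqrt_le_iff)
  qed (auto intro: continuous_on_poly local_rec_props(1))
  also have "r ^ (CARD('n) - 2) * (\<Sum>K\<in>\<T>. (s K)\<^sup>2) = C * ?E"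
    by (simp add: sum_distrib_left s2)
  also have "2 * jump_energy ?p + A * (C * ?E) \<le> (2 + A * C) * (?E + jump_energy ?p)"
    using A C E0 jump_energy_nonneg[of ?p] mult_nonneg_nonneg[of "A * C" "jump_energy ?p"] by (simp add: algebra_simps)
  finally show ?thesis
    unfolding dg_norm_piecewise_const[OF v] dg_norm_reconstruction A_def real_sqrt_mult[symmetric]
    by (rule real_sqrt_le_mono)
qed

text \<open>
  With \<open>s K\<close> bounding the distance of the reconstruction to \<open>v (barycenter K)\<close>, both the gradient and the change of the
  jumps are at most of order \<open>r\<^sup>d\<^sup>-\<^sup>2 \<Sum>\<^sub>K (s K)\<^sup>2\<close>, and this sum is bounded by the variation over patches. That \<open>\<Lambda>_bar\<close> is at least \<open>1\<close> absorbs
  the jumps of \<open>v\<close> itself.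
\<close>
lemma reconstruction_le_dg_norm:
  assumes inv: "\<And>p K a b s. p \<in> poly_space m \<Longrightarrow> ball a r \<subseteq> K \<Longrightarrow> K \<subseteq> cball a (\<kappa> * r) \<Longrightarrow>
      (\<forall>x\<in>K. \<bar>p x - b\<bar> \<le> s) \<Longrightarrow> grad_energy p K \<le> C * r ^ (CARD('n) - 2) * s\<^sup>2"
    and C: "C > 0" and v: "v \<in> piecewise_const \<T>" and ne: "\<T> \<noteq> {}"
  shows "dg_norm \<T> (reconstruction m N \<T> v) \<le>
    sqrt (2 + 4 * (C + 4 * (2 * \<kappa>) ^ (CARD('n) - 1) * real (CARD('n) + 1)) *
      (overlap_bound \<kappa> N CARD('n) ^ 5 * (4 * (\<kappa> / (2 / CARD('n)) ^ (CARD('n) - 1))))) * \<Lambda>_bar m N \<T> * dg_norm \<T> v"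
proof -
  let ?p = "local_rec v" and ?J = "jump_energy (\<lambda>K x. v (barycenter K))" and ?L = "\<Lambda>_bar m N \<T>"
  define A where "A = 4 * (2 * \<kappa>) ^ (CARD('n) - 1) * real (CARD('n) + 1)"
  define B where "B = overlap_bound \<kappa> N CARD('n) ^ 5 * (4 * (\<kappa> / (2 / CARD('n)) ^ (CARD('n) - 1)))"
  define V where "V K = overlap_bound \<kappa> N CARD('n) ^ 4 * (\<Sum>(K1, K2)\<in>face_adjacent (region N K). (v (barycenter K1) - v (barycenter K2))\<^sup>2)" for K
  define s where "s K = 2 * ?L * sqrt (V K)" for K
  have A: "A \<ge> 0" using \<kappa>_pos by (simp add: A_def)
  have L: "1 \<le> ?L" using ne \<Lambda>_bar_ge_1 by blast
  have V0: "V K \<ge> 0" for K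
    unfolding V_def using \<kappa>_pos by (intro mult_nonneg_nonneg sum_nonneg) (auto simp: overlap_bound_def)
  have close: "\<bar>?p K x - v (barycenter K)\<bar> \<le> s K" if K: "K \<in> \<T>" "x \<in> K" for K x
    unfolding s_def
  proof (rule local_rec_stable[OF K])
    fix T assume "T \<in> patch N \<T> K"
    then have "(v (barycenter K) - v (barycenter T))\<^sup>2 \<le> V K"
      unfolding V_def by (rule patch_oscillation[OF K(1) patches, of T "\<lambda>K. v (barycenter K)"])
    then show "\<bar>v (barycenter K) - v (barycenter T)\<bar> \<le> sqrt (V K)" by (metis real_sqrt_abs real_sqrt_le_iff)
  qed
  have "(\<Sum>K\<in>\<T>. (s K)\<^sup>2) = 4 * ?L\<^sup>2 * (\<Sum>K\<in>\<T>. V K)"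
    using V0 by (simp add: s_def power_mult_distrib sum_distrib_left)
  moreover have "r ^ (CARD('n) - 2) * (\<Sum>K\<in>\<T>. V K) \<le> B * ?J"
    unfolding V_def B_def by (rule patch_variation_le_jump_energy)
  then have "4 * ?L\<^sup>2 * (r ^ (CARD('n) - 2) * (\<Sum>K\<in>\<T>. V K)) \<le> 4 * ?L\<^sup>2 * (B * ?J)" by (intro mult_left_mono) auto
  ultimately have S: "r ^ (CARD('n) - 2) * (\<Sum>K\<in>\<T>. (s K)\<^sup>2) \<le> 4 * ?L\<^sup>2 * (B * ?J)" by (simp add: ac_simps)
  have "grad_energy (?p K) K \<le> C * r ^ (CARD('n) - 2) * (s K)\<^sup>2" if K: "K \<in> \<T>" for K
    using center[OF K] ball_subset_cball close[OF K]
    by (intro inv[of "?p K" "center K" K "v (barycenter K)"] local_rec_props(1)[OF K] elem_subset[OF K]) blast+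
  then have "(\<Sum>K\<in>\<T>. grad_energy (?p K) K) \<le> (\<Sum>K\<in>\<T>. C * r ^ (CARD('n) - 2) * (s K)\<^sup>2)" by (rule sum_mono)
  also have "\<dots> = C * (r ^ (CARD('n) - 2) * (\<Sum>K\<in>\<T>. (s K)\<^sup>2))" by (simp add: sum_distrib_left mult.assoc)
  finally have E: "(\<Sum>K\<in>\<T>. grad_energy (?p K) K) \<le> C * (r ^ (CARD('n) - 2) * (\<Sum>K\<in>\<T>. (s K)\<^sup>2))" .
  have "jump_energy ?p \<le> 2 * ?J + A * (r ^ (CARD('n) - 2) * (\<Sum>K\<in>\<T>. (s K)\<^sup>2))"
    unfolding A_def using close
    by (intro jump_energy_perturbation) (auto intro: continuous_on_poly local_rec_props(1))
  then have "(\<Sum>K\<in>\<T>. grad_energy (?p K) K) + jump_energy ?p \<le> 2 * ?J + (C + A) * (r ^ (CARD('n) - 2) * (\<Sum>K\<in>\<T>. (s K)\<^sup>2))"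
    using E by (simp add: algebra_simps)
  also have "\<dots> \<le> 2 * ?J + (C + A) * (4 * ?L\<^sup>2 * (B * ?J))"
    using S C A by (intro add_left_mono mult_left_mono) auto
  also have "\<dots> \<le> 2 * (?L\<^sup>2 * ?J) + (C + A) * (4 * ?L\<^sup>2 * (B * ?J))"
  proof -
    have "1 \<le> ?L\<^sup>2" using L by (simp add: one_le_power)
    then have "1 * ?J \<le> ?L\<^sup>2 * ?J" by (intro mult_right_mono jump_energy_nonneg)
    then show ?thesis by simp
  qed
  also have "\<dots> = (2 + 4 * (C + A) * B) * ?L\<^sup>2 * ?J" by (simp add: algebra_simps)
  finally have "sqrt ((\<Sum>K\<in>\<T>. grad_energy (?p K) K) + jump_energy ?p) \<le> sqrt ((2 + 4 * (C + A) * B) * ?L\<^sup>2 * ?J)"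
    by (rule real_sqrt_le_mono)
  also have "\<dots> = sqrt (2 + 4 * (C + A) * B) * ?L * sqrt ?J"
    using L by (simp add: real_sqrt_mult)
  finally show ?thesis
    unfolding dg_norm_piecewise_const[OF v] dg_norm_reconstruction A_def B_def .
qed

end


section \<open>Uniform constants for quasi-uniform meshes\<close>

text \<open>
  Quasi-uniformity makes the mesh size divided by \<open>C\<sigma>\<close> a lower bound for all inradii. An inradius is a supremum, and a
  strictly smaller radius certainly belongs to an inscribed ball; this accounts for the factor \<open>2\<close>.
\<close>
lemma quasi_uniform_regular_mesh:
  fixes \<T> :: "(real^'n) set set"
  assumes d: "CARD('n) \<ge> 2" and dom: "convex_polytopal_domain \<Omega>" and C\<sigma>: "C\<sigma> > 0"
    and mesh: "simplicial_mesh \<Omega> \<T>" and qu: "quasi_uniform C\<sigma> \<T>"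
  shows "\<T> \<noteq> {}" "regular_mesh \<Omega> \<T> (mesh_size \<T> / (2 * C\<sigma>)) (2 * C\<sigma>)"
proof -
  have fin: "finite \<T>" and cover: "\<Union>\<T> = closure \<Omega>" and simplex: "\<And>K. K \<in> \<T> \<Longrightarrow> int CARD('n) simplex K"
    using mesh by (auto simp: simplicial_mesh_def triangulation_def)
  have "\<Omega> \<noteq> {}" using dom by (simp add: convex_polytopal_domain_def)
  then show ne: "\<T> \<noteq> {}" using cover closure_subset[of \<Omega>] by auto
  have diam: "diameter K \<le> mesh_size \<T>" if "K \<in> \<T>" for K
    unfolding mesh_size_def using that fin by (intro Max_ge) auto
  obtain K0 where K0: "K0 \<in> \<T>" using ne by blast
  have h: "mesh_size \<T> > 0"
  proof -
    obtain x where "x \<in> interior K0" using simplex_interior_nonempty(1)[OF simplex[OF K0]] by blast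
    then obtain e where e: "e > 0" "cball x e \<subseteq> K0" by (meson mem_interior_cball)
    have "diameter (cball x e) \<le> diameter K0"
      using e(2) compact_simplex[OF simplex[OF K0]] by (intro diameter_subset compact_imp_bounded)
    then show ?thesis using e(1) diam[OF K0] by simp
  qed
  have ball: "\<exists>c. cball c (mesh_size \<T> / (2 * C\<sigma>)) \<subseteq> K" if K: "K \<in> \<T>" for K
  proof -
    let ?R = "{r. 0 \<le> r \<and> (\<exists>x. cball x r \<subseteq> K)}"
    have "min_inradius \<T> \<le> inradius K"
      unfolding min_inradius_def using K fin by (intro Min_le) auto
    then have "mesh_size \<T> \<le> C\<sigma> * inradius K"
      using qu C\<sigma> unfolding quasi_uniform_def by (meson less_imp_le mult_left_mono order_trans)
    then have "mesh_size \<T> / (2 * C\<sigma>) < Sup ?R"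
      using h C\<sigma> unfolding inradius_def[symmetric] by (simp add: field_simps)
    moreover have "?R \<noteq> {}"
    proof -
      obtain x where "x \<in> K" using simplex_interior_nonempty(1)[OF simplex[OF K]] interior_subset by blast
      then have "0 \<in> ?R" by auto
      then show ?thesis by blast
    qed
    ultimately obtain r' x where "cball x r' \<subseteq> K" "mesh_size \<T> / (2 * C\<sigma>) < r'"
      using less_cSupD[of ?R] by blast
    then have "cball x (mesh_size \<T> / (2 * C\<sigma>)) \<subseteq> K"
      using subset_cball[of "mesh_size \<T> / (2 * C\<sigma>)" r' x] by simp
    then show ?thesis by blast
  qed
  show "regular_mesh \<Omega> \<T> (mesh_size \<T> / (2 * C\<sigma>)) (2 * C\<sigma>)"
    using d dom mesh h C\<sigma> ball diam unfolding regular_mesh_def convex_polytopal_domain_def by simp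
qed

theorem lemma7:
  fixes \<Omega> :: "(real^'n) set" and m N :: nat and C\<sigma> :: real
  assumes "CARD('n) = 2 \<or> CARD('n) = 3"
    and "convex_polytopal_domain \<Omega>"
    and "m \<ge> 1"
    and "C\<sigma> > 0"
  shows "\<exists>C1>0. \<exists>C2>0. \<forall>\<T>.
    simplicial_mesh \<Omega> \<T> \<and> quasi_uniform C\<sigma> \<T> \<and> patches_exist N \<T> \<and> unisolvent m N \<T> \<longrightarrow>
      (\<forall>v\<in>piecewise_const \<T>.
         dg_norm \<T> v \<le> C1 * dg_norm \<T> (reconstruction m N \<T> v) \<and>
         dg_norm \<T> (reconstruction m N \<T> v) \<le> C2 * \<Lambda>_bar m N \<T> * dg_norm \<T> v)"
proof -
  have d: "CARD('n) \<ge> 2" using assms(1) by auto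
  define \<kappa> where "\<kappa> = 2 * C\<sigma>"
  have \<kappa>: "\<kappa> > 0" using assms(4) by (simp add: \<kappa>_def)
  obtain Ca where Ca: "Ca > 0" "\<forall>p\<in>poly_space m. \<forall>K a r x y. r > 0 \<longrightarrow> convex K \<longrightarrow> ball a r \<subseteq> K \<longrightarrow> K \<subseteq> cball a (\<kappa> * r) \<longrightarrow>
     x \<in> K \<longrightarrow> y \<in> K \<longrightarrow>
     r ^ (CARD('n) - 2) * (p x - p y)\<^sup>2 \<le> Ca * set_lebesgue_integral lborel (interior K) (\<lambda>x::real^'n. (norm (gradient p x))\<^sup>2)"
    using poly_oscillation_le_gradient[OF d \<kappa>, of m] by (elim exE conjE) (rule that)
  obtain Cb where Cb: "Cb > 0" "\<forall>p\<in>poly_space m. \<forall>K a r b s. r > 0 \<longrightarrow> ball a r \<subseteq> K \<longrightarrow> K \<subseteq> cball a (\<kappa> * r) \<longrightarrow>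
     (\<forall>x\<in>K. \<bar>p x - b\<bar> \<le> s) \<longrightarrow>
     set_lebesgue_integral lborel (interior K) (\<lambda>x::real^'n. (norm (gradient p x))\<^sup>2) \<le> Cb * r ^ (CARD('n) - 2) * s\<^sup>2"
    using poly_inverse_inequality[OF d \<kappa>, of m] by (elim exE conjE) (rule that)
  define C1 where "C1 = sqrt (2 + 4 * (2 * \<kappa>) ^ (CARD('n) - 1) * real (CARD('n) + 1) * Ca)"
  define C2 where "C2 = sqrt (2 + 4 * (Cb + 4 * (2 * \<kappa>) ^ (CARD('n) - 1) * real (CARD('n) + 1)) *
      (overlap_bound \<kappa> N CARD('n) ^ 5 * (4 * (\<kappa> / (2 / CARD('n)) ^ (CARD('n) - 1)))))"
  have pos: "C1 > 0" "C2 > 0"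
    unfolding C1_def C2_def overlap_bound_def using \<kappa> Ca(1) Cb(1)
    by (auto intro!: add_pos_nonneg mult_nonneg_nonneg add_nonneg_nonneg)
  have bounds: "dg_norm \<T> v \<le> C1 * dg_norm \<T> (reconstruction m N \<T> v) \<and>
      dg_norm \<T> (reconstruction m N \<T> v) \<le> C2 * \<Lambda>_bar m N \<T> * dg_norm \<T> v"
    if mesh: "simplicial_mesh \<Omega> \<T>" "quasi_uniform C\<sigma> \<T>" "patches_exist N \<T>" "unisolvent m N \<T>"
      and v: "v \<in> piecewise_const \<T>" for \<T> v
  proof -
    define r where "r = mesh_size \<T> / (2 * C\<sigma>)"
    have ne: "\<T> \<noteq> {}" and "regular_mesh \<Omega> \<T> r \<kappa>"
      using quasi_uniform_regular_mesh[OF d assms(2,4) mesh(1,2)] by (auto simp: r_def \<kappa>_def)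
    then interpret reconstruction_mesh \<Omega> \<T> r \<kappa> m N
      using mesh by (intro reconstruction_mesh.intro reconstruction_mesh_axioms.intro)
    have "dg_norm \<T> v \<le> C1 * dg_norm \<T> (reconstruction m N \<T> v)"
      unfolding C1_def
      by (rule dg_norm_le_reconstruction[OF _ Ca(1) v]) (use Ca(2) r_pos in \<open>simp add: grad_energy_def\<close>)
    moreover have "dg_norm \<T> (reconstruction m N \<T> v) \<le> C2 * \<Lambda>_bar m N \<T> * dg_norm \<T> v"
      unfolding C2_def
      by (rule reconstruction_le_dg_norm[OF _ Cb(1) v ne]) (use Cb(2) r_pos in \<open>simp add: grad_energy_def\<close>)
    ultimately show ?thesis ..
  qed
  show ?thesis
    using pos bounds by (intro exI[of _ C1] exI[of _ C2] conjI allI impI ballI) auto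
qed

end
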